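(* Let $\Lambda\subset\mathbb{D}$ be a discrete set, let $f:\mathbb{D}\setminus\Lambda\to\mathbb{C}$, and fix an integer $\kappa\ge 0$. The following are equivalent: (1) $f\in\mathcal{S}_\kappa$. (2) $f$ admits an extension to a standard function with $\ell$ jumps, for some $0\le\ell\le\kappa$, and $\kappa-\ell$ poles (counted with multiplicity), and all jumps of this standard function lie in $\mathbb{D}\setminus\Lambda$. (3) There is an integer $n\ge 0$ such that $\mathbf{k}_n(f)=\mathbf{k}_{n+3}(f)=\kappa$.
   Context: $\mathbb{D}$ is the open unit disk. A set $\Lambda\subset\mathbb{D}$ is discrete if it is at most countable with accumulation points (if any) only on the unit circle. A Schur function is an analytic $S:\mathbb{D}\to\mathbb{C}$ with $|S|\le1$. A (finite) Blaschke product is a rational function analytic on $\mathbb{D}$ and unimodular on the unit circle; its degree is its number of zeros in $\mathbb{D}$ counted with multiplicity. For a function $f$ with domain $\mathrm{Dom}(f)\subseteq\mathbb{D}$ and distinct points $z_1,\dots,z_n\in\mathrm{Dom}(f)$, the Pick matrix is $P_n(f;z_1,\dots,z_n)=\left[\frac{1-f(z_i)\overline{f(z_j)}}{1-z_i\overline{z_j}}\right]_{i,j=1}^n$. For a Hermitian matrix $P$, $\mathrm{sq}_-P$ is its number of negative eigenvalues counted with multiplicity. $\mathbf{k}_n(f)=\max\,\mathrm{sq}_-P_n(f;z_1,\dots,z_n)$ over all distinct $z_1,\dots,z_n\in\mathrm{Dom}(f)$, and $\mathbf{k}_0(f)=0$. The class $\mathcal{S}_\kappa$ consists of functions $f$ defined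 on $\mathbb{D}\setminus\Lambda$ for some discrete $\Lambda$ such that every Pick matrix of $f$ (at distinct points of $\mathbb{D}\setminus\Lambda$) has at most $\kappa$ negative eigenvalues and at least one has exactly $\kappa$. A function $g$ is an extension of $f$ if $\mathrm{Dom}(g)\supseteq\mathrm{Dom}(f)$ and $g=f$ on $\mathrm{Dom}(f)$. A standard function is a function of the form $f(z)=S(z)/B(z)$ for $z\notin\mathcal{W}\cup\mathcal{Z}$ and $f(z_j)=\gamma_j$ for $z_j\in\mathcal{Z}$, where: $\mathcal{Z}=\{z_1,\dots,z_\ell\}$ and $\mathcal{W}=\{w_1,\dots,w_p\}$ are disjoint sets of distinct points of $\mathbb{D}$; $\gamma_1,\dots,\gamma_\ell\in\mathbb{C}$; $B$ is a Blaschke product of degree $q\ge0$ and $S$ is a Schur function with $\mathcal{W}\subseteq Z(B)\subseteq\mathcal{W}\cup\mathcal{Z}$ and $Z(B)\cap Z(S)=\emptyset$ ($Z(\cdot)$ = zero set); and if $z_j\in\mathcal{Z}\setminus Z(B)$ then $S(z_j)/B(z_j)\ne\gamma_j$. Its domain is $\mathbb{D}\setminus\mathcal{W}$. Such $f$ is said to have $q$ poles (zeros of $B$ with multiplicity) and $\ell$ jumps $z_1,\dots,z_\ell$ (poles and jumps may coincide). *)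

theory Defs
  imports "HOL-Complex_Analysis.Complex_Analysis" "Jordan_Normal_Form.Char_Poly"
begin

abbreviation unit_disk :: "complex set" where
  "unit_disk \<equiv> ball 0 1"

definition discrete_in_disk :: "complex set \<Rightarrow> bool" where
  "discrete_in_disk L \<longleftrightarrow> L \<subseteq> unit_disk \<and> countable L \<and>
     (\<forall>z\<in>unit_disk. \<not> z islimpt L)"

definition schur_function :: "(complex \<Rightarrow> complex) \<Rightarrow> bool" where
  "schur_function S \<longleftrightarrow> S holomorphic_on unit_disk \<and> (\<forall>z\<in>unit_disk. cmod (S z) \<le> 1)"

definition blaschke_product_deg :: "(complex \<Rightarrow> complex) \<Rightarrow> nat \<Rightarrow> bool" where
  "blaschke_product_deg B q \<longleftrightarrow>
     (\<exists>p r :: complex poly.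
        r \<noteq> 0 \<and>
        (\<forall>z. poly r z \<noteq> 0 \<longrightarrow> B z = poly p z / poly r z) \<and>
        (\<forall>z. cmod z \<le> 1 \<longrightarrow> poly r z \<noteq> 0) \<and>
        (\<forall>z. cmod z = 1 \<longrightarrow> cmod (B z) = 1) \<and>
        size (filter_mset (\<lambda>z. z \<in> unit_disk) (proots p)) = q)"

definition zero_set :: "(complex \<Rightarrow> complex) \<Rightarrow> complex set" where
  "zero_set F = {z \<in> unit_disk. F z = 0}"

text \<open>g is a standard function with data (W, Z, gamma, B, S) having q poles:
  g = S/B off W \<union> Z, g = gamma on Z; domain of g is the disk minus W.\<close>
definition standard_function ::
  "(complex \<Rightarrow> complex) \<Rightarrow> complex set \<Rightarrow> complex set \<Rightarrow> (complex \<Rightarrow> complex) \<Rightarrow>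
   (complex \<Rightarrow> complex) \<Rightarrow> (complex \<Rightarrow> complex) \<Rightarrow> nat \<Rightarrow> bool" where
  "standard_function g W Z gamma B S q \<longleftrightarrow>
     finite Z \<and> finite W \<and> Z \<subseteq> unit_disk \<and> W \<subseteq> unit_disk \<and> Z \<inter> W = {} \<and>
     blaschke_product_deg B q \<and> schur_function S \<and>
     W \<subseteq> zero_set B \<and> zero_set B \<subseteq> W \<union> Z \<and> zero_set B \<inter> zero_set S = {} \<and>
     (\<forall>z\<in>Z - zero_set B. S z / B z \<noteq> gamma z) \<and>
     (\<forall>z\<in>unit_disk - (W \<union> Z). g z = S z / B z) \<and>
     (\<forall>z\<in>Z. g z = gamma z)"

definition pick_matrix :: "(complex \<Rightarrow> complex) \<Rightarrow> complex list \<Rightarrow> complex mat" where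
  "pick_matrix f zs = mat (length zs) (length zs)
     (\<lambda>(i, j). (1 - f (zs ! i) * cnj (f (zs ! j))) / (1 - zs ! i * cnj (zs ! j)))"

definition sq_minus :: "complex mat \<Rightarrow> nat" where
  "sq_minus A = size (filter_mset (\<lambda>x. x \<in> \<real> \<and> Re x < 0) (proots (char_poly A)))"

definition k_num :: "complex set \<Rightarrow> (complex \<Rightarrow> complex) \<Rightarrow> nat \<Rightarrow> nat" where
  "k_num Dom f n = (if n = 0 then 0 else
     Max {sq_minus (pick_matrix f zs) | zs. length zs = n \<and> distinct zs \<and> set zs \<subseteq> Dom})"

definition in_S_kappa :: "nat \<Rightarrow> complex set \<Rightarrow> (complex \<Rightarrow> complex) \<Rightarrow> bool" where
  "in_S_kappa \<kappa> Dom f \<longleftrightarrow>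
     (\<forall>zs. distinct zs \<and> set zs \<subseteq> Dom \<longrightarrow> sq_minus (pick_matrix f zs) \<le> \<kappa>) \<and>
     (\<exists>zs. distinct zs \<and> set zs \<subseteq> Dom \<and> sq_minus (pick_matrix f zs) = \<kappa>)"

end

theory Submission
  imports Defs "Jordan_Normal_Form.Jordan_Normal_Form_Existence"
begin

text \<open>
  The function is treated as a map into the projective line, given by a pair (a, b) with f = b/a and
  kernel (a(z) a(w)* - b(z) b(w)*) / (1 - z w*). If a finite set F of n points carries the full
  negative index and no n + 3 points carry more, one eliminates the points of F one at a time: the
  Schur complement of the kernel at a point p with |a(p)| different from |b(p)| is the kernel of
  another pair, obtained by a Moebius transformation and a Blaschke factor. The degenerate case
  |a(p)| = |b(p)| is avoided by replacing b with r b, r < 1, which changes the kernel by a small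
  positive one, and letting r tend to 1. When F is exhausted all three-point Pick matrices are
  positive semidefinite, and Hindmarsh's theorem yields a Schur function. Going back through the
  eliminations, Rouche's theorem counts the poles and coincidences at p count the jumps; their sum
  increases by one exactly at pivots with |a(p)| < |b(p)|.
\<close>

section \<open>Negative index of Hermitian kernels\<close>

text \<open>Pairs are forced by the pivots with |a(p)| < |b(p)|: there the Schur complement changes
  sign, numerator and denominator trade places, and a finite value may turn into an infinite one.
  Both components of the new pair vanish at p, so p has to join the exceptional set; this is why the
  induction runs over arbitrary discrete sets. The constant 3 is what survives the eliminations:
  every pivot costs one point of F and one of the n + 3 points in the upper bound. Of the remaining
  three, one serves as the point of differentiation and the other two compare difference quotients
  there. The passage from r < 1 to r = 1 uses no normal families. Representations for different r
  satisfy a common cross-multiplied equation, so a single one, rescaled, already represents the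
  limit with the same poles and jumps, and only the bound by 1 remains to be shown. The index is
  measured by negative subspaces, which behave well under restriction, congruence and monotone
  change of the form; eigenvalues enter only in the comparison with Pick matrices.\<close>

definition qform :: "('a \<Rightarrow> 'a \<Rightarrow> complex) \<Rightarrow> 'a set \<Rightarrow> ('a \<Rightarrow> complex) \<Rightarrow> real" where
  "qform K G x = Re (\<Sum>z\<in>G. \<Sum>w\<in>G. x z * K z w * cnj (x w))"

text \<open>A combination with a nonzero coefficient that vanished on \<open>G\<close> would have
  form value 0, so the vectors are automatically independent on \<open>G\<close> and
  \<open>card I\<close> is the dimension of a negative subspace. The numbers in \<open>I\<close> are
  mere labels, which makes it easy to discard or add a vector.\<close>

definition neg_family ::
  "('a \<Rightarrow> 'a \<Rightarrow> complex) \<Rightarrow> 'a set \<Rightarrow> nat set \<Rightarrow> (nat \<Rightarrow> 'a \<Rightarrow> complex) \<Rightarrow> bool" where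
  "neg_family K G I v \<longleftrightarrow> finite I \<and>
     (\<forall>c. (\<exists>i\<in>I. c i \<noteq> 0) \<longrightarrow> qform K G (\<lambda>z. \<Sum>i\<in>I. c i * v i z) < 0)"

definition neg_dim_ge :: "('a \<Rightarrow> 'a \<Rightarrow> complex) \<Rightarrow> 'a set \<Rightarrow> nat \<Rightarrow> bool" where
  "neg_dim_ge K G k \<longleftrightarrow> (\<exists>I v. card I = k \<and> neg_family K G I v)"

lemma qform_cong:
  assumes "\<And>z. z \<in> G \<Longrightarrow> x z = y z" "\<And>z w. z \<in> G \<Longrightarrow> w \<in> G \<Longrightarrow> K z w = K' z w"
  shows "qform K G x = qform K' G y"
  unfolding qform_def using assms by (intro arg_cong[of _ _ Re] sum.cong) auto

lemma qform_zero [simp]: "qform K G (\<lambda>_. 0) = 0"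
  by (simp add: qform_def)

lemma qform_add_kernel:
  "qform (\<lambda>z w. K z w + K' z w) G x = qform K G x + qform K' G x"
  unfolding qform_def plus_complex.sel(1)[symmetric]
  by (intro arg_cong[of _ _ Re]) (simp add: algebra_simps sum.distrib)

lemma qform_diff_kernel:
  "qform (\<lambda>z w. K z w - K' z w) G x = qform K G x - qform K' G x"
  unfolding qform_def minus_complex.sel(1)[symmetric]
  by (intro arg_cong[of _ _ Re]) (simp add: algebra_simps sum_subtractf)

lemma qform_congruence:
  "qform (\<lambda>z w. c z * K z w * cnj (c w)) G x = qform K G (\<lambda>z. x z * c z)"
  unfolding qform_def by (intro arg_cong[of _ _ Re] sum.cong) (auto simp: mult_ac)

lemma qform_rank_one:
  "qform (\<lambda>z w. e z * cnj (e w)) G x = (cmod (\<Sum>z\<in>G. x z * e z))\<^sup>2"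
proof -
  have "(\<Sum>z\<in>G. \<Sum>w\<in>G. x z * (e z * cnj (e w)) * cnj (x w)) =
      (\<Sum>z\<in>G. x z * e z) * cnj (\<Sum>z\<in>G. x z * e z)"
    by (simp add: sum_product mult_ac)
  also have "\<dots> = complex_of_real ((cmod (\<Sum>z\<in>G. x z * e z))\<^sup>2)"
    by (simp only: complex_norm_square)
  finally show ?thesis
    unfolding qform_def by (simp only: Re_complex_of_real)
qed

lemma qform_scale_kernel:
  "qform (\<lambda>z w. complex_of_real c * K z w) G x = c * qform K G x"
proof -
  have "(\<Sum>z\<in>G. \<Sum>w\<in>G. x z * (complex_of_real c * K z w) * cnj (x w))
      = complex_of_real c * (\<Sum>z\<in>G. \<Sum>w\<in>G. x z * K z w * cnj (x w))"
    by (simp add: sum_distrib_left mult_ac)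
  then show ?thesis unfolding qform_def by simp
qed

lemma qform_scale_vector: "qform K G (\<lambda>z. c * x z) = (cmod c)\<^sup>2 * qform K G x"
proof -
  have "qform K G (\<lambda>z. c * x z) = qform (\<lambda>z w. complex_of_real ((cmod c)\<^sup>2) * K z w) G x"
    unfolding qform_def by (intro arg_cong[of _ _ Re] sum.cong)
      (auto simp del: of_real_power simp: complex_norm_square mult_ac)
  then show ?thesis by (simp only: qform_scale_kernel)
qed

lemma neg_familyD:
  assumes "neg_family K G I v" "i \<in> I" "c i \<noteq> 0"
  shows "qform K G (\<lambda>z. \<Sum>i\<in>I. c i * v i z) < 0"
  using assms unfolding neg_family_def by blast

lemma neg_family_form_mono:
  assumes "neg_family K G I v" "\<And>x. qform K' G' x \<le> qform K G x"
  shows "neg_family K' G' I v"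
  unfolding neg_family_def
proof (intro conjI allI impI)
  show "finite I" using assms(1) by (simp add: neg_family_def)
  fix c :: "nat \<Rightarrow> complex" assume "\<exists>i\<in>I. c i \<noteq> 0"
  then have "qform K G (\<lambda>z. \<Sum>i\<in>I. c i * v i z) < 0"
    using neg_familyD[OF assms(1)] by blast
  with assms(2) show "qform K' G' (\<lambda>z. \<Sum>i\<in>I. c i * v i z) < 0"
    by (rule order_le_less_trans)
qed

lemma neg_family_mono:
  assumes "neg_family K G I v" "\<And>x. qform K' G' (\<lambda>z. if z \<in> G then x z else 0) \<le> qform K G x"
  shows "neg_family K' G' I (\<lambda>i z. if z \<in> G then v i z else 0)"
  unfolding neg_family_def
proof (intro conjI allI impI)
  show "finite I" using assms(1) by (simp add: neg_family_def)
  fix c :: "nat \<Rightarrow> complex" assume "\<exists>i\<in>I. c i \<noteq> 0"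
  then have "qform K G (\<lambda>z. \<Sum>i\<in>I. c i * v i z) < 0"
    using neg_familyD[OF assms(1)] by blast
  moreover have "(\<lambda>z. \<Sum>i\<in>I. c i * (if z \<in> G then v i z else 0)) =
      (\<lambda>z. if z \<in> G then (\<Sum>i\<in>I. c i * v i z) else 0)" by auto
  ultimately show "qform K' G' (\<lambda>z. \<Sum>i\<in>I. c i * (if z \<in> G then v i z else 0)) < 0"
    using assms(2)[of "\<lambda>z. \<Sum>i\<in>I. c i * v i z"] by auto
qed

lemma qform_extend_zero:
  assumes "G \<subseteq> G'" "finite G'"
  shows "qform K G' (\<lambda>z. if z \<in> G then x z else 0) = qform K G x"
proof -
  have "(\<Sum>z\<in>G'. \<Sum>w\<in>G'. (if z \<in> G then x z else 0) * K z w * cnj (if w \<in> G then x w else 0)) =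
        (\<Sum>z\<in>G. \<Sum>w\<in>G'. (if z \<in> G then x z else 0) * K z w * cnj (if w \<in> G then x w else 0))"
    using assms by (intro sum.mono_neutral_right) auto
  also have "\<dots> = (\<Sum>z\<in>G. \<Sum>w\<in>G. (if z \<in> G then x z else 0) * K z w * cnj (if w \<in> G then x w else 0))"
    using assms by (intro sum.cong sum.mono_neutral_right) auto
  finally show ?thesis unfolding qform_def by simp
qed

lemma neg_dim_ge_mono_set:
  assumes "neg_dim_ge K G k" "G \<subseteq> G'" "finite G'"
  shows "neg_dim_ge K G' k"
  using assms(1) neg_family_mono[of K G _ _ K G'] qform_extend_zero[OF assms(2,3), of K]
  unfolding neg_dim_ge_def by fastforce

lemma neg_dim_ge_mono_form:
  assumes "neg_dim_ge K G k" "\<And>x. qform K' G' x \<le> qform K G x"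
  shows "neg_dim_ge K' G' k"
  using assms(1) neg_family_form_mono[OF _ assms(2)] unfolding neg_dim_ge_def by blast

lemma neg_family_subset:
  assumes "neg_family K G I v" "J \<subseteq> I"
  shows "neg_family K G J v"
  unfolding neg_family_def
proof (intro conjI allI impI)
  show fJ: "finite J" using assms finite_subset by (auto simp: neg_family_def)
  fix c :: "nat \<Rightarrow> complex" assume "\<exists>i\<in>J. c i \<noteq> 0"
  then obtain i where i: "i \<in> J" "c i \<noteq> 0" by blast
  then have "qform K G (\<lambda>z. \<Sum>i\<in>I. (if i \<in> J then c i else 0) * v i z) < 0"
    using assms(2) by (intro neg_familyD[OF assms(1), of i]) auto
  moreover have "(\<Sum>i\<in>I. (if i \<in> J then c i else 0) * v i z) = (\<Sum>i\<in>J. c i * v i z)" for z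
    using assms by (intro sum.mono_neutral_cong_right) (auto simp: neg_family_def)
  ultimately show "qform K G (\<lambda>z. \<Sum>i\<in>J. c i * v i z) < 0" by simp
qed

lemma neg_dim_ge_decrease:
  assumes "neg_dim_ge K G k" "j \<le> k"
  shows "neg_dim_ge K G j"
proof -
  obtain I v where I: "card I = k" "neg_family K G I v"
    using assms by (auto simp: neg_dim_ge_def)
  obtain J where "J \<subseteq> I" "card J = j"
    using obtain_subset_with_card_n[of j I] assms(2) I(1) by auto
  then show ?thesis
    using neg_family_subset[OF I(2)] by (auto simp: neg_dim_ge_def)
qed

lemma neg_dim_ge_0 [simp]: "neg_dim_ge K G 0"
  unfolding neg_dim_ge_def neg_family_def by (intro exI[of _ "{}"]) auto

lemma neg_dim_ge_Suc_0: "neg_dim_ge K G (Suc 0) \<longleftrightarrow> (\<exists>x. qform K G x < 0)"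
proof
  assume "neg_dim_ge K G (Suc 0)"
  then obtain I v where I: "card I = Suc 0" "neg_family K G I v"
    by (auto simp: neg_dim_ge_def)
  then obtain i where "I = {i}" by (auto simp: card_Suc_eq)
  then have "qform K G (\<lambda>z. \<Sum>i\<in>I. 1 * v i z) < 0"
    by (intro neg_familyD[OF I(2), of i]) auto
  then show "\<exists>x. qform K G x < 0" by blast
next
  assume "\<exists>x. qform K G x < 0"
  then obtain x where x: "qform K G x < 0" by blast
  have "neg_family K G {0} (\<lambda>_. x)"
    using x by (auto simp: neg_family_def qform_scale_vector mult_less_0_iff)
  then show "neg_dim_ge K G (Suc 0)"
    unfolding neg_dim_ge_def by (intro exI[of _ "{0}"]) auto
qed

lemma not_neg_dim_ge_1_iff: "\<not> neg_dim_ge K G (Suc 0) \<longleftrightarrow> (\<forall>x. qform K G x \<ge> 0)"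
  by (auto simp: neg_dim_ge_Suc_0 not_less)

text \<open>A linear functional cuts a negative subspace in codimension at most one: unless it
  vanishes on the whole family, one vector with nonzero value is used to correct the others. The
  last clause says that functionals already annihilated stay so, which lets the step be
  iterated.\<close>

lemma neg_family_kernel:
  assumes "neg_family K G I v" "card I = Suc k"
  shows "\<exists>J w. card J = k \<and> neg_family K G J w \<and> (\<forall>j\<in>J. (\<Sum>z\<in>G. w j z * e z) = 0) \<and>
     (\<forall>e'. (\<forall>i\<in>I. (\<Sum>z\<in>G. v i z * e' z) = 0) \<longrightarrow> (\<forall>j\<in>J. (\<Sum>z\<in>G. w j z * e' z) = 0))"
proof (cases "\<forall>i\<in>I. (\<Sum>z\<in>G. v i z * e z) = 0")
  case True
  obtain J where "J \<subseteq> I" "card J = k"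
    using obtain_subset_with_card_n[of k I] assms(2) by auto
  with True assms show ?thesis
    by (intro exI[of _ J] exI[of _ v]) (auto intro: neg_family_subset)
next
  case False
  define \<phi> where "\<phi> i = (\<Sum>z\<in>G. v i z * e z)" for i
  from False obtain m where m: "m \<in> I" "\<phi> m \<noteq> 0" by (auto simp: \<phi>_def)
  define w where "w i z = v i z - \<phi> i / \<phi> m * v m z" for i z
  have fin: "finite I" using assms by (simp add: neg_family_def)
  have w_sum: "(\<Sum>z\<in>G. w j z * e' z) =
      (\<Sum>z\<in>G. v j z * e' z) - \<phi> j / \<phi> m * (\<Sum>z\<in>G. v m z * e' z)" for j e'
    by (simp add: w_def algebra_simps sum_subtractf sum_distrib_left)
  have "neg_family K G (I - {m}) w"
    unfolding neg_family_def
  proof (intro conjI allI impI)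
    show "finite (I - {m})" using fin by simp
    fix c :: "nat \<Rightarrow> complex" assume c: "\<exists>i\<in>I-{m}. c i \<noteq> 0"
    \<comment> \<open>The coefficient at \<open>m\<close> is the one that rewrites the combination
      of the \<open>w i\<close> as a combination of the original vectors.\<close>
    define c' where "c' = c(m := - (\<Sum>i\<in>I-{m}. c i * (\<phi> i / \<phi> m)))"
    have eq: "(\<lambda>z. \<Sum>i\<in>I. c' i * v i z) = (\<lambda>z. \<Sum>i\<in>I-{m}. c i * w i z)"
    proof
      fix z
      have "(\<Sum>i\<in>I. c' i * v i z) = c' m * v m z + (\<Sum>i\<in>I-{m}. c' i * v i z)"
        using m fin by (simp add: sum.remove)
      also have "(\<Sum>i\<in>I-{m}. c' i * v i z) = (\<Sum>i\<in>I-{m}. c i * v i z)"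
        by (intro sum.cong) (auto simp: c'_def)
      finally show "(\<Sum>i\<in>I. c' i * v i z) = (\<Sum>i\<in>I-{m}. c i * w i z)"
        by (simp add: w_def c'_def right_diff_distrib sum_subtractf sum_distrib_right mult.assoc)
    qed
    have "\<exists>i\<in>I. c' i \<noteq> 0" using c by (auto simp: c'_def)
    then have "qform K G (\<lambda>z. \<Sum>i\<in>I. c' i * v i z) < 0"
      using neg_familyD[OF assms(1)] by blast
    then show "qform K G (\<lambda>z. \<Sum>i\<in>I-{m}. c i * w i z) < 0"
      by (simp only: eq)
  qed
  moreover have "card (I - {m}) = k" using m assms fin by simp
  moreover have "(\<Sum>z\<in>G. w j z * e z) = 0" for j
    using m(2) by (simp add: w_sum flip: \<phi>_def)
  moreover have "(\<Sum>z\<in>G. w j z * e' z) = 0"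
    if "\<forall>i\<in>I. (\<Sum>z\<in>G. v i z * e' z) = 0" "j \<in> I - {m}" for e' j
    using that m(1) by (simp add: w_sum)
  ultimately show ?thesis by blast
qed

lemma neg_family_kernel_list:
  assumes "neg_family K G I v" "card I = k + length es"
  shows "\<exists>J w. card J = k \<and> neg_family K G J w \<and> (\<forall>e\<in>set es. \<forall>j\<in>J. (\<Sum>z\<in>G. w j z * e z) = 0)"
  using assms
proof (induction es arbitrary: k)
  case Nil
  then show ?case by auto
next
  case (Cons e es)
  from Cons.IH[of "Suc k"] Cons.prems obtain J w where
    J: "card J = Suc k" "neg_family K G J w" "\<forall>e\<in>set es. \<forall>j\<in>J. (\<Sum>z\<in>G. w j z * e z) = 0" by auto
  from neg_family_kernel[OF J(2,1), of e] obtain J' w' where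
    J': "card J' = k" "neg_family K G J' w'" "\<forall>j\<in>J'. (\<Sum>z\<in>G. w' j z * e z) = 0"
      "\<And>e'. (\<forall>i\<in>J. (\<Sum>z\<in>G. w i z * e' z) = 0) \<Longrightarrow> (\<forall>j\<in>J'. (\<Sum>z\<in>G. w' j z * e' z) = 0)"
    by blast
  then have "\<forall>e'\<in>set (e # es). \<forall>j\<in>J'. (\<Sum>z\<in>G. w' j z * e' z) = 0"
    using J(3) by simp
  with J'(1,2) show ?case by blast
qed

text \<open>A negative subspace of dimension larger than the number of functionals meets their
  common kernel. The bounds by the number of negative eigenvalues, by poles plus jumps and by the
  number of points all arise from a choice of \<open>es\<close>.\<close>

lemma not_neg_dim_ge_if_nonneg_on_kernel:
  assumes "\<And>x. (\<And>e. e \<in> set es \<Longrightarrow> (\<Sum>z\<in>G. x z * e z) = 0) \<Longrightarrow> qform K G x \<ge> 0"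
  shows "\<not> neg_dim_ge K G (Suc (length es))"
proof
  assume "neg_dim_ge K G (Suc (length es))"
  then obtain I v where "neg_family K G I v" "card I = 1 + length es"
    by (auto simp: neg_dim_ge_def)
  from neg_family_kernel_list[OF this] obtain J w where
    J: "card J = 1" "neg_family K G J w" "\<forall>e\<in>set es. \<forall>j\<in>J. (\<Sum>z\<in>G. w j z * e z) = 0" by auto
  then obtain j where j: "J = {j}" by (auto simp: card_1_singleton_iff)
  have "qform K G (\<lambda>z. \<Sum>i\<in>J. 1 * w i z) < 0"
    using j by (intro neg_familyD[OF J(2), of j]) auto
  moreover have "qform K G (w j) \<ge> 0" using assms[of "w j"] J(3) j by auto
  ultimately show False using j by simp
qed

section \<open>Schur complements and the negative index\<close>

definition hermitian_kernel :: "('a \<Rightarrow> 'a \<Rightarrow> complex) \<Rightarrow> bool" where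
  "hermitian_kernel K \<longleftrightarrow> (\<forall>z w. K w z = cnj (K z w))"

definition schur_complement :: "('a \<Rightarrow> 'a \<Rightarrow> complex) \<Rightarrow> 'a \<Rightarrow> 'a \<Rightarrow> 'a \<Rightarrow> complex" where
  "schur_complement K p z w = K z w - K z p * K p w / K p p"

lemma hermitian_kernel_diag: "hermitian_kernel K \<Longrightarrow> K p p = complex_of_real (Re (K p p))"
  by (metis Reals_cnj_iff hermitian_kernel_def of_real_Re)

text \<open>The Schur complement vanishes whenever one argument is \<open>p\<close>, so it does not
  see \<open>x p\<close>. What is left of the form is a rank-one term weighted by the pivot, which
  is real for a hermitian kernel.\<close>

lemma qform_complete_square:
  assumes "hermitian_kernel K" "finite G" "p \<notin> G" "K p p \<noteq> 0"
  shows "qform K (insert p G) x = qform (schur_complement K p) G x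
     + Re (K p p) * (cmod (\<Sum>z\<in>insert p G. x z * (K z p / K p p)))\<^sup>2"
proof -
  have d: "K p p = complex_of_real (Re (K p p))" by (rule hermitian_kernel_diag[OF assms(1)])
  have herm: "K p w = cnj (K w p)" for w
    using assms(1) unfolding hermitian_kernel_def by blast
  have sc0: "schur_complement K p z w = 0" if "z = p \<or> w = p" for z w
    using that assms(4) by (auto simp: schur_complement_def)
  have 1: "qform K (insert p G) x = qform (\<lambda>z w. schur_complement K p z w
      + complex_of_real (Re (K p p)) * ((K z p / K p p) * cnj (K w p / K p p))) (insert p G) x"
  proof (rule qform_cong)
    fix z w
    have "complex_of_real (Re (K p p)) * ((K z p / K p p) * cnj (K w p / K p p)) =
        K p p * (K z p / K p p) * (K p w / cnj (K p p))"
      by (simp add: herm[of w] flip: d)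
    also have "cnj (K p p) = K p p" by (metis herm)
    finally show "K z w = schur_complement K p z w
      + complex_of_real (Re (K p p)) * ((K z p / K p p) * cnj (K w p / K p p))"
      using assms(4) by (simp add: schur_complement_def)
  qed auto
  have 2: "qform (schur_complement K p) (insert p G) x = qform (schur_complement K p) G x"
    unfolding qform_def using assms by (simp add: sc0)
  show ?thesis
    unfolding 1 qform_add_kernel qform_scale_kernel qform_rank_one 2 ..
qed

text \<open>Haynsworth additivity of the negative index for a Schur complement with a single pivot.\<close>

lemma neg_dim_ge_schur_complement_pos:
  assumes "hermitian_kernel K" "finite G" "p \<notin> G" "Re (K p p) > 0" "neg_dim_ge K (insert p G) k"
  shows "neg_dim_ge (schur_complement K p) G k"
proof -
  have nz: "K p p \<noteq> 0" using assms by auto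
  have "qform (schur_complement K p) G x \<le> qform K (insert p G) x" for x
    using qform_complete_square[OF assms(1-3) nz, of x] assms(4) by simp
  with assms(5) show ?thesis by (rule neg_dim_ge_mono_form)
qed

lemma neg_dim_ge_schur_complement_neg:
  assumes "hermitian_kernel K" "finite G" "p \<notin> G" "Re (K p p) < 0" "neg_dim_ge K (insert p G) (Suc k)"
  shows "neg_dim_ge (schur_complement K p) G k"
proof -
  have nz: "K p p \<noteq> 0" using assms by auto
  obtain I v where "neg_family K (insert p G) I v" "card I = Suc k"
    using assms(5) by (auto simp: neg_dim_ge_def)
  from neg_family_kernel[OF this, of "\<lambda>z. K z p / K p p"] obtain J w where
    J: "card J = k" "neg_family K (insert p G) J w"
       "\<forall>j\<in>J. (\<Sum>z\<in>insert p G. w j z * (K z p / K p p)) = 0" by blast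
  have "neg_family (schur_complement K p) G J w"
    unfolding neg_family_def
  proof (intro conjI allI impI)
    show "finite J" using J by (simp add: neg_family_def)
    fix c :: "nat \<Rightarrow> complex" assume c: "\<exists>i\<in>J. c i \<noteq> 0"
    let ?x = "\<lambda>z. \<Sum>i\<in>J. c i * w i z"
    have "(\<Sum>z\<in>insert p G. ?x z * (K z p / K p p)) =
       (\<Sum>z\<in>insert p G. \<Sum>i\<in>J. c i * (w i z * (K z p / K p p)))"
      by (simp only: sum_distrib_right mult.assoc)
    also have "\<dots> = (\<Sum>i\<in>J. c i * (\<Sum>z\<in>insert p G. w i z * (K z p / K p p)))"
      by (subst sum.swap) (simp only: sum_distrib_left)
    also have "\<dots> = 0" using J(3) by simp
    finally have "(\<Sum>z\<in>insert p G. ?x z * (K z p / K p p)) = 0" .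
    then have "qform K (insert p G) ?x = qform (schur_complement K p) G ?x"
      using qform_complete_square[OF assms(1-3) nz, of ?x] by simp
    moreover have "qform K (insert p G) ?x < 0" using c neg_familyD[OF J(2)] by blast
    ultimately show "qform (schur_complement K p) G ?x < 0" by simp
  qed
  with J(1) show ?thesis by (auto simp: neg_dim_ge_def)
qed

text \<open>Each vector is prolonged to \<open>p\<close> by the value \<open>t i\<close> that
  annihilates the square in \<open>qform_complete_square\<close>, so its form value is that of the
  Schur complement. For a negative pivot the unit vector at \<open>p\<close> is an additional
  direction; it contributes the square term alone, without mixed terms.\<close>

lemma neg_dim_ge_from_schur_complement:
  assumes "hermitian_kernel K" "finite G" "p \<notin> G" "K p p \<noteq> 0"
    "neg_dim_ge (schur_complement K p) G k"
  shows "neg_dim_ge K (insert p G) (if Re (K p p) < 0 then Suc k else k)"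
proof -
  obtain I v where I: "card I = k" "neg_family (schur_complement K p) G I v"
    using assms(5) by (auto simp: neg_dim_ge_def)
  then have finI: "finite I" by (simp add: neg_family_def)
  define t where "t i = - (\<Sum>z\<in>G. v i z * (K z p / K p p))" for i
  define v' where "v' i = (v i)(p := t i)" for i
  obtain n where n: "n \<notin> I" using finI ex_new_if_finite infinite_UNIV_nat by blast
  define I' where "I' = (if Re (K p p) < 0 then insert n I else I)"
  define v'' where "v'' = v'(n := (\<lambda>z. if z = p then 1 else 0))"
  have key: "qform K (insert p G) (\<lambda>z. (\<Sum>i\<in>I. c i * v' i z) + s * (if z = p then 1 else 0)) =
     qform (schur_complement K p) G (\<lambda>z. \<Sum>i\<in>I. c i * v i z) + Re (K p p) * (cmod s)\<^sup>2" for c s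
  proof -
    let ?x = "\<lambda>z. (\<Sum>i\<in>I. c i * v' i z) + s * (if z = p then 1 else 0)"
    have xG: "?x z = (\<Sum>i\<in>I. c i * v i z)" if "z \<in> G" for z
      using that assms(3) by (auto simp: v'_def intro!: sum.cong)
    have "(\<Sum>z\<in>insert p G. ?x z * (K z p / K p p)) = ?x p + (\<Sum>z\<in>G. ?x z * (K z p / K p p))"
      using assms by simp
    also have "(\<Sum>z\<in>G. ?x z * (K z p / K p p)) = (\<Sum>z\<in>G. \<Sum>i\<in>I. c i * (v i z * (K z p / K p p)))"
      by (intro sum.cong) (simp_all add: xG sum_distrib_right mult.assoc del: times_divide_eq_right)
    also have "\<dots> = - (\<Sum>i\<in>I. c i * t i)"
      by (subst sum.swap) (simp add: t_def sum_distrib_left sum_negf)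
    finally have "(\<Sum>z\<in>insert p G. ?x z * (K z p / K p p)) = s" by (simp add: v'_def)
    moreover have "qform (schur_complement K p) G ?x = qform (schur_complement K p) G (\<lambda>z. \<Sum>i\<in>I. c i * v i z)"
      by (intro qform_cong xG) auto
    ultimately show ?thesis
      using qform_complete_square[OF assms(1-4), of ?x] by simp
  qed
  have "neg_family K (insert p G) I' v''"
    unfolding neg_family_def
  proof (intro conjI allI impI)
    show "finite I'" using finI by (simp add: I'_def)
    fix c :: "nat \<Rightarrow> complex" assume c: "\<exists>i\<in>I'. c i \<noteq> 0"
    define s where "s = (if Re (K p p) < 0 then c n else 0)"
    have eq: "(\<Sum>i\<in>I'. c i * v'' i z) = (\<Sum>i\<in>I. c i * v' i z) + s * (if z = p then 1 else 0)" for z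
    proof -
      have "(\<Sum>i\<in>I. c i * v'' i z) = (\<Sum>i\<in>I. c i * v' i z)"
        using n by (intro sum.cong) (auto simp: v''_def)
      then show ?thesis using n finI by (simp add: I'_def v''_def s_def)
    qed
    show "qform K (insert p G) (\<lambda>z. \<Sum>i\<in>I'. c i * v'' i z) < 0"
    proof (cases "\<exists>i\<in>I. c i \<noteq> 0")
      case True
      then have "qform (schur_complement K p) G (\<lambda>z. \<Sum>i\<in>I. c i * v i z) < 0"
        using neg_familyD[OF I(2)] by blast
      moreover have "Re (K p p) * (cmod s)\<^sup>2 \<le> 0"
        by (auto simp: s_def mult_le_0_iff)
      ultimately show ?thesis unfolding eq key by simp
    next
      case False
      then have "(\<Sum>i\<in>I. c i * v i z) = 0" for z by (intro sum.neutral) auto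
      moreover have "Re (K p p) < 0" "c n \<noteq> 0"
        using False c by (auto simp: I'_def split: if_splits)
      ultimately show ?thesis unfolding eq key by (auto simp: s_def mult_less_0_iff)
    qed
  qed
  moreover have "card I' = (if Re (K p p) < 0 then Suc k else k)"
    using n finI I(1) by (simp add: I'_def)
  ultimately show ?thesis unfolding neg_dim_ge_def by blast
qed

section \<open>Negative eigenvalues of Hermitian matrices\<close>

text \<open>Prepares the proof that the Jordan form of a hermitian matrix is diagonal: the only
  obstruction is a superdiagonal entry inside one block.\<close>

lemma jordan_matrix_off_diagonal:
  assumes "i < sum_list (map fst n_as)" "j < sum_list (map fst n_as)"
    "jordan_matrix n_as $$ (i, j) \<noteq> 0" "i \<noteq> j"
  shows "j = Suc i \<and> jordan_matrix n_as $$ (i, i) = jordan_matrix n_as $$ (j, j)"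
  using assms
proof (induction n_as arbitrary: i j)
  case Nil
  then show ?case by simp
next
  case (Cons na n_as)
  obtain n a where na: "na = (n, a)" by force
  let ?N = "sum_list (map fst n_as)"
  have entry: "jordan_matrix (na # n_as) $$ (k, l) =
     (if k < n then if l < n then (if k = l then a else if Suc k = l then 1 else 0) else 0
      else if l < n then 0 else jordan_matrix n_as $$ (k - n, l - n))"
    if "k < n + ?N" "l < n + ?N" for k l
    using that by (auto simp: na jordan_matrix_Cons)
  have i: "i < n + ?N" and j: "j < n + ?N" using Cons.prems by (auto simp: na)
  show ?case
  proof (cases "i < n")
    case True
    with Cons.prems(3,4) show ?thesis unfolding entry[OF i j] entry[OF i i] entry[OF j j]
      by (auto split: if_splits)
  next
    case False
    with Cons.prems(3) have jn: "\<not> j < n" unfolding entry[OF i j] by auto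
    have "j - n = Suc (i - n) \<and> jordan_matrix n_as $$ (i - n, i - n) = jordan_matrix n_as $$ (j - n, j - n)"
      using Cons.prems(3,4) False jn i j unfolding entry[OF i j]
      by (intro Cons.IH) auto
    with False jn show ?thesis unfolding entry[OF i i] entry[OF j j] by auto
  qed
qed

lemma proots_prod_list_linear: "proots (\<Prod>a\<leftarrow>xs. [:- a, 1:]) = mset (xs :: complex list)"
proof (induction xs)
  case (Cons a xs)
  have "(\<Prod>a\<leftarrow>xs. [:- a, 1:]) \<noteq> (0 :: complex poly)"
    by (auto simp: prod_list_zero_iff)
  with Cons show ?case by (simp add: proots_mult proots_linear_factor del: mult_pCons_left)
qed simp

text \<open>A spectral theorem without orthonormalisation. The columns of \<open>P\<close> come from
  a Jordan form, \<open>H\<close> is their Gram matrix and \<open>d\<close> lists the real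
  eigenvalues. Orthogonality is recorded only between different eigenvalues, which suffices for
  counting signs because a Gram matrix is positive in any case.\<close>

lemma hermitian_eigenbasis:
  fixes A :: "complex mat"
  assumes A: "A \<in> carrier_mat n n"
    and herm: "\<And>i j. i < n \<Longrightarrow> j < n \<Longrightarrow> A $$ (j, i) = cnj (A $$ (i, j))"
  shows "\<exists>P Q d H. P \<in> carrier_mat n n \<and> Q \<in> carrier_mat n n \<and> P * Q = 1\<^sub>m n \<and> Q * P = 1\<^sub>m n \<and>
    (\<forall>i<n. \<forall>j<n. H i j = (\<Sum>k<n. cnj (P $$ (k, i)) * P $$ (k, j))) \<and>
    (\<forall>i<n. \<forall>j<n.
       (\<Sum>k<n. \<Sum>l<n. cnj (P $$ (k, i)) * A $$ (k, l) * P $$ (l, j)) = H i j * complex_of_real (d j)) \<and>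
    (\<forall>i<n. \<forall>j<n. d i \<noteq> d j \<longrightarrow> H i j = 0) \<and>
    proots (char_poly A) = mset (map (\<lambda>j. complex_of_real (d j)) [0..<n])"
proof -
  obtain as where as: "char_poly A = (\<Prod>a\<leftarrow>as. [:- a, 1:])"
    using char_poly_factorized[OF A] by blast
  obtain n_as where jnf: "jordan_nf A n_as" using jordan_nf_exists[OF A as] by blast
  define J where "J = jordan_matrix n_as"
  obtain P Q where wit: "similar_mat_wit A J P Q"
    using jnf unfolding jordan_nf_def similar_mat_def J_def by blast
  note w = similar_mat_witD2[OF A wit]
  have P: "P \<in> carrier_mat n n" and Q: "Q \<in> carrier_mat n n" and J: "J \<in> carrier_mat n n"
    and PQ: "P * Q = 1\<^sub>m n" and QP: "Q * P = 1\<^sub>m n" and APJ: "A = P * J * Q" using w by auto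
  have N: "sum_list (map fst n_as) = n" using J unfolding J_def by (metis carrier_matD(1) jordan_matrix_dim(1))
  have offd: "j = Suc i \<and> J $$ (i, i) = J $$ (j, j)"
    if "i < n" "j < n" "J $$ (i, j) \<noteq> 0" "i \<noteq> j" for i j
    using jordan_matrix_off_diagonal[of i n_as j] that by (simp add: N J_def)
  have AP: "A * P = P * J"
  proof -
    have "A * P = P * J * (Q * P)" unfolding APJ using P Q J by (simp add: assoc_mult_mat[of _ n n _ n _ n])
    then show ?thesis using P J by (simp add: QP)
  qed
  have APe: "(\<Sum>l<n. A $$ (k, l) * P $$ (l, j)) = (\<Sum>m<n. P $$ (k, m) * J $$ (m, j))"
    if "k < n" "j < n" for k j
  proof -
    have "(A * P) $$ (k, j) = (P * J) $$ (k, j)" by (simp only: AP)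
    then show ?thesis using that A P J by (simp add: scalar_prod_def atLeast0LessThan)
  qed
  define H where "H i j = (\<Sum>k<n. cnj (P $$ (k, i)) * P $$ (k, j))" for i j
  define g where "g i j = (\<Sum>k<n. \<Sum>l<n. cnj (P $$ (k, i)) * A $$ (k, l) * P $$ (l, j))" for i j
  have gH: "g i j = (\<Sum>m<n. H i m * J $$ (m, j))" if "i < n" "j < n" for i j
  proof -
    have "g i j = (\<Sum>k<n. cnj (P $$ (k, i)) * (\<Sum>l<n. A $$ (k, l) * P $$ (l, j)))"
      by (simp add: g_def sum_distrib_left mult.assoc)
    also have "\<dots> = (\<Sum>k<n. \<Sum>m<n. cnj (P $$ (k, i)) * (P $$ (k, m) * J $$ (m, j)))"
      using that by (simp add: APe sum_distrib_left)
    also have "\<dots> = (\<Sum>m<n. H i m * J $$ (m, j))"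
      by (subst sum.swap) (simp add: H_def sum_distrib_right mult.assoc)
    finally show ?thesis .
  qed
  have g_herm: "g i j = cnj (g j i)" if "i < n" "j < n" for i j
  proof -
    have "cnj (g j i) = (\<Sum>k<n. \<Sum>l<n. P $$ (k, j) * cnj (A $$ (k, l)) * cnj (P $$ (l, i)))"
      by (simp add: g_def)
    also have "\<dots> = (\<Sum>k<n. \<Sum>l<n. P $$ (k, j) * A $$ (l, k) * cnj (P $$ (l, i)))"
      by (intro sum.cong refl) (simp add: herm[symmetric])
    also have "\<dots> = g i j"
      unfolding g_def by (subst sum.swap) (simp add: mult_ac)
    finally show ?thesis ..
  qed
  have H_herm: "H i j = cnj (H j i)" for i j by (simp add: H_def mult_ac)
  have H_nz: "H j j \<noteq> 0" if "j < n" for j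
  proof
    assume "H j j = 0"
    moreover have "H j j = complex_of_real (\<Sum>k<n. (cmod (P $$ (k, j)))\<^sup>2)"
      unfolding H_def by (simp del: of_real_power add: complex_norm_square mult_ac)
    ultimately have "(\<Sum>k<n. (cmod (P $$ (k, j)))\<^sup>2) = 0" by (simp only: of_real_eq_0_iff)
    then have z: "P $$ (k, j) = 0" if "k < n" for k
      using that by (simp add: sum_nonneg_eq_0_iff)
    have "(Q * P) $$ (j, j) = (\<Sum>k<n. Q $$ (j, k) * P $$ (k, j))"
      using that P Q by (simp add: scalar_prod_def atLeast0LessThan)
    then show False using that by (simp add: QP z)
  qed
  have diag_col: "g i j = H i j * J $$ (j, j)"
    if "i < n" "j < n" "\<And>m. m < n \<Longrightarrow> m \<noteq> j \<Longrightarrow> J $$ (m, j) = 0" for i j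
  proof -
    have "(\<Sum>m<n. H i m * J $$ (m, j)) = (\<Sum>m\<in>{j}. H i m * J $$ (m, j))"
      using that by (intro sum.mono_neutral_right) auto
    then show ?thesis using gH that by simp
  qed
  \<comment> \<open>In terms of the columns v_j of \<open>P\<close>: by induction v_j is an
    eigenvector, and its eigenvalue is real. An entry c here would give A v_(j+1) = lambda v_(j+1) +
    c v_j; pairing with v_j and moving A to the other side leaves c |v_j|^2 = 0.\<close>
  have super0: "Suc j < n \<Longrightarrow> J $$ (j, Suc j) = 0" for j
  proof (induction j rule: less_induct)
    case (less j)
    have jn: "j < n" using less.prems by simp
    have col: "J $$ (m, j) = 0" if "m < n" "m \<noteq> j" for m
      using offd[of m j] less.IH[of m] that jn by fastforce
    show ?case
    proof (rule ccontr)
      assume nz: "J $$ (j, Suc j) \<noteq> 0"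
      then have eq: "J $$ (j, j) = J $$ (Suc j, Suc j)" using offd[of j "Suc j"] less.prems by simp
      have gj: "g i j = H i j * J $$ (j, j)" if "i < n" for i
        using diag_col[OF that jn col] by simp
      have "H j j * J $$ (j, j) = cnj (H j j * J $$ (j, j))"
        using gj[OF jn] g_herm[OF jn jn] by simp
      then have real: "cnj (J $$ (j, j)) = J $$ (j, j)"
        using H_herm[of j j] H_nz[OF jn] by (metis complex_cnj_mult mult_left_cancel)
      have "(\<Sum>m<n. H j m * J $$ (m, Suc j)) = (\<Sum>m\<in>{j, Suc j}. H j m * J $$ (m, Suc j))"
      proof (rule sum.mono_neutral_right)
        show "\<forall>m\<in>{..<n} - {j, Suc j}. H j m * J $$ (m, Suc j) = 0"
          using offd[OF _ less.prems] by fastforce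
      qed (use less.prems in auto)
      then have "g j (Suc j) = H j j * J $$ (j, Suc j) + H j (Suc j) * J $$ (j, j)"
        using gH[OF jn less.prems] eq by simp
      moreover have "g j (Suc j) = cnj (H (Suc j) j * J $$ (j, j))"
        using g_herm[OF jn less.prems] gj[OF less.prems] by simp
      ultimately have "H j j * J $$ (j, Suc j) = 0"
        using real H_herm[of j "Suc j"] by simp
      with nz H_nz[OF jn] show False by simp
    qed
  qed
  have Jdiag: "J $$ (i, j) = 0" if "i < n" "j < n" "i \<noteq> j" for i j
    using offd[OF that(1,2) _ that(3)] super0[of i] that by blast
  have gd: "g i j = H i j * J $$ (j, j)" if "i < n" "j < n" for i j
    using diag_col[OF that] Jdiag that by blast
  define d where "d j = Re (J $$ (j, j))" for j
  have real: "J $$ (j, j) = complex_of_real (d j)" if "j < n" for j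
  proof -
    have "H j j * J $$ (j, j) = cnj (H j j * J $$ (j, j))"
      using gd[OF that that] g_herm[OF that that] by simp
    then have "cnj (J $$ (j, j)) = J $$ (j, j)"
      using H_herm[of j j] H_nz[OF that] by (metis complex_cnj_mult mult_left_cancel)
    then show ?thesis unfolding d_def by (metis Reals_cnj_iff of_real_Re)
  qed
  have orth: "H i j = 0" if "i < n" "j < n" "d i \<noteq> d j" for i j
  proof -
    have "H i j * complex_of_real (d j) = cnj (H j i * complex_of_real (d i))"
      using g_herm[OF that(1,2)] gd[OF that(1,2)] gd[OF that(2,1)] that by (simp add: real)
    then have "H i j * complex_of_real (d j) = H i j * complex_of_real (d i)"
      using H_herm[of i j] by simp
    with that show ?thesis by simp
  qed
  have "char_poly A = char_poly J" using char_poly_similar wit unfolding similar_mat_def by blast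
  also have "\<dots> = (\<Prod>a\<leftarrow>diag_mat J. [:- a, 1:])"
    using Jdiag J by (intro char_poly_upper_triangular[OF J]) (auto simp: upper_triangular_def)
  finally have "proots (char_poly A) = mset (diag_mat J)"
    by (simp add: proots_prod_list_linear)
  also have "diag_mat J = map (\<lambda>j. complex_of_real (d j)) [0..<n]"
    using J by (auto simp: diag_mat_def real)
  finally have "proots (char_poly A) = mset (map (\<lambda>j. complex_of_real (d j)) [0..<n])" .
  moreover have "\<forall>i<n. \<forall>j<n. (\<Sum>k<n. \<Sum>l<n. cnj (P $$ (k, i)) * A $$ (k, l) * P $$ (l, j)) =
      H i j * complex_of_real (d j)"
    using gd real by (simp add: g_def)
  moreover have "\<forall>i<n. \<forall>j<n. H i j = (\<Sum>k<n. cnj (P $$ (k, i)) * P $$ (k, j))" by (simp add: H_def)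
  moreover have "\<forall>i<n. \<forall>j<n. d i \<noteq> d j \<longrightarrow> H i j = 0" using orth by blast
  ultimately show ?thesis
    using P Q PQ QP by (intro exI[of _ P] exI[of _ Q] exI[of _ d] exI[of _ H] conjI)
qed

text \<open>\<open>H i j\<close> can be nonzero only for equal weights, so \<open>d j\<close> may be
  split evenly into the square roots at \<open>i\<close> and at \<open>j\<close>. This turns a
  weighted Gram form into a plain one.\<close>

lemma qform_sqrt_weights:
  assumes "\<And>i j. i \<in> I \<Longrightarrow> j \<in> I \<Longrightarrow> d i \<noteq> d j \<Longrightarrow> H i j = 0" "\<And>i. i \<in> I \<Longrightarrow> d i \<ge> 0"
  shows "qform (\<lambda>i j. H i j * complex_of_real (d j)) I c =
         qform H I (\<lambda>i. c i * complex_of_real (sqrt (d i)))"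
  unfolding qform_def
proof (intro arg_cong[of _ _ Re] sum.cong refl)
  fix i j assume ij: "i \<in> I" "j \<in> I"
  show "c i * (H i j * complex_of_real (d j)) * cnj (c j) =
    c i * complex_of_real (sqrt (d i)) * H i j * cnj (c j * complex_of_real (sqrt (d j)))"
  proof (cases "d i = d j")
    case True
    have "complex_of_real (sqrt (d j)) * complex_of_real (sqrt (d j)) = complex_of_real (d j)"
      using assms(2)[OF ij(2)] by (simp flip: of_real_mult)
    with True show ?thesis by (simp add: mult_ac)
  qed (simp add: assms(1)[OF ij])
qed

lemma qform_gram:
  fixes n :: nat
  shows "qform (\<lambda>i j. \<Sum>k<n. cnj (P k i) * P k j) I c = (\<Sum>k<n. (cmod (\<Sum>i\<in>I. c i * cnj (P k i)))\<^sup>2)"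
proof -
  have "qform (\<lambda>i j. \<Sum>k<n. cnj (P k i) * P k j) I c = (\<Sum>k<n. qform (\<lambda>i j. cnj (P k i) * cnj (cnj (P k j))) I c)"
  proof (induction n)
    case (Suc n)
    then show ?case by (simp add: qform_add_kernel)
  qed (simp add: qform_def)
  then show ?thesis by (simp only: qform_rank_one)
qed

lemma sq_minus_eq_card:
  assumes "proots (char_poly A) = mset (map (\<lambda>j. complex_of_real (d j)) [0..<n])"
  shows "sq_minus A = card {j. j < n \<and> d j < 0}"
proof -
  have "sq_minus A = length (filter (\<lambda>j. d j < 0) [0..<n])"
    unfolding sq_minus_def assms mset_filter[symmetric] size_mset filter_map length_map
    by (simp add: o_def)
  also have "\<dots> = card {j. j < n \<and> d j < 0}"
    by (subst distinct_card[symmetric]) (auto intro!: arg_cong[of _ _ card])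
  finally show ?thesis .
qed

text \<open>Eigenvectors for negative eigenvalues span a negative subspace. Conversely, killing the
  coordinates along them leaves a combination of the other eigenvectors, on which the form is a sum
  of squares.\<close>

lemma neg_dim_ge_iff_le_sq_minus:
  fixes A :: "complex mat"
  assumes A: "A \<in> carrier_mat n n"
    and herm: "\<And>i j. i < n \<Longrightarrow> j < n \<Longrightarrow> A $$ (j, i) = cnj (A $$ (i, j))"
  shows "neg_dim_ge (\<lambda>i j. A $$ (i, j)) {..<n} k \<longleftrightarrow> k \<le> sq_minus A"
proof -
  obtain P Q d H where
    P: "P \<in> carrier_mat n n" and Q: "Q \<in> carrier_mat n n" and PQ: "P * Q = 1\<^sub>m n" and QP: "Q * P = 1\<^sub>m n"
    and H': "\<forall>i<n. \<forall>j<n. H i j = (\<Sum>k<n. cnj (P $$ (k, i)) * P $$ (k, j))"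
    and G': "\<forall>i<n. \<forall>j<n.
       (\<Sum>k<n. \<Sum>l<n. cnj (P $$ (k, i)) * A $$ (k, l) * P $$ (l, j)) = H i j * complex_of_real (d j)"
    and orth': "\<forall>i<n. \<forall>j<n. d i \<noteq> d j \<longrightarrow> H i j = 0"
    and roots: "proots (char_poly A) = mset (map (\<lambda>j. complex_of_real (d j)) [0..<n])"
    using hermitian_eigenbasis[OF A herm] by blast
  note H = H'[rule_format] and G = G'[rule_format] and orth = orth'[rule_format]
  define K where "K = (\<lambda>i j. A $$ (i, j))"
  define N where "N = {j. j < n \<and> d j < 0}"
  have Nfin: "finite N" by (simp add: N_def)
  have s: "sq_minus A = card N" unfolding N_def by (rule sq_minus_eq_card[OF roots])
  \<comment> \<open>The conjugate appears because \<open>qform\<close> conjugates its second vector: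
    \<open>x\<close> acts as a row vector, that is, as the conjugate of an eigencolumn.\<close>
  define v where "v j k = cnj (P $$ (k, j))" for j k
  have comb: "qform K {..<n} (\<lambda>k. \<Sum>j\<in>I. c j * v j k) = qform (\<lambda>i j. H i j * complex_of_real (d j)) I c"
    if I: "I \<subseteq> {..<n}" for I c
  proof -
    have "(\<Sum>k<n. \<Sum>l<n. (\<Sum>i\<in>I. c i * v i k) * K k l * cnj (\<Sum>j\<in>I. c j * v j l)) =
        (\<Sum>k<n. \<Sum>l<n. \<Sum>i\<in>I. \<Sum>j\<in>I. c i * (cnj (P $$ (k, i)) * A $$ (k, l) * P $$ (l, j)) * cnj (c j))"
      by (intro sum.cong refl) (simp add: v_def K_def sum_distrib_left sum_distrib_right mult_ac)
    also have "\<dots> = (\<Sum>k<n. \<Sum>i\<in>I. \<Sum>j\<in>I. \<Sum>l<n. c i * (cnj (P $$ (k, i)) * A $$ (k, l) * P $$ (l, j)) * cnj (c j))"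
      by (rule sum.cong[OF refl], subst sum.swap, rule sum.cong[OF refl], rule sum.swap)
    also have "\<dots> = (\<Sum>i\<in>I. \<Sum>j\<in>I. \<Sum>k<n. \<Sum>l<n. c i * (cnj (P $$ (k, i)) * A $$ (k, l) * P $$ (l, j)) * cnj (c j))"
      by (subst sum.swap, rule sum.cong[OF refl], rule sum.swap)
    also have "\<dots> = (\<Sum>i\<in>I. \<Sum>j\<in>I. c i * (H i j * complex_of_real (d j)) * cnj (c j))"
    proof (intro sum.cong refl)
      fix i j assume "i \<in> I" "j \<in> I"
      then have "i < n" "j < n" using I by auto
      from G[OF this] show "(\<Sum>k<n. \<Sum>l<n. c i * (cnj (P $$ (k, i)) * A $$ (k, l) * P $$ (l, j)) * cnj (c j)) =
        c i * (H i j * complex_of_real (d j)) * cnj (c j)"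
        by (simp only: sum_distrib_left[symmetric] sum_distrib_right[symmetric])
    qed
    finally show ?thesis unfolding qform_def by (simp only:)
  qed
  have Hq: "qform H I c = (\<Sum>k<n. (cmod (\<Sum>i\<in>I. c i * cnj (P $$ (k, i))))\<^sup>2)" if "I \<subseteq> {..<n}" for I c
  proof -
    have "qform H I c = qform (\<lambda>i j. \<Sum>k<n. cnj (P $$ (k, i)) * P $$ (k, j)) I c"
      using that by (intro qform_cong refl H) auto
    then show ?thesis by (simp only: qform_gram)
  qed
  have indep: "c j = 0" if I: "I \<subseteq> {..<n}" and 0: "\<And>k. k < n \<Longrightarrow> (\<Sum>i\<in>I. c i * cnj (P $$ (k, i))) = 0" and j: "j \<in> I" for I c j
  proof -
    have fin: "finite I" using I finite_subset by blast
    have "(\<Sum>k<n. cnj (Q $$ (j, k)) * (\<Sum>i\<in>I. c i * cnj (P $$ (k, i)))) = 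
      (\<Sum>i\<in>I. c i * cnj (\<Sum>k<n. Q $$ (j, k) * P $$ (k, i)))"
      unfolding sum_distrib_left by (subst sum.swap) (simp add: sum_distrib_left mult_ac)
    also have "\<dots> = (\<Sum>i\<in>I. c i * (if i = j then 1 else 0))"
    proof (intro sum.cong refl)
      fix i assume "i \<in> I"
      then have ij: "i < n" "j < n" using I j by auto
      have "(Q * P) $$ (j, i) = (\<Sum>k<n. Q $$ (j, k) * P $$ (k, i))"
        using ij P Q by (simp add: scalar_prod_def atLeast0LessThan)
      then have eq: "(\<Sum>k<n. Q $$ (j, k) * P $$ (k, i)) = (if i = j then 1 else 0)"
        using ij by (auto simp: QP split: if_splits)
      show "c i * cnj (\<Sum>k<n. Q $$ (j, k) * P $$ (k, i)) = c i * (if i = j then 1 else 0)"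
        unfolding eq by simp
    qed
    also have "\<dots> = c j" using fin j by (simp add: if_distrib[of "(*) _"] cong: if_cong)
    finally show ?thesis using 0 by simp
  qed
  have "neg_family K {..<n} N v"
    unfolding neg_family_def
  proof (intro conjI allI impI Nfin)
    fix c :: "nat \<Rightarrow> complex" assume c: "\<exists>i\<in>N. c i \<noteq> 0"
    have Nn: "N \<subseteq> {..<n}" by (auto simp: N_def)
    define c' where "c' i = c i * complex_of_real (sqrt (- d i))" for i
    have "qform (\<lambda>i j. H i j * complex_of_real (d j)) N c =
       - qform (\<lambda>i j. H i j * complex_of_real (- d j)) N c"
      unfolding qform_def by (simp add: sum_negf)
    also have "qform (\<lambda>i j. H i j * complex_of_real (- d j)) N c = qform H N c'"
      unfolding c'_def by (intro qform_sqrt_weights orth) (auto simp: N_def)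
    finally have eq: "qform K {..<n} (\<lambda>z. \<Sum>i\<in>N. c i * v i z) = - qform H N c'"
      using comb[OF Nn] by simp
    have "qform H N c' \<noteq> 0"
    proof
      assume "qform H N c' = 0"
      then have "(\<Sum>i\<in>N. c' i * cnj (P $$ (k, i))) = 0" if "k < n" for k
        using that Hq[OF Nn, of c'] by (simp add: sum_nonneg_eq_0_iff)
      then have "c' j = 0" if "j \<in> N" for j using indep[OF Nn] that by blast
      then show False using c by (auto simp: c'_def N_def)
    qed
    moreover have "qform H N c' \<ge> 0" unfolding Hq[OF Nn] by (intro sum_nonneg) auto
    ultimately show "qform K {..<n} (\<lambda>z. \<Sum>i\<in>N. c i * v i z) < 0" unfolding eq by simp
  qed
  then have lower: "neg_dim_ge K {..<n} (card N)" by (auto simp: neg_dim_ge_def)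
  obtain Nl where Nl: "set Nl = N" "length Nl = card N"
    using Nfin finite_distinct_list distinct_card by metis
  \<comment> \<open>The conjugated rows of \<open>Q\<close>, the inverse of \<open>P\<close>, read
    off the coordinates with respect to the vectors \<open>v j\<close>.\<close>
  define es where "es = map (\<lambda>j k. cnj (Q $$ (j, k))) Nl"
  have "\<not> neg_dim_ge K {..<n} (Suc (length es))"
  proof (rule not_neg_dim_ge_if_nonneg_on_kernel)
    fix x assume x: "\<And>e. e \<in> set es \<Longrightarrow> (\<Sum>z<n. x z * e z) = 0"
    define c where "c j = (\<Sum>k<n. x k * cnj (Q $$ (j, k)))" for j
    have cN: "c j = 0" if "j \<in> N" for j using x that by (auto simp: es_def c_def Nl)
    define I where "I = {..<n} - N"
    have I: "I \<subseteq> {..<n}" by (auto simp: I_def)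
    have xc: "x k = (\<Sum>j\<in>I. c j * v j k)" if "k < n" for k
    proof -
      have "(\<Sum>j\<in>I. c j * v j k) = (\<Sum>j<n. c j * v j k)"
        using cN by (intro sum.mono_neutral_left) (auto simp: I_def)
      also have "\<dots> = (\<Sum>j<n. \<Sum>l<n. x l * cnj (P $$ (k, j) * Q $$ (j, l)))"
        by (simp add: c_def v_def sum_distrib_right sum_distrib_left mult_ac)
      also have "\<dots> = (\<Sum>l<n. x l * cnj (\<Sum>j<n. P $$ (k, j) * Q $$ (j, l)))"
        by (subst sum.swap) (simp add: sum_distrib_left)
      also have "\<dots> = (\<Sum>l<n. x l * (if l = k then 1 else 0))"
      proof (intro sum.cong refl)
        fix l assume "l \<in> {..<n}"
        then have "(P * Q) $$ (k, l) = (\<Sum>j<n. P $$ (k, j) * Q $$ (j, l))" "l < n"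
          using that P Q by (auto simp: scalar_prod_def atLeast0LessThan)
        then have eq: "(\<Sum>j<n. P $$ (k, j) * Q $$ (j, l)) = (if l = k then 1 else 0)"
          using that by (auto simp: PQ split: if_splits)
        show "x l * cnj (\<Sum>j<n. P $$ (k, j) * Q $$ (j, l)) = x l * (if l = k then 1 else 0)"
          unfolding eq by simp
      qed
      also have "\<dots> = x k" using that by (simp add: if_distrib[of "(*) _"] cong: if_cong)
      finally show ?thesis ..
    qed
    have "qform K {..<n} x = qform K {..<n} (\<lambda>k. \<Sum>j\<in>I. c j * v j k)"
      by (intro qform_cong xc) auto
    also have "\<dots> = qform H I (\<lambda>i. c i * complex_of_real (sqrt (d i)))"
      unfolding comb[OF I] by (intro qform_sqrt_weights orth) (auto simp: I_def N_def)
    also have "\<dots> \<ge> 0" unfolding Hq[OF I] by (intro sum_nonneg) auto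
    finally show "qform K {..<n} x \<ge> 0" .
  qed
  then have upper: "\<not> neg_dim_ge K {..<n} (Suc (card N))" by (simp add: es_def Nl)
  have "neg_dim_ge K {..<n} k \<longleftrightarrow> k \<le> card N"
    using lower upper neg_dim_ge_decrease[of K "{..<n}"] by (metis not_less_eq_eq)
  then show ?thesis by (simp add: s K_def)
qed

section \<open>Pick kernels and Pick matrices\<close>

lemma qform_reindex:
  assumes "inj_on h I"
  shows "qform K (h ` I) x = qform (\<lambda>i j. K (h i) (h j)) I (\<lambda>i. x (h i))"
  unfolding qform_def by (simp add: sum.reindex[OF assms])

lemma neg_dim_ge_reindex:
  assumes "inj_on h I"
  shows "neg_dim_ge K (h ` I) k \<longleftrightarrow> neg_dim_ge (\<lambda>i j. K (h i) (h j)) I k"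
proof
  assume "neg_dim_ge K (h ` I) k"
  then obtain J v where J: "card J = k" "neg_family K (h ` I) J v" by (auto simp: neg_dim_ge_def)
  have "neg_family (\<lambda>i j. K (h i) (h j)) I J (\<lambda>m i. v m (h i))"
    using J(2) unfolding neg_family_def qform_reindex[OF assms] .
  with J(1) show "neg_dim_ge (\<lambda>i j. K (h i) (h j)) I k" unfolding neg_dim_ge_def by blast
next
  assume "neg_dim_ge (\<lambda>i j. K (h i) (h j)) I k"
  then obtain J v where J: "card J = k" "neg_family (\<lambda>i j. K (h i) (h j)) I J v"
    by (auto simp: neg_dim_ge_def)
  have eq: "qform K (h ` I) (\<lambda>z. \<Sum>i\<in>J. c i * v i (the_inv_into I h z)) =
      qform (\<lambda>i j. K (h i) (h j)) I (\<lambda>z. \<Sum>i\<in>J. c i * v i z)" for c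
    unfolding qform_reindex[OF assms] by (intro qform_cong) (auto simp: the_inv_into_f_f[OF assms])
  have "neg_family K (h ` I) J (\<lambda>m z. v m (the_inv_into I h z))"
    using J(2) unfolding neg_family_def eq .
  with J(1) show "neg_dim_ge K (h ` I) k" unfolding neg_dim_ge_def by blast
qed

definition pick_kernel :: "(complex \<Rightarrow> complex) \<Rightarrow> (complex \<Rightarrow> complex) \<Rightarrow> complex \<Rightarrow> complex \<Rightarrow> complex" where
  "pick_kernel a b z w = (a z * cnj (a w) - b z * cnj (b w)) / (1 - z * cnj w)"

abbreviation pick :: "(complex \<Rightarrow> complex) \<Rightarrow> complex \<Rightarrow> complex \<Rightarrow> complex" where
  "pick \<equiv> pick_kernel (\<lambda>_. 1)"

lemma hermitian_pick_kernel: "hermitian_kernel (pick_kernel a b)"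
  by (auto simp: hermitian_kernel_def pick_kernel_def mult_ac)

lemma le_sq_minus_pick_matrix_iff:
  assumes "distinct zs"
  shows "k \<le> sq_minus (pick_matrix f zs) \<longleftrightarrow> neg_dim_ge (pick f) (set zs) k"
proof -
  define n where "n = length zs"
  let ?A = "pick_matrix f zs"
  have A: "?A \<in> carrier_mat n n" by (simp add: pick_matrix_def n_def)
  have entry: "?A $$ (i, j) = pick f (zs ! i) (zs ! j)" if "i < n" "j < n" for i j
    using that by (simp add: pick_matrix_def n_def pick_kernel_def)
  have herm: "?A $$ (j, i) = cnj (?A $$ (i, j))" if "i < n" "j < n" for i j
    using hermitian_pick_kernel unfolding entry[OF that] entry[OF that(2,1)] hermitian_kernel_def by blast
  have "k \<le> sq_minus ?A \<longleftrightarrow> neg_dim_ge (\<lambda>i j. ?A $$ (i, j)) {..<n} k"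
    by (rule neg_dim_ge_iff_le_sq_minus[OF A herm, symmetric])
  also have "\<dots> \<longleftrightarrow> neg_dim_ge (\<lambda>i j. pick f (zs ! i) (zs ! j)) {..<n} k"
  proof -
    have "qform (\<lambda>i j. ?A $$ (i, j)) {..<n} x =
        qform (\<lambda>i j. pick f (zs ! i) (zs ! j)) {..<n} x" for x
      by (intro qform_cong) (auto simp: entry)
    then show ?thesis by (simp add: neg_dim_ge_def neg_family_def)
  qed
  also have "\<dots> \<longleftrightarrow> neg_dim_ge (pick f) ((!) zs ` {..<n}) k"
    using assms by (intro neg_dim_ge_reindex[symmetric] inj_on_nth) (auto simp: n_def)
  also have "(!) zs ` {..<n} = set zs" by (auto simp: n_def set_conv_nth)
  finally show ?thesis .
qed

text \<open>On the compact set of normalised coefficient vectors the form of \<open>K\<close> is at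
  most some -\<delta> < 0 and that of \<open>E\<close> at most some \<open>M\<close>, so the sum
  stays negative for \<epsilon> < \<delta> / M. Scaling covers all other coefficients.\<close>

lemma neg_dim_ge_perturb:
  assumes "neg_dim_ge K G k"
  shows "\<exists>\<epsilon>0>0. \<forall>\<epsilon>. 0 \<le> \<epsilon> \<and> \<epsilon> < \<epsilon>0 \<longrightarrow> neg_dim_ge (\<lambda>z w. K z w + complex_of_real \<epsilon> * E z w) G k"
proof -
  obtain I v where I: "card I = k" "neg_family K G I v"
    using assms by (auto simp: neg_dim_ge_def)
  then have fin: "finite I" by (simp add: neg_family_def)
  define x where "x = (\<lambda>(c :: nat \<Rightarrow> complex) z. \<Sum>i\<in>I. c i * v i z)"
  \<comment> \<open>Coefficients outside \<open>I\<close> are pinned to 0, so that \<open>C\<close>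
    is a product of compact sets in the full function space, hence compact by Tychonoff.\<close>
  define C where "C = PiE UNIV (\<lambda>i. if i \<in> I then cball (0::complex) 1 else {0})"
  define T where "T = C \<inter> {c. (\<Sum>i\<in>I. (cmod (c i))\<^sup>2) = 1}"
  have "compactin (product_topology (\<lambda>_. euclidean) UNIV) C"
    unfolding C_def compactin_PiE by auto
  then have "compact C" by (simp add: euclidean_product_topology)
  moreover have coord: "continuous_on X (\<lambda>c :: nat \<Rightarrow> complex. c i)" for i X
    by (rule continuous_on_subset[OF continuous_on_product_coordinates]) simp
  have "closed {c :: nat \<Rightarrow> complex. (\<Sum>i\<in>I. (cmod (c i))\<^sup>2) = 1}"
    by (intro closed_Collect_eq continuous_intros coord)
  ultimately have T: "compact T" unfolding T_def by (intro compact_Int_closed)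
  have cont: "continuous_on T (\<lambda>c. qform K' G (x c))" for K'
    unfolding qform_def x_def by (intro continuous_intros coord)
  show ?thesis
  proof (cases "T = {}")
    case False
    obtain c1 where c1: "c1 \<in> T" "\<And>c. c \<in> T \<Longrightarrow> qform K G (x c) \<le> qform K G (x c1)"
      using continuous_attains_sup[OF T False cont, of K] by blast
    obtain c2 where c2: "c2 \<in> T" "\<And>c. c \<in> T \<Longrightarrow> qform E G (x c) \<le> qform E G (x c2)"
      using continuous_attains_sup[OF T False cont, of E] by blast
    define \<delta> where "\<delta> = - qform K G (x c1)"
    define M where "M = \<bar>qform E G (x c2)\<bar> + 1"
    have "\<exists>i\<in>I. c1 i \<noteq> 0"
    proof (rule ccontr)
      assume "\<not> ?thesis"
      then have "(\<Sum>i\<in>I. (cmod (c1 i))\<^sup>2) = 0" by (intro sum.neutral) auto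
      with c1(1) show False by (auto simp: T_def)
    qed
    then have d: "\<delta> > 0" using neg_familyD[OF I(2)] by (auto simp: \<delta>_def x_def)
    have M: "M > 0" by (simp add: M_def)
    have "neg_dim_ge (\<lambda>z w. K z w + complex_of_real \<epsilon> * E z w) G k" if e: "0 \<le> \<epsilon>" "\<epsilon> < \<delta> / M" for \<epsilon>
    proof -
      have "neg_family (\<lambda>z w. K z w + complex_of_real \<epsilon> * E z w) G I v"
        unfolding neg_family_def
      proof (intro conjI allI impI fin)
        fix c :: "nat \<Rightarrow> complex" assume c: "\<exists>i\<in>I. c i \<noteq> 0"
        define t where "t = sqrt (\<Sum>i\<in>I. (cmod (c i))\<^sup>2)"
        have t2: "t\<^sup>2 = (\<Sum>i\<in>I. (cmod (c i))\<^sup>2)" unfolding t_def by (simp add: sum_nonneg)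
        obtain i0 where i0: "i0 \<in> I" "c i0 \<noteq> 0" using c by blast
        have "(cmod (c i0))\<^sup>2 \<le> t\<^sup>2" unfolding t2 using fin i0 by (intro member_le_sum) auto
        moreover have "0 < (cmod (c i0))\<^sup>2" using i0(2) by simp
        ultimately have "t\<^sup>2 > 0" by linarith
        moreover have "t \<ge> 0" by (simp add: t_def sum_nonneg)
        ultimately have tpos: "t > 0" by (simp add: less_le)
        define c0 where "c0 i = (if i \<in> I then c i / complex_of_real t else 0)" for i
        have n0: "(\<Sum>i\<in>I. (cmod (c0 i))\<^sup>2) = 1"
        proof -
          have "(\<Sum>i\<in>I. (cmod (c0 i))\<^sup>2) = (\<Sum>i\<in>I. (cmod (c i))\<^sup>2 / t\<^sup>2)"
            by (intro sum.cong) (auto simp: c0_def norm_divide power_divide)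
          also have "\<dots> = 1" using tpos by (simp flip: sum_divide_distrib t2)
          finally show ?thesis .
        qed
        have "cmod (c0 i) \<le> 1" if "i \<in> I" for i
        proof -
          have "(cmod (c0 i))\<^sup>2 \<le> 1" unfolding n0[symmetric] using fin that by (intro member_le_sum) auto
          then show ?thesis by (simp add: abs_square_le_1)
        qed
        then have c0T: "c0 \<in> T" using n0 by (auto simp: T_def C_def c0_def)
        have xc: "(\<lambda>z. \<Sum>i\<in>I. c i * v i z) = (\<lambda>z. complex_of_real t * x c0 z)"
          using tpos by (auto simp: x_def c0_def sum_distrib_left intro!: sum.cong)
        have "qform K G (x c0) + \<epsilon> * qform E G (x c0) < 0"
        proof -
          have "qform K G (x c0) \<le> - \<delta>" using c1(2)[OF c0T] by (simp add: \<delta>_def)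
          moreover have "qform E G (x c0) \<le> M" using c2(2)[OF c0T] by (simp add: M_def)
          then have "\<epsilon> * qform E G (x c0) \<le> \<epsilon> * M" using e(1) by (rule mult_left_mono)
          moreover have "\<epsilon> * M < \<delta>" using e(2) M by (simp add: field_simps)
          ultimately show ?thesis by simp
        qed
        then show "qform (\<lambda>z w. K z w + complex_of_real \<epsilon> * E z w) G (\<lambda>z. \<Sum>i\<in>I. c i * v i z) < 0"
          unfolding xc qform_scale_vector qform_add_kernel qform_scale_kernel
          using tpos by (simp add: mult_less_0_iff)
      qed
      with I(1) show ?thesis by (auto simp: neg_dim_ge_def)
    qed
    then show ?thesis using d M by (intro exI[of _ "\<delta> / M"]) auto
  next
    case True
    have "I = {}"
    proof (rule ccontr)
      assume "I \<noteq> {}"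
      then obtain i where i: "i \<in> I" by blast
      have "(\<Sum>j\<in>I. (cmod (if j = i then 1 else 0))\<^sup>2) = (\<Sum>j\<in>I. if j = i then 1 else 0)"
        by (intro sum.cong) auto
      then have "(\<lambda>j. if j = i then 1 else 0) \<in> T"
        using i fin by (auto simp: T_def C_def)
      with True show False by blast
    qed
    with I(1) have "k = 0" by simp
    then show ?thesis by (intro exI[of _ 1]) auto
  qed
qed

section \<open>Blaschke products and the boundary filter\<close>

definition bfac :: "complex \<Rightarrow> complex \<Rightarrow> complex" where
  "bfac a z = (z - a) / (1 - cnj a * z)"

text \<open>The zeros form a multiset, so the degree is \<open>size M\<close> and multiplicities
  need no separate bookkeeping. A unimodular constant is not included; it is moved into the Schur
  function instead.\<close>

definition blaschke :: "complex multiset \<Rightarrow> complex \<Rightarrow> complex" where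
  "blaschke M z = (\<Prod>a\<in>#M. bfac a z)"

lemma blaschke_empty [simp]: "blaschke {#} z = 1"
  and blaschke_add [simp]: "blaschke (add_mset a M) z = bfac a z * blaschke M z"
  and blaschke_plus: "blaschke (M + N) z = blaschke M z * blaschke N z"
  by (simp_all add: blaschke_def)

lemma cnj_mult_neq_1:
  assumes "cmod a < 1" "cmod z \<le> 1"
  shows "cnj a * z \<noteq> 1"
proof
  assume "cnj a * z = 1"
  then have "cmod a * cmod z = 1" by (metis complex_mod_cnj norm_mult norm_one)
  moreover have "cmod a * cmod z \<le> cmod a * 1" using assms by (intro mult_left_mono) auto
  ultimately show False using assms by simp
qed

lemma one_minus_cnj_mult_neq_0:
  "cmod a < 1 \<Longrightarrow> cmod z \<le> 1 \<Longrightarrow> 1 - cnj a * z \<noteq> 0"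
  using cnj_mult_neq_1[of a z] by simp

lemma bfac_self [simp]: "bfac a a = 0" by (simp add: bfac_def)

lemma bfac_eq_0_iff: "cmod a < 1 \<Longrightarrow> cmod z \<le> 1 \<Longrightarrow> bfac a z = 0 \<longleftrightarrow> z = a"
  using cnj_mult_neq_1[of a z] by (auto simp: bfac_def)

lemma one_minus_bfac:
  assumes "cmod a < 1" "cmod z \<le> 1" "cmod w \<le> 1"
  shows "1 - bfac a z * cnj (bfac a w) =
    complex_of_real (1 - (cmod a)\<^sup>2) * (1 - z * cnj w) / ((1 - cnj a * z) * (1 - a * cnj w))"
proof -
  have nz: "1 - cnj a * z \<noteq> 0" "1 - a * cnj w \<noteq> 0"
    using one_minus_cnj_mult_neq_0[of a z] one_minus_cnj_mult_neq_0[of a w] assms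
    by (auto dest: arg_cong[of _ _ cnj])
  have "complex_of_real (1 - (cmod a)\<^sup>2) = 1 - a * cnj a"
    by (simp only: of_real_diff of_real_1 complex_norm_square)
  then show ?thesis using nz
    by (simp add: bfac_def divide_simps) (simp add: algebra_simps)
qed

lemma one_minus_norm_bfac:
  assumes "cmod a < 1" "cmod z \<le> 1"
  shows "1 - (cmod (bfac a z))\<^sup>2 = (1 - (cmod a)\<^sup>2) * (1 - (cmod z)\<^sup>2) / (cmod (1 - cnj a * z))\<^sup>2"
proof -
  have "complex_of_real (1 - (cmod (bfac a z))\<^sup>2) = 1 - bfac a z * cnj (bfac a z)"
    by (simp only: of_real_diff of_real_1 complex_norm_square)
  also have "\<dots> = complex_of_real (1 - (cmod a)\<^sup>2) * (1 - z * cnj z) / ((1 - cnj a * z) * cnj (1 - cnj a * z))"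
    using one_minus_bfac[OF assms assms(2)] by simp
  also have "\<dots> = complex_of_real ((1 - (cmod a)\<^sup>2) * (1 - (cmod z)\<^sup>2) / (cmod (1 - cnj a * z))\<^sup>2)"
    by (simp only: of_real_diff of_real_1 of_real_mult of_real_divide complex_norm_square)
  finally show ?thesis by (simp only: of_real_eq_iff)
qed

lemma norm_bfac_le_1: "cmod a < 1 \<Longrightarrow> cmod z \<le> 1 \<Longrightarrow> cmod (bfac a z) \<le> 1"
proof -
  assume a: "cmod a < 1" "cmod z \<le> 1"
  have "1 - (cmod (bfac a z))\<^sup>2 \<ge> 0"
    unfolding one_minus_norm_bfac[OF a] using a by (simp add: abs_square_le_1)
  then show ?thesis by (simp add: abs_square_le_1)
qed

lemma norm_bfac_circle: "cmod a < 1 \<Longrightarrow> cmod z = 1 \<Longrightarrow> cmod (bfac a z) = 1"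
  using one_minus_norm_bfac[of a z] by (simp add: power2_eq_1_iff) (smt (verit) norm_ge_zero)

lemma holomorphic_bfac: "a \<in> unit_disk \<Longrightarrow> bfac a holomorphic_on unit_disk"
  unfolding bfac_def by (intro holomorphic_intros) (use cnj_mult_neq_1 in auto)

lemma norm_blaschke_le_1:
  "set_mset M \<subseteq> unit_disk \<Longrightarrow> cmod z \<le> 1 \<Longrightarrow> cmod (blaschke M z) \<le> 1"
  by (induction M) (auto simp: norm_mult norm_bfac_le_1 intro!: mult_le_one)

lemma norm_blaschke_circle:
  "set_mset M \<subseteq> unit_disk \<Longrightarrow> cmod z = 1 \<Longrightarrow> cmod (blaschke M z) = 1"
  by (induction M) (auto simp: norm_mult norm_bfac_circle)

lemma holomorphic_blaschke:
  "set_mset M \<subseteq> unit_disk \<Longrightarrow> blaschke M holomorphic_on unit_disk"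
proof (induction M)
  case empty
  have "blaschke {#} = (\<lambda>_. 1)" by auto
  then show ?case by simp
next
  case (add a M)
  have "blaschke (add_mset a M) = (\<lambda>z. bfac a z * blaschke M z)" by auto
  then show ?case using add by (auto intro!: holomorphic_intros holomorphic_bfac)
qed

lemma blaschke_eq_0_iff:
  "set_mset M \<subseteq> unit_disk \<Longrightarrow> cmod z \<le> 1 \<Longrightarrow> blaschke M z = 0 \<longleftrightarrow> z \<in># M"
  by (induction M) (auto simp: bfac_eq_0_iff)

lemma schur_blaschke: "set_mset M \<subseteq> unit_disk \<Longrightarrow> schur_function (blaschke M)"
  by (auto simp: schur_function_def holomorphic_blaschke intro!: norm_blaschke_le_1)

lemma schur_mult: "schur_function S \<Longrightarrow> schur_function T \<Longrightarrow> schur_function (\<lambda>z. S z * T z)"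
  by (auto simp: schur_function_def norm_mult intro!: holomorphic_intros mult_le_one)

text \<open>The modulus tends to 1 from below, uniformly in the argument. Boundary behaviour is
  expressed through this filter because a Schur function may have no continuous extension to the
  circle.\<close>

definition to_circle :: "complex filter" where
  "to_circle = filtercomap cmod (at_left 1)"

lemma eventually_to_circle:
  "eventually P to_circle \<longleftrightarrow> (\<exists>r<1. \<forall>z. r < cmod z \<and> cmod z < 1 \<longrightarrow> P z)"
proof
  assume "eventually P to_circle"
  then obtain Q b where "b < 1" "\<And>y. y > b \<Longrightarrow> y < 1 \<Longrightarrow> Q y" "\<And>z. Q (cmod z) \<Longrightarrow> P z"
    unfolding to_circle_def eventually_filtercomap eventually_at_left_field by blast
  then show "\<exists>r<1. \<forall>z. r < cmod z \<and> cmod z < 1 \<longrightarrow> P z" by blast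
next
  assume "\<exists>r<1. \<forall>z. r < cmod z \<and> cmod z < 1 \<longrightarrow> P z"
  then obtain r where "r < 1" "\<And>z. r < cmod z \<and> cmod z < 1 \<Longrightarrow> P z" by blast
  then show "eventually P to_circle"
    unfolding to_circle_def eventually_filtercomap eventually_at_left_field
    by (intro exI[of _ "\<lambda>y. r < y \<and> y < 1"]) blast
qed

lemma tendsto_norm_to_circle: "(cmod \<longlongrightarrow> 1) to_circle"
proof (rule tendstoI)
  fix e :: real assume "e > 0"
  then show "eventually (\<lambda>z. dist (cmod z) 1 < e) to_circle"
    unfolding eventually_to_circle by (intro exI[of _ "1 - e"]) (auto simp: dist_real_def)
qed

lemma in_disk_to_circle: "eventually (\<lambda>z. z \<in> unit_disk) to_circle"
  unfolding eventually_to_circle by (intro exI[of _ 0]) auto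

text \<open>Since |1 - cnj a z| >= 1 - |a|, the identity \<open>one_minus_norm_bfac\<close> bounds 1
  - |bfac a z|^2 by a constant times 1 - |z|^2, independently of the argument of z.\<close>

lemma tendsto_norm_bfac:
  assumes a: "cmod a < 1"
  shows "((\<lambda>z. cmod (bfac a z)) \<longlongrightarrow> 1) to_circle"
proof -
  let ?c = "(1 - (cmod a)\<^sup>2) / (1 - cmod a)\<^sup>2"
  have c: "?c \<ge> 0" using a by (simp add: abs_square_le_1)
  have lower: "eventually (\<lambda>z. 1 - ?c * (1 - (cmod z)\<^sup>2) \<le> (cmod (bfac a z))\<^sup>2) to_circle"
    using in_disk_to_circle
  proof eventually_elim
    case (elim z)
    then have z: "cmod z \<le> 1" by simp
    have "cmod a * cmod z \<le> cmod a * 1" using z by (intro mult_left_mono) auto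
    then have "1 - cmod a \<le> 1 - cmod (cnj a * z)" by (simp add: norm_mult)
    also have "\<dots> \<le> cmod (1 - cnj a * z)" using norm_triangle_ineq2[of 1 "cnj a * z"] by simp
    finally have "(1 - cmod a)\<^sup>2 \<le> (cmod (1 - cnj a * z))\<^sup>2" using a by (intro power_mono) auto
    moreover have "(1 - (cmod a)\<^sup>2) * (1 - (cmod z)\<^sup>2) \<ge> 0" using a z by (simp add: abs_square_le_1)
    ultimately have "(1 - (cmod a)\<^sup>2) * (1 - (cmod z)\<^sup>2) / (cmod (1 - cnj a * z))\<^sup>2 \<le>
       (1 - (cmod a)\<^sup>2) * (1 - (cmod z)\<^sup>2) / (1 - cmod a)\<^sup>2"
      using a by (intro divide_left_mono) (auto intro!: mult_pos_pos simp: cnj_mult_neq_1[OF a z, symmetric])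
    then show ?case using one_minus_norm_bfac[OF a z] by simp
  qed
  have upper: "eventually (\<lambda>z. (cmod (bfac a z))\<^sup>2 \<le> 1) to_circle"
    using in_disk_to_circle by eventually_elim (use norm_bfac_le_1[OF a] in \<open>auto simp: abs_square_le_1\<close>)
  have "((\<lambda>z. 1 - ?c * (1 - (cmod z)\<^sup>2)) \<longlongrightarrow> 1 - ?c * (1 - 1\<^sup>2)) to_circle"
    by (intro tendsto_intros tendsto_norm_to_circle)
  then have "((\<lambda>z. (cmod (bfac a z))\<^sup>2) \<longlongrightarrow> 1) to_circle"
    using tendsto_sandwich[OF lower upper] by simp
  then have "((\<lambda>z. sqrt ((cmod (bfac a z))\<^sup>2)) \<longlongrightarrow> sqrt 1) to_circle"
    by (rule tendsto_real_sqrt)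
  then show ?thesis by simp
qed

lemma tendsto_norm_blaschke:
  "set_mset M \<subseteq> unit_disk \<Longrightarrow> ((\<lambda>z. cmod (blaschke M z)) \<longlongrightarrow> 1) to_circle"
proof (induction M)
  case (add a M)
  then have "((\<lambda>z. cmod (bfac a z) * cmod (blaschke M z)) \<longlongrightarrow> 1 * 1) to_circle"
    by (intro tendsto_mult tendsto_norm_bfac) auto
  then show ?case by (simp add: norm_mult)
qed simp

text \<open>The maximum principle is applied on a disk of radius \<open>s\<close> < 1 around 0 that
  contains \<open>z\<close>, with the bound on its circle taken from the filter; boundary values of
  \<open>h\<close> never occur.\<close>

lemma maximum_principle_to_circle:
  assumes h: "h holomorphic_on unit_disk"
    and bound: "\<And>c'. c' > c \<Longrightarrow> eventually (\<lambda>z. cmod (h z) \<le> c') to_circle"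
    and z: "z \<in> unit_disk"
  shows "cmod (h z) \<le> c"
proof (rule field_le_epsilon)
  fix e :: real assume "e > 0"
  then obtain r where r: "r < 1" "\<And>z. r < cmod z \<Longrightarrow> cmod z < 1 \<Longrightarrow> cmod (h z) \<le> c + e"
    using bound[of "c + e"] by (auto simp: eventually_to_circle)
  define s where "s = (max (max r (cmod z)) 0 + 1) / 2"
  have s: "r < s" "cmod z < s" "0 < s" "s < 1" using r(1) z by (auto simp: s_def)
  show "cmod (h z) \<le> c + e"
  proof (rule maximum_modulus_frontier[of h "ball 0 s"])
    show "h holomorphic_on interior (ball 0 s)"
      using s by (intro holomorphic_on_subset[OF h]) auto
    show "continuous_on (closure (ball 0 s)) h"
      using s by (intro continuous_on_subset[OF holomorphic_on_imp_continuous_on[OF h]]) auto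
    show "cmod (h w) \<le> c + e" if "w \<in> frontier (ball 0 s)" for w
      using that s by (intro r(2)) (auto simp: dist_norm)
  qed (use s in auto)
qed

text \<open>Schwarz's lemma: the singularity of the quotient at \<open>p\<close> is removable, and
  because |bfac p z| tends to 1 at the circle, the quotient is eventually bounded there by every c >
  1.\<close>

lemma schur_divide_bfac:
  assumes T: "schur_function T" and p: "p \<in> unit_disk" and Tp: "T p = 0"
  shows "\<exists>T'. schur_function T' \<and> (\<forall>z\<in>unit_disk. T z = bfac p z * T' z)"
proof -
  have hT: "T holomorphic_on unit_disk" using T by (simp add: schur_function_def)
  define g where "g z = (if z = p then deriv T p else (T z - T p) / (z - p))" for z
  have g: "g holomorphic_on unit_disk" unfolding g_def by (rule pole_lemma_open[OF hT open_ball])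
  define T' where "T' z = g z * (1 - cnj p * z)" for z
  have hT': "T' holomorphic_on unit_disk" unfolding T'_def by (intro holomorphic_intros g)
  have eq: "T z = bfac p z * T' z" if "z \<in> unit_disk" for z
    using that p Tp one_minus_cnj_mult_neq_0[of p z] by (auto simp: T'_def g_def bfac_def)
  have "cmod (T' z) \<le> 1" if z: "z \<in> unit_disk" for z
  proof (rule maximum_principle_to_circle[OF hT' _ z])
    fix c :: real assume c: "c > 1"
    have "((\<lambda>z. cmod (bfac p z)) \<longlongrightarrow> 1) to_circle" using p by (intro tendsto_norm_bfac) auto
    then have "eventually (\<lambda>z. cmod (bfac p z) > 1 / c) to_circle"
      using c by (intro order_tendstoD) auto
    then show "eventually (\<lambda>z. cmod (T' z) \<le> c) to_circle"
      using in_disk_to_circle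
    proof eventually_elim
      case (elim z)
      have "cmod (bfac p z) * cmod (T' z) \<le> 1"
        using T elim(2) eq[OF elim(2)] by (metis norm_mult schur_function_def)
      moreover have "(1 / c) * cmod (T' z) \<le> cmod (bfac p z) * cmod (T' z)"
        using elim(1) by (intro mult_right_mono) auto
      ultimately have "(1 / c) * cmod (T' z) \<le> 1" by linarith
      then show ?case using c by (simp add: field_simps)
    qed
  qed
  with hT' eq show ?thesis by (intro exI[of _ T']) (auto simp: schur_function_def)
qed

lemma zorder_blaschke_mult:
  assumes M: "set_mset M \<subseteq> unit_disk" and g: "g holomorphic_on unit_disk" "g p \<noteq> 0" and p: "p \<in> unit_disk"
  shows "zorder (\<lambda>z. blaschke M z * g z) p = int (count M p)"
proof -
  define N where "N = filter_mset (\<lambda>x. x \<noteq> p) M"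
  define k where "k = count M p"
  have MN: "M = replicate_mset k p + N"
    unfolding N_def k_def by (rule multiset_eqI) simp
  have rep: "blaschke (replicate_mset k p) z = bfac p z ^ k" for z by (induction k) auto
  have N: "set_mset N \<subseteq> unit_disk" "p \<notin># N" using M by (auto simp: N_def)
  show ?thesis unfolding k_def[symmetric]
  proof (rule zorder_eqI)
    let ?h = "\<lambda>z. blaschke N z * g z / (1 - cnj p * z) ^ k"
    show "?h holomorphic_on unit_disk"
      using p cnj_mult_neq_1[of p] by (intro holomorphic_intros holomorphic_blaschke N g) auto
    show "?h p \<noteq> 0"
      using p g N blaschke_eq_0_iff[OF N(1), of p] cnj_mult_neq_1[of p p] by auto
    show "blaschke M w * g w = ?h w * (w - p) powi int k" for w
      by (simp add: MN blaschke_plus rep bfac_def power_divide)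
  qed (use p in auto)
qed

text \<open>Induction on the number of distinct zeros: the full power of the Blaschke factor at one
  zero is split off, and the cofactor has exactly the other zeros.\<close>

lemma factor_zeros:
  assumes "h holomorphic_on unit_disk" "finite {z\<in>unit_disk. h z = 0}"
  shows "\<exists>M g. set_mset M \<subseteq> unit_disk \<and> g holomorphic_on unit_disk \<and>
      (\<forall>z\<in>unit_disk. g z \<noteq> 0 \<and> h z = blaschke M z * g z)"
  using assms
proof (induction "card {z\<in>unit_disk. h z = 0}" arbitrary: h)
  case 0
  then have "\<forall>z\<in>unit_disk. h z \<noteq> 0" by auto
  then show ?case using 0 by (intro exI[of _ "{#}"] exI[of _ h]) auto
next
  case (Suc n)
  from Suc.hyps(2) have "{z\<in>unit_disk. h z = 0} \<noteq> {}" by (metis card.empty nat.distinct(1))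
  then obtain p where p: "p \<in> unit_disk" "h p = 0" by blast
  have "\<not> h constant_on unit_disk"
  proof
    assume "h constant_on unit_disk"
    then have "{z\<in>unit_disk. h z = 0} = unit_disk" using p by (auto simp: constant_on_def)
    then show False using Suc.prems(2) uncountable_ball[of 1 "0::complex"] countable_finite by auto
  qed
  note R = holomorphic_factor_zero_nonconstant[OF Suc.prems(1) open_ball connected_ball p this]
  have "\<exists>g r k. (0::nat) < k \<and> 0 < r \<and> ball p r \<subseteq> unit_disk \<and> g holomorphic_on ball p r \<and>
      (\<forall>w\<in>ball p r. h w = (w - p) ^ k * g w) \<and> (\<forall>w\<in>ball p r. g w \<noteq> 0)"
  proof (rule R)
    fix g r and k :: nat
    assume a: "0 < k" "0 < r" "ball p r \<subseteq> unit_disk" "g holomorphic_on ball p r"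
      "\<And>w. w \<in> ball p r \<Longrightarrow> h w = (w - p) ^ k * g w" "\<And>w. w \<in> ball p r \<Longrightarrow> g w \<noteq> 0"
    show ?thesis
      by (rule exI[of _ g], rule exI[of _ r], rule exI[of _ k]) (intro conjI ballI a)
  qed
  then obtain g r k where g: "0 < k" "0 < r" "ball p r \<subseteq> unit_disk" "g holomorphic_on ball p r"
      and g': "\<forall>w\<in>ball p r. h w = (w - p) ^ k * g w" "\<forall>w\<in>ball p r. g w \<noteq> 0"
    by (elim exE conjE)
  have g5: "h w = (w - p) ^ k * g w" if "w \<in> ball p r" for w using g'(1) that by blast
  have g6: "g p \<noteq> 0" using g'(2) g(2) by (metis centre_in_ball)
  define G where "G z = (if z = p then g p else h z / (z - p) ^ k) * (1 - cnj p * z) ^ k" for z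
  have "(\<lambda>z. if z = p then g p else h z / (z - p) ^ k) holomorphic_on unit_disk"
  proof -
    have "(\<lambda>z. if z = p then g p else h z / (z - p) ^ k) holomorphic_on ball p r"
      using g(4) by (rule holomorphic_transform) (use g5 in auto)
    moreover have "(\<lambda>z. if z = p then g p else h z / (z - p) ^ k) holomorphic_on (unit_disk - {p})"
    proof (rule holomorphic_transform)
      show "(\<lambda>z. h z / (z - p) ^ k) holomorphic_on unit_disk - {p}"
        by (intro holomorphic_intros holomorphic_on_subset[OF Suc.prems(1)]) auto
    qed auto
    ultimately have "(\<lambda>z. if z = p then g p else h z / (z - p) ^ k) holomorphic_on (ball p r \<union> (unit_disk - {p}))"
      by (intro holomorphic_on_Un) auto
    moreover have "ball p r \<union> (unit_disk - {p}) = unit_disk" using g(2,3) p by auto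
    ultimately show ?thesis by simp
  qed
  then have hG: "G holomorphic_on unit_disk" unfolding G_def by (intro holomorphic_intros)
  have hGeq: "h z = bfac p z ^ k * G z" if "z \<in> unit_disk" for z
    using that p g(1) cnj_mult_neq_1[of p z] by (auto simp: G_def bfac_def power_divide)
  have Gp: "G p \<noteq> 0" using g6 p cnj_mult_neq_1[of p p] by (auto simp: G_def)
  have zeros: "{z\<in>unit_disk. G z = 0} = {z\<in>unit_disk. h z = 0} - {p}"
    using hGeq Gp p by (auto simp: bfac_eq_0_iff)
  have "n = card {z\<in>unit_disk. G z = 0}"
    unfolding zeros using Suc.hyps(2) p Suc.prems(2) by simp
  moreover have "finite {z\<in>unit_disk. G z = 0}" unfolding zeros using Suc.prems(2) by simp
  ultimately obtain M g' where M: "set_mset M \<subseteq> unit_disk" "g' holomorphic_on unit_disk"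
    "\<forall>z\<in>unit_disk. g' z \<noteq> 0 \<and> G z = blaschke M z * g' z"
    using Suc.hyps(1)[of G] hG by blast
  have rep: "blaschke (replicate_mset k p) z = bfac p z ^ k" for z by (induction k) auto
  show ?case
    using M p hGeq g(1)
    by (intro exI[of _ "replicate_mset k p + M"] exI[of _ g']) (auto simp: blaschke_plus rep)
qed

text \<open>Evaluates one side of Rouche's theorem: all zeros lie inside the circle, where the
  winding number is 1, and their orders add up to the size of the multiset.\<close>

lemma winding_zorder_blaschke_mult:
  assumes M: "set_mset M \<subseteq> unit_disk" and g: "g holomorphic_on unit_disk" "\<And>z. z \<in> unit_disk \<Longrightarrow> g z \<noteq> 0"
    and h: "\<And>z. z \<in> unit_disk \<Longrightarrow> h z = blaschke M z * g z"
    and r: "0 < r" "r < 1" "\<And>z. z \<in># M \<Longrightarrow> cmod z < r"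
  shows "(\<Sum>p | p \<in> unit_disk \<and> h p = 0. winding_number (circlepath 0 r) p * of_int (zorder h p)) =
      of_nat (size M)"
proof -
  have zeros: "{p. p \<in> unit_disk \<and> h p = 0} = set_mset M"
    using h g(2) M blaschke_eq_0_iff[OF M] by (auto simp: subset_iff)
  have "winding_number (circlepath 0 r) p * of_int (zorder h p) = of_nat (count M p)" if "p \<in># M" for p
  proof -
    have p: "p \<in> unit_disk" using M that by auto
    have "zorder h p = zorder (\<lambda>z. blaschke M z * g z) p"
    proof (rule zorder_cong)
      have "eventually (\<lambda>z. z \<in> unit_disk) (at p)" using p by (intro eventually_at_in_open') auto
      then show "eventually (\<lambda>z. h z = blaschke M z * g z) (at p)"
        by eventually_elim (rule h)
    qed simp
    also have "\<dots> = int (count M p)" using p by (intro zorder_blaschke_mult M g) auto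
    finally show ?thesis using r(3)[OF that] by (simp add: winding_number_circlepath)
  qed
  then show ?thesis unfolding zeros by (simp add: size_multiset_overloaded_eq)
qed

section \<open>Moebius images of standard data\<close>

text \<open>The matrix with rows (\<alpha>, cnj \<beta>) and (\<beta>, cnj \<alpha>) multiplies
  |B|^2 - |T|^2 by a positive constant, B being the Blaschke product of \<open>M\<close>. Near the
  circle |B| is close to 1 while |T| <= 1, so \<alpha> B dominates cnj \<beta> T and Rouche's
  theorem preserves the number of zeros of the denominator. Dividing both components by its
  zero-free cofactor \<open>g\<close> leaves a Blaschke product as denominator and a Schur function
  as numerator.\<close>

lemma moebius_blaschke_schur:
  assumes M: "set_mset M \<subseteq> unit_disk" and T: "schur_function T"
    and coprime: "\<And>z. z \<in> unit_disk \<Longrightarrow> blaschke M z = 0 \<Longrightarrow> T z \<noteq> 0"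
    and ab: "cmod \<beta> < cmod \<alpha>"
  shows "\<exists>N S g. set_mset N \<subseteq> unit_disk \<and> size N = size M \<and> schur_function S \<and>
     (\<forall>z\<in>unit_disk. g z \<noteq> 0 \<and> (blaschke N z = 0 \<longrightarrow> S z \<noteq> 0) \<and>
        \<alpha> * blaschke M z + cnj \<beta> * T z = blaschke N z * g z \<and>
        \<beta> * blaschke M z + cnj \<alpha> * T z = S z * g z)"
proof -
  define D where "D = (\<lambda>z. \<alpha> * blaschke M z + cnj \<beta> * T z)"
  define E where "E = (\<lambda>z. \<beta> * blaschke M z + cnj \<alpha> * T z)"
  have hM: "blaschke M holomorphic_on unit_disk" by (rule holomorphic_blaschke[OF M])
  have hT: "T holomorphic_on unit_disk" and T1: "\<And>z. z \<in> unit_disk \<Longrightarrow> cmod (T z) \<le> 1"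
    using T by (auto simp: schur_function_def)
  have hD: "D holomorphic_on unit_disk" and hE: "E holomorphic_on unit_disk"
    unfolding D_def E_def by (intro holomorphic_intros hM hT)+
  have \<alpha>: "cmod \<alpha> > 0" using ab by (meson norm_ge_zero order_le_less_trans)
  have Mto: "((\<lambda>z. cmod (blaschke M z)) \<longlongrightarrow> 1) to_circle" by (rule tendsto_norm_blaschke[OF M])
  have "eventually (\<lambda>z. cmod (blaschke M z) > cmod \<beta> / cmod \<alpha>) to_circle"
    using ab \<alpha> by (intro order_tendstoD(1)[OF Mto]) simp
  then obtain r0 where r0: "r0 < 1"
    "\<And>z. r0 < cmod z \<Longrightarrow> cmod z < 1 \<Longrightarrow> cmod (blaschke M z) > cmod \<beta> / cmod \<alpha>"
    unfolding eventually_to_circle by blast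
  have dom: "cmod (cnj \<beta> * T z) < cmod (\<alpha> * blaschke M z)" if "r0 < cmod z" "cmod z < 1" for z
  proof -
    have "cmod (cnj \<beta> * T z) \<le> cmod \<beta> * 1"
      unfolding norm_mult complex_mod_cnj using that by (intro mult_left_mono T1) auto
    also have "\<dots> < cmod (\<alpha> * blaschke M z)"
      using r0(2)[OF that] \<alpha> by (simp add: norm_mult field_simps)
    finally show ?thesis .
  qed
  have Dnz: "D z \<noteq> 0" if "r0 < cmod z" "cmod z < 1" for z
  proof
    assume "D z = 0"
    then have "cnj \<beta> * T z = - (\<alpha> * blaschke M z)" unfolding D_def by (metis add_eq_0_iff)
    then show False using dom[OF that] by simp
  qed
  define r where "r = (max r0 0 + 1) / 2"
  have r: "0 < r" "r < 1" "r0 < r" using r0(1) by (auto simp: r_def)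
  have zerosD: "{z\<in>unit_disk. D z = 0} = {z\<in>cball 0 r. D z = 0}"
    using Dnz r by (force simp: not_less)
  have finD: "finite {z\<in>unit_disk. D z = 0}"
  proof (cases "D constant_on unit_disk")
    case True
    then obtain c where c: "\<And>z. z \<in> unit_disk \<Longrightarrow> D z = c" by (auto simp: constant_on_def)
    have "c \<noteq> 0" using c[of "complex_of_real r"] Dnz[of "complex_of_real r"] r by auto
    then have "{z\<in>unit_disk. D z = 0} = {}" using c by auto
    then show ?thesis by (simp only: finite.emptyI)
  next
    case False
    have "cball (0::complex) r \<subseteq> unit_disk" using r by auto
    then show ?thesis unfolding zerosD
      by (intro holomorphic_compact_finite_zeros[OF hD open_ball connected_ball compact_cball _ False]) auto
  qed
  obtain N g where N: "set_mset N \<subseteq> unit_disk" and g: "g holomorphic_on unit_disk"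
    and gnz: "\<And>z. z \<in> unit_disk \<Longrightarrow> g z \<noteq> 0" and DN: "\<And>z. z \<in> unit_disk \<Longrightarrow> D z = blaschke N z * g z"
    using factor_zeros[OF hD finD] by blast
  have "size N = size M"
  proof -
    let ?f = "\<lambda>z. \<alpha> * blaschke M z" and ?g = "\<lambda>z. cnj \<beta> * T z"
    have zerosf: "{p. p \<in> unit_disk \<and> ?f p = 0} = set_mset M"
      using M \<alpha> blaschke_eq_0_iff[OF M] by auto
    have "(\<Sum>p | p \<in> unit_disk \<and> ?f p + ?g p = 0.
          winding_number (circlepath 0 r) p * complex_of_int (zorder (\<lambda>p. ?f p + ?g p) p)) =
       (\<Sum>p | p \<in> unit_disk \<and> ?f p = 0. winding_number (circlepath 0 r) p * complex_of_int (zorder ?f p))"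
    proof (rule Rouche_theorem)
      show "finite {p \<in> unit_disk. ?f p + ?g p = 0}" using finD by (simp add: D_def)
      show "finite {p \<in> unit_disk. ?f p = 0}" using zerosf by simp
      show "?f holomorphic_on unit_disk" "?g holomorphic_on unit_disk"
        by (intro holomorphic_intros hM hT)+
      show "path_image (circlepath 0 r) \<subseteq> unit_disk" using r by auto
      show "\<forall>z\<in>path_image (circlepath 0 r). cmod (?g z) < cmod (?f z)"
        using r dom by auto
      show "\<forall>z. z \<notin> unit_disk \<longrightarrow> winding_number (circlepath 0 r) z = 0"
        using r by (intro allI impI winding_number_zero_outside[of _ unit_disk]) auto
    qed auto
    moreover have "(\<Sum>p | p \<in> unit_disk \<and> ?f p + ?g p = 0.
          winding_number (circlepath 0 r) p * complex_of_int (zorder (\<lambda>p. ?f p + ?g p) p)) = of_nat (size N)"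
    proof (rule winding_zorder_blaschke_mult[OF N g gnz _ r(1,2)])
      show "cmod z < r" if "z \<in># N" for z
      proof -
        have z: "z \<in> unit_disk" using that N by auto
        then have "D z = 0" using DN[OF z] blaschke_eq_0_iff[OF N, of z] that by auto
        then show ?thesis using Dnz[of z] z r by force
      qed
    qed (use DN in \<open>auto simp: D_def\<close>)
    moreover have "(\<Sum>p | p \<in> unit_disk \<and> ?f p = 0.
        winding_number (circlepath 0 r) p * complex_of_int (zorder ?f p)) = of_nat (size M)"
    proof (rule winding_zorder_blaschke_mult[OF M, of "\<lambda>_. \<alpha>"])
      show "cmod z < r" if "z \<in># M" for z
      proof -
        have z: "z \<in> unit_disk" using that M by auto
        then have "blaschke M z = 0" using blaschke_eq_0_iff[OF M, of z] that by auto
        then show ?thesis using dom[of z] z r by (cases "r0 < cmod z") auto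
      qed
    qed (use \<alpha> r in auto)
    ultimately show ?thesis by (metis of_nat_eq_iff)
  qed
  define S where "S z = E z / g z" for z
  have hS: "S holomorphic_on unit_disk" unfolding S_def by (intro holomorphic_intros hE g gnz)
  define d where "d = (cmod \<alpha>)\<^sup>2 - (cmod \<beta>)\<^sup>2"
  have d: "d > 0" using ab by (simp add: d_def power_strict_mono)
  have ident: "(cmod (D z))\<^sup>2 - (cmod (E z))\<^sup>2 = d * ((cmod (blaschke M z))\<^sup>2 - (cmod (T z))\<^sup>2)" for z
  proof -
    have "complex_of_real ((cmod (D z))\<^sup>2 - (cmod (E z))\<^sup>2) =
       complex_of_real (d * ((cmod (blaschke M z))\<^sup>2 - (cmod (T z))\<^sup>2))"
      unfolding d_def of_real_diff of_real_mult complex_norm_square D_def E_def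
      by (simp add: algebra_simps)
    then show ?thesis by (simp only: of_real_eq_iff)
  qed
  have "cmod (S z) \<le> 1" if z: "z \<in> unit_disk" for z
  proof (rule maximum_principle_to_circle[OF hS _ z])
    fix c :: real assume c: "c > 1"
    \<comment> \<open>By \<open>ident\<close> and |T| <= 1, |E|^2 exceeds |D|^2 by at most d (1 -
      |B|^2), while |D| >= |\<alpha>| |B| - |\<beta>|. The quotient therefore bounds the relative
      excess, and it tends to 0 at the circle.\<close>
    have "((\<lambda>z. d * (1 - (cmod (blaschke M z))\<^sup>2) / (cmod \<alpha> * cmod (blaschke M z) - cmod \<beta>)\<^sup>2)
       \<longlongrightarrow> d * (1 - 1\<^sup>2) / (cmod \<alpha> * 1 - cmod \<beta>)\<^sup>2) to_circle"
      using ab by (intro tendsto_intros Mto) auto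
    then have "eventually (\<lambda>z. d * (1 - (cmod (blaschke M z))\<^sup>2) / (cmod \<alpha> * cmod (blaschke M z) - cmod \<beta>)\<^sup>2
        < c\<^sup>2 - 1) to_circle"
      using c by (intro order_tendstoD) auto
    moreover have "eventually (\<lambda>z. r0 < cmod z \<and> cmod z < 1) to_circle"
      unfolding eventually_to_circle using r0(1) by blast
    ultimately show "eventually (\<lambda>z. cmod (S z) \<le> c) to_circle"
    proof eventually_elim
      case (elim z)
      then have z: "z \<in> unit_disk" by simp
      let ?m = "cmod (blaschke M z)"
      have mpos: "cmod \<alpha> * ?m - cmod \<beta> > 0" using r0(2)[of z] elim \<alpha> by (simp add: field_simps)
      have "cmod (cnj \<beta> * T z) \<le> cmod \<beta> * 1"
        unfolding norm_mult complex_mod_cnj using z by (intro mult_left_mono T1) auto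
      then have "cmod \<alpha> * ?m - cmod \<beta> \<le> cmod (\<alpha> * blaschke M z) - cmod (cnj \<beta> * T z)"
        by (simp add: norm_mult)
      also have "\<dots> \<le> cmod (D z)"
        unfolding D_def using norm_triangle_ineq2[of "\<alpha> * blaschke M z" "- (cnj \<beta> * T z)"] by simp
      finally have Dge: "cmod \<alpha> * ?m - cmod \<beta> \<le> cmod (D z)" .
      have "(cmod (T z))\<^sup>2 \<le> 1" using T1[OF z] by (simp add: abs_square_le_1)
      then have "d * (cmod (T z))\<^sup>2 \<le> d * 1" using d by (intro mult_left_mono) auto
      then have "(cmod (E z))\<^sup>2 \<le> (cmod (D z))\<^sup>2 + d * (1 - ?m\<^sup>2)"
        using ident[of z] by (simp add: algebra_simps)
      also have "d * (1 - ?m\<^sup>2) \<le> (c\<^sup>2 - 1) * (cmod \<alpha> * ?m - cmod \<beta>)\<^sup>2"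
        using elim(1) mpos by (simp add: divide_less_eq)
      also have "(c\<^sup>2 - 1) * (cmod \<alpha> * ?m - cmod \<beta>)\<^sup>2 \<le> (c\<^sup>2 - 1) * (cmod (D z))\<^sup>2"
        using c mpos Dge by (intro mult_left_mono power_mono) auto
      finally have "(cmod (E z))\<^sup>2 \<le> (c * cmod (D z))\<^sup>2" by (simp add: algebra_simps power_mult_distrib)
      then have "cmod (E z) \<le> c * cmod (D z)" by (rule power2_le_imp_le) (use c in simp)
      also have "cmod (D z) = cmod (blaschke N z) * cmod (g z)" by (simp add: DN[OF z] norm_mult)
      also have "\<dots> \<le> 1 * cmod (g z)" using z by (intro mult_right_mono norm_blaschke_le_1 N) auto
      finally have "cmod (E z) \<le> c * cmod (g z)" using c by (simp add: mult_left_mono)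
      then show ?case using gnz[OF z] by (simp add: S_def norm_divide divide_le_eq)
    qed
  qed
  then have S: "schur_function S" using hS by (auto simp: schur_function_def)
  have "S z \<noteq> 0" if z: "z \<in> unit_disk" and 0: "blaschke N z = 0" for z
  proof
    assume "S z = 0"
    then have E0: "E z = 0" using gnz[OF z] by (simp add: S_def)
    have D0: "D z = 0" using DN[OF z] 0 by simp
    \<comment> \<open>The matrix is inverted: a common zero of \<open>D\<close> and \<open>E\<close>
      would be a common zero of \<open>blaschke M\<close> and \<open>T\<close>.\<close>
    have "complex_of_real d * blaschke M z = cnj \<alpha> * D z - cnj \<beta> * E z"
      and "complex_of_real d * T z = \<alpha> * E z - \<beta> * D z"
      unfolding d_def of_real_diff complex_norm_square D_def E_def by (simp_all add: algebra_simps)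
    then have "blaschke M z = 0" "T z = 0" using d E0 D0 by auto
    then show False using coprime[OF z] by blast
  qed
  then show ?thesis
    using N \<open>size N = size M\<close> S gnz DN
    by (intro exI[of _ N] exI[of _ S] exI[of _ g]) (auto simp: S_def D_def E_def)
qed

section \<open>One-point pivots\<close>

text \<open>Cross-multiplied, so that it makes sense where \<open>a\<close> or the Blaschke product
  vanishes. For \<open>a\<close> = 1 and \<open>S\<close> without common zeros with
  \<open>blaschke M\<close>, every zero of the latter in \<open>Om\<close> is a jump: a pole at
  which a finite value is prescribed.\<close>

definition jump_set where
  "jump_set Om a b S M = {z\<in>Om. b z * blaschke M z \<noteq> a z * S z}"

text \<open>Poles are all zeros of the Blaschke product in the disk, jumps are points of
  \<open>Om\<close> only. The quantity followed through the pivots is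
  \<open>size M + card (jump_set Om a b S M)\<close>.\<close>

definition standard_pair where
  "standard_pair Om a b S M \<longleftrightarrow> schur_function S \<and> set_mset M \<subseteq> unit_disk \<and>
     (\<forall>z\<in>unit_disk. blaschke M z = 0 \<longrightarrow> S z \<noteq> 0) \<and> finite (jump_set Om a b S M)"

text \<open>Dividing by the zero-free \<open>g\<close> of \<open>moebius_blaschke_schur\<close>
  changes no cross-multiplied equation, so the jumps can be described by the transformed components
  before the cofactor is removed.\<close>

lemma standard_pair_moebius:
  assumes Om: "Om \<subseteq> unit_disk" and M: "set_mset M \<subseteq> unit_disk" and T: "schur_function T"
    and coprime: "\<And>z. z \<in> unit_disk \<Longrightarrow> blaschke M z = 0 \<Longrightarrow> T z \<noteq> 0"
    and \<alpha>\<beta>: "cmod \<beta> < cmod \<alpha>" and J: "finite J" "J \<subseteq> Om"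
    and jump: "\<And>z. z \<in> Om \<Longrightarrow> z \<in> J \<longleftrightarrow>
      b z * (\<alpha> * blaschke M z + cnj \<beta> * T z) \<noteq> a z * (\<beta> * blaschke M z + cnj \<alpha> * T z)"
  shows "\<exists>S N. standard_pair Om a b S N \<and> size N = size M \<and> jump_set Om a b S N = J"
proof -
  obtain N S g where N: "set_mset N \<subseteq> unit_disk" "size N = size M" "schur_function S"
    and g: "\<forall>z\<in>unit_disk. g z \<noteq> 0 \<and> (blaschke N z = 0 \<longrightarrow> S z \<noteq> 0) \<and>
        \<alpha> * blaschke M z + cnj \<beta> * T z = blaschke N z * g z \<and>
        \<beta> * blaschke M z + cnj \<alpha> * T z = S z * g z"
    using moebius_blaschke_schur[OF M T coprime \<alpha>\<beta>] by blast
  have "z \<in> jump_set Om a b S N \<longleftrightarrow> z \<in> J" if z: "z \<in> Om" for z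
  proof -
    have "z \<in> unit_disk" using z Om by auto
    with g have *: "g z \<noteq> 0" "\<alpha> * blaschke M z + cnj \<beta> * T z = blaschke N z * g z"
      "\<beta> * blaschke M z + cnj \<alpha> * T z = S z * g z" by auto
    show ?thesis
      unfolding jump[OF z] *(2,3) mult.assoc[symmetric] using *(1) z by (simp add: jump_set_def)
  qed
  then have "jump_set Om a b S N = J" using J(2) by (auto simp: jump_set_def)
  then show ?thesis using N g J(1) by (intro exI[of _ S] exI[of _ N]) (auto simp: standard_pair_def)
qed

definition pair_defect :: "(complex \<Rightarrow> complex) \<Rightarrow> (complex \<Rightarrow> complex) \<Rightarrow> complex \<Rightarrow> real" where
  "pair_defect a b p = (cmod (a p))\<^sup>2 - (cmod (b p))\<^sup>2"

text \<open>Together with \<open>pivot_v\<close> the image of \<open>(a, b)\<close> under the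
  fractional linear map that sends b(p)/a(p) to 0. The scaling by the square root makes the matrix
  preserve |a|^2 - |b|^2 when the defect at \<open>p\<close> is positive and reverse its sign when
  it is negative.\<close>

definition pivot_u where
  "pivot_u a b p z = (a z * cnj (a p) - b z * cnj (b p)) / complex_of_real (sqrt \<bar>pair_defect a b p\<bar>)"

definition pivot_v where
  "pivot_v a b p z = (b z * a p - a z * b p) / complex_of_real (sqrt \<bar>pair_defect a b p\<bar>)"

lemma of_real_pair_defect:
  "complex_of_real (pair_defect a b p) = a p * cnj (a p) - b p * cnj (b p)"
  unfolding pair_defect_def by (simp only: of_real_diff complex_norm_square)

lemma pivot_J_unitary:
  assumes "pair_defect a b p \<noteq> 0"
  shows "a z * cnj (a w) - b z * cnj (b w) = complex_of_real (sgn (pair_defect a b p)) *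
     (pivot_u a b p z * cnj (pivot_u a b p w) - pivot_v a b p z * cnj (pivot_v a b p w))"
proof -
  let ?d = "pair_defect a b p" and ?s = "complex_of_real (sqrt \<bar>pair_defect a b p\<bar>)"
  have s2: "?s * ?s = complex_of_real \<bar>?d\<bar>" by (simp flip: of_real_mult)
  have "pivot_u a b p z * cnj (pivot_u a b p w) - pivot_v a b p z * cnj (pivot_v a b p w) =
    ((a z * cnj (a p) - b z * cnj (b p)) * (cnj (a w) * a p - cnj (b w) * b p)
      - (b z * a p - a z * b p) * (cnj (b w) * cnj (a p) - cnj (a w) * cnj (b p))) / (?s * ?s)"
    by (simp add: pivot_u_def pivot_v_def flip: diff_divide_distrib)
  also have "((a z * cnj (a p) - b z * cnj (b p)) * (cnj (a w) * a p - cnj (b w) * b p)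
      - (b z * a p - a z * b p) * (cnj (b w) * cnj (a p) - cnj (a w) * cnj (b p))) =
      complex_of_real ?d * (a z * cnj (a w) - b z * cnj (b w))"
    unfolding of_real_pair_defect by (simp add: algebra_simps)
  also have "\<dots> / (?s * ?s) = complex_of_real (?d / \<bar>?d\<bar>) * (a z * cnj (a w) - b z * cnj (b w))"
    unfolding s2 by simp
  also have "?d / \<bar>?d\<bar> = sgn ?d" by (simp add: sgn_if)
  finally have eq: "pivot_u a b p z * cnj (pivot_u a b p w) - pivot_v a b p z * cnj (pivot_v a b p w) =
     complex_of_real (sgn ?d) * (a z * cnj (a w) - b z * cnj (b w))" .
  show ?thesis unfolding eq using assms by (simp add: sgn_if)
qed

lemma pick_kernel_diag:
  "pick_kernel a b p p = complex_of_real (pair_defect a b p / (1 - (cmod p)\<^sup>2))"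
  unfolding pick_kernel_def of_real_divide of_real_pair_defect of_real_diff of_real_1 complex_norm_square ..

lemma schur_complement_pick_kernel:
  assumes p: "p \<in> unit_disk" and z: "z \<in> unit_disk" and w: "w \<in> unit_disk"
    and d: "pair_defect a b p \<noteq> 0"
  shows "schur_complement (pick_kernel a b) p z w =
    (if pair_defect a b p > 0 then pick_kernel (\<lambda>z. bfac p z * pivot_u a b p z) (pivot_v a b p) z w
     else pick_kernel (pivot_v a b p) (\<lambda>z. bfac p z * pivot_u a b p z) z w)"
proof -
  let ?d = "pair_defect a b p" and ?s = "complex_of_real (sqrt \<bar>pair_defect a b p\<bar>)"
  let ?u = "pivot_u a b p" and ?v = "pivot_v a b p"
  have s2: "?s * ?s = complex_of_real \<bar>?d\<bar>" by (simp flip: of_real_mult)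
  have snz: "?s \<noteq> 0" using d by simp
  have nz: "1 - z * cnj w \<noteq> 0" "1 - cnj p * z \<noteq> 0" "1 - p * cnj w \<noteq> 0"
    using z w p cnj_mult_neq_1[of w z] cnj_mult_neq_1[of p z] cnj_mult_neq_1[of w p]
    by (auto simp: mult.commute)
  have 1: "pick_kernel a b z p = ?s * ?u z / (1 - cnj p * z)"
    using snz by (simp add: pick_kernel_def pivot_u_def mult.commute)
  have 2: "pick_kernel a b p w = ?s * cnj (?u w) / (1 - p * cnj w)"
    using snz by (simp add: pick_kernel_def pivot_u_def mult.commute)
  have "pick_kernel a b z p * pick_kernel a b p w / pick_kernel a b p p =
     (?s * ?s) * (?u z * cnj (?u w)) * complex_of_real (1 - (cmod p)\<^sup>2) /
      ((1 - cnj p * z) * (1 - p * cnj w) * complex_of_real ?d)"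
    unfolding 1 2 pick_kernel_diag by simp
  also have "\<dots> = complex_of_real (\<bar>?d\<bar> / ?d) * (?u z * cnj (?u w)) *
       (complex_of_real (1 - (cmod p)\<^sup>2) * (1 - z * cnj w) / ((1 - cnj p * z) * (1 - p * cnj w))) / (1 - z * cnj w)"
    unfolding s2 using nz(1) by (simp add: mult_ac)
  also have "complex_of_real (1 - (cmod p)\<^sup>2) * (1 - z * cnj w) / ((1 - cnj p * z) * (1 - p * cnj w)) =
      1 - bfac p z * cnj (bfac p w)"
    using p z w by (intro one_minus_bfac[symmetric]) auto
  also have "\<bar>?d\<bar> / ?d = sgn ?d" by (simp add: sgn_if)
  finally have "schur_complement (pick_kernel a b) p z w =
     (a z * cnj (a w) - b z * cnj (b w)) / (1 - z * cnj w) -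
     complex_of_real (sgn ?d) * (?u z * cnj (?u w)) * (1 - bfac p z * cnj (bfac p w)) / (1 - z * cnj w)"
    unfolding schur_complement_def by (simp add: pick_kernel_def)
  also have "\<dots> = complex_of_real (sgn ?d) * (bfac p z * ?u z * cnj (bfac p w * ?u w) - ?v z * cnj (?v w)) / (1 - z * cnj w)"
    unfolding pivot_J_unitary[OF d, of z w] diff_divide_distrib[symmetric]
    by (simp add: algebra_simps)
  finally show ?thesis using d
    by (auto simp: pick_kernel_def sgn_if minus_divide_left)
qed

text \<open>The pivot map is invertible and the Blaschke factor vanishes in the disk only at
  \<open>p\<close>. At \<open>p\<close> itself both components are 0, which is the reason for
  excluding that point.\<close>

lemma pivot_nonzero:
  assumes "pair_defect a b p \<noteq> 0" "(a z, b z) \<noteq> (0, 0)" "p \<in> unit_disk" "z \<in> unit_disk" "z \<noteq> p"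
  shows "(bfac p z * pivot_u a b p z, pivot_v a b p z) \<noteq> (0, 0)"
proof
  let ?s = "complex_of_real (sqrt \<bar>pair_defect a b p\<bar>)"
  have snz: "?s \<noteq> 0" using assms by simp
  assume "(bfac p z * pivot_u a b p z, pivot_v a b p z) = (0, 0)"
  then have u: "a z * cnj (a p) - b z * cnj (b p) = 0" and v: "b z * a p - a z * b p = 0"
    using assms snz bfac_eq_0_iff[of p z] by (auto simp: pivot_u_def pivot_v_def)
  have "complex_of_real (pair_defect a b p) * a z = a p * (a z * cnj (a p) - b z * cnj (b p)) + cnj (b p) * (b z * a p - a z * b p)"
   and "complex_of_real (pair_defect a b p) * b z = b p * (a z * cnj (a p) - b z * cnj (b p)) + cnj (a p) * (b z * a p - a z * b p)"
    unfolding of_real_pair_defect by (simp_all add: algebra_simps)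
  then show False using assms u v by auto
qed

text \<open>Up to a scalar the inverse matrix is applied to \<open>blaschke M1\<close> and
  \<open>bfac p * S1\<close>. If \<open>p\<close> is not in \<open>M1\<close>, these are coprime,
  the equation at \<open>p\<close> holds trivially, and neither count changes. If \<open>p\<close>
  is in \<open>M1\<close>, one common factor \<open>bfac p\<close> cancels: a pole is lost and
  \<open>p\<close> becomes a jump, so the sum is the same.\<close>

lemma standard_pair_unpivot_pos:
  assumes Om: "Om \<subseteq> unit_disk" "p \<in> Om" and d: "pair_defect a b p > 0"
    and std: "standard_pair (Om - {p}) (\<lambda>z. bfac p z * pivot_u a b p z) (pivot_v a b p) S1 M1"
  shows "\<exists>S M. standard_pair Om a b S M \<and> size M + card (jump_set Om a b S M) =
     size M1 + card (jump_set (Om - {p}) (\<lambda>z. bfac p z * pivot_u a b p z) (pivot_v a b p) S1 M1)"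
proof -
  let ?s = "complex_of_real (sqrt \<bar>pair_defect a b p\<bar>)"
  let ?J1 = "jump_set (Om - {p}) (\<lambda>z. bfac p z * pivot_u a b p z) (pivot_v a b p) S1 M1"
  have snz: "?s \<noteq> 0" using d by simp
  have p: "p \<in> unit_disk" using Om by auto
  have ab: "cmod (b p) < cmod (a p)" using d by (simp add: pair_defect_def power2_less_imp_less)
  have S1: "schur_function S1" and M1: "set_mset M1 \<subseteq> unit_disk"
    and cop: "\<And>z. z \<in> unit_disk \<Longrightarrow> blaschke M1 z = 0 \<Longrightarrow> S1 z \<noteq> 0" and fin: "finite ?J1"
    using std by (auto simp: standard_pair_def)
  have J1: "z \<in> ?J1 \<longleftrightarrow> (b z * a p - a z * b p) * blaschke M1 z \<noteq>
      bfac p z * (a z * cnj (a p) - b z * cnj (b p)) * S1 z" if "z \<in> Om" "z \<noteq> p" for z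
    using that snz by (simp add: jump_set_def pivot_u_def pivot_v_def)
  have pJ1: "p \<notin> ?J1" and J1sub: "?J1 \<subseteq> Om" by (auto simp: jump_set_def)
  have bn: "bfac p z \<noteq> 0" if "z \<in> unit_disk" "z \<noteq> p" for z using that p by (simp add: bfac_eq_0_iff)
  show ?thesis
  proof (cases "blaschke M1 p = 0")
    case False
    have "\<exists>S N. standard_pair Om a b S N \<and> size N = size M1 \<and> jump_set Om a b S N = ?J1"
    proof (rule standard_pair_moebius[OF Om(1) M1 _ _ ab fin J1sub])
      show "schur_function (\<lambda>z. bfac p z * S1 z)"
        using schur_mult[OF schur_blaschke[of "{#p#}"] S1] p by simp
      show "bfac p z * S1 z \<noteq> 0" if "z \<in> unit_disk" "blaschke M1 z = 0" for z
        using cop that False bn by (metis mult_eq_0_iff)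
      show "z \<in> ?J1 \<longleftrightarrow> b z * (a p * blaschke M1 z + cnj (b p) * (bfac p z * S1 z)) \<noteq>
         a z * (b p * blaschke M1 z + cnj (a p) * (bfac p z * S1 z))" if "z \<in> Om" for z
        using J1[OF that] pJ1 by (cases "z = p") (auto simp: algebra_simps)
    qed
    then obtain S N where "standard_pair Om a b S N" "size N = size M1" "jump_set Om a b S N = ?J1" by blast
    then show ?thesis by (intro exI[of _ S] exI[of _ N]) simp
  next
    case True
    then have "p \<in># M1" using blaschke_eq_0_iff[OF M1, of p] p by simp
    then obtain M2 where M12: "M1 = add_mset p M2" by (metis insert_DiffM)
    have M2: "set_mset M2 \<subseteq> unit_disk" using M1 M12 by auto
    have "\<exists>S N. standard_pair Om a b S N \<and> size N = size M2 \<and> jump_set Om a b S N = insert p ?J1"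
    proof (rule standard_pair_moebius[OF Om(1) M2 S1 _ ab])
      show "S1 z \<noteq> 0" if "z \<in> unit_disk" "blaschke M2 z = 0" for z
        using cop[OF that(1)] that(2) by (simp add: M12)
      fix z assume z: "z \<in> Om"
      show "z \<in> insert p ?J1 \<longleftrightarrow> b z * (a p * blaschke M2 z + cnj (b p) * S1 z) \<noteq>
         a z * (b p * blaschke M2 z + cnj (a p) * S1 z)"
      proof (cases "z = p")
        case zp: True
        have "b p * (a p * blaschke M2 p + cnj (b p) * S1 p) - a p * (b p * blaschke M2 p + cnj (a p) * S1 p) =
           - (complex_of_real (pair_defect a b p) * S1 p)"
          unfolding of_real_pair_defect by (simp add: algebra_simps)
        moreover have "S1 p \<noteq> 0" using cop[OF p True] .
        ultimately show ?thesis using d zp by auto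
      next
        case ne: False
        then have "bfac p z \<noteq> 0" using z Om bn by blast
        moreover have "b z * (a p * blaschke M2 z + cnj (b p) * S1 z) = a z * (b p * blaschke M2 z + cnj (a p) * S1 z) \<longleftrightarrow>
            (b z * a p - a z * b p) * blaschke M2 z = (a z * cnj (a p) - b z * cnj (b p)) * S1 z"
          by (auto simp: algebra_simps)
        ultimately show ?thesis using ne J1[OF z ne] by (simp add: M12 mult.assoc mult.left_commute[of _ "bfac p z"])
      qed
    qed (use fin J1sub Om(2) in auto)
    then obtain S N where "standard_pair Om a b S N" "size N = size M2" "jump_set Om a b S N = insert p ?J1" by blast
    then show ?thesis using fin pJ1 by (intro exI[of _ S] exI[of _ N]) (simp add: M12)
  qed
qed

text \<open>Here the Blaschke factor at \<open>p\<close> multiplies the denominator. If S1(p) is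
  nonzero, it adds a pole at \<open>p\<close> and no jump. If S1(p) = 0, it cancels against a factor
  of \<open>S1\<close>, and \<open>p\<close> becomes a jump. Either way the sum grows by
  one.\<close>

lemma standard_pair_unpivot_neg:
  assumes Om: "Om \<subseteq> unit_disk" "p \<in> Om" and d: "pair_defect a b p < 0"
    and std: "standard_pair (Om - {p}) (pivot_v a b p) (\<lambda>z. bfac p z * pivot_u a b p z) S1 M1"
  shows "\<exists>S M. standard_pair Om a b S M \<and> size M + card (jump_set Om a b S M) =
     Suc (size M1 + card (jump_set (Om - {p}) (pivot_v a b p) (\<lambda>z. bfac p z * pivot_u a b p z) S1 M1))"
proof -
  let ?s = "complex_of_real (sqrt \<bar>pair_defect a b p\<bar>)"
  let ?J1 = "jump_set (Om - {p}) (pivot_v a b p) (\<lambda>z. bfac p z * pivot_u a b p z) S1 M1"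
  have snz: "?s \<noteq> 0" using d by simp
  have p: "p \<in> unit_disk" using Om by auto
  have ab: "cmod (cnj (a p)) < cmod (cnj (b p))" using d by (simp add: pair_defect_def power2_less_imp_less)
  have S1: "schur_function S1" and M1: "set_mset M1 \<subseteq> unit_disk"
    and cop: "\<And>z. z \<in> unit_disk \<Longrightarrow> blaschke M1 z = 0 \<Longrightarrow> S1 z \<noteq> 0" and fin: "finite ?J1"
    using std by (auto simp: standard_pair_def)
  have J1: "z \<in> ?J1 \<longleftrightarrow> bfac p z * (a z * cnj (a p) - b z * cnj (b p)) * blaschke M1 z \<noteq>
      (b z * a p - a z * b p) * S1 z" if "z \<in> Om" "z \<noteq> p" for z
    using that snz by (simp add: jump_set_def pivot_u_def pivot_v_def)
  have pJ1: "p \<notin> ?J1" and J1sub: "?J1 \<subseteq> Om" by (auto simp: jump_set_def)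
  have bn: "bfac p z \<noteq> 0" if "z \<in> unit_disk" "z \<noteq> p" for z using that p by (simp add: bfac_eq_0_iff)
  show ?thesis
  proof (cases "S1 p = 0")
    case False
    have M2: "set_mset (add_mset p M1) \<subseteq> unit_disk" using M1 p by auto
    have "\<exists>S N. standard_pair Om a b S N \<and> size N = size (add_mset p M1) \<and> jump_set Om a b S N = ?J1"
    proof (rule standard_pair_moebius[OF Om(1) M2 S1 _ ab fin J1sub])
      show "S1 z \<noteq> 0" if "z \<in> unit_disk" "blaschke (add_mset p M1) z = 0" for z
        using cop that False bn by (cases "z = p") auto
      show "z \<in> ?J1 \<longleftrightarrow> b z * (cnj (b p) * blaschke (add_mset p M1) z + cnj (cnj (a p)) * S1 z) \<noteq>
         a z * (cnj (a p) * blaschke (add_mset p M1) z + cnj (cnj (b p)) * S1 z)" if "z \<in> Om" for z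
        using J1[OF that] pJ1 by (cases "z = p") (auto simp: algebra_simps)
    qed
    then obtain S N where "standard_pair Om a b S N" "size N = size (add_mset p M1)" "jump_set Om a b S N = ?J1" by blast
    then show ?thesis by (intro exI[of _ S] exI[of _ N]) simp
  next
    case True
    obtain S2 where S2: "schur_function S2" and S12: "\<forall>z\<in>unit_disk. S1 z = bfac p z * S2 z"
      using schur_divide_bfac[OF S1 p True] by blast
    have "\<exists>S N. standard_pair Om a b S N \<and> size N = size M1 \<and> jump_set Om a b S N = insert p ?J1"
    proof (rule standard_pair_moebius[OF Om(1) M1 S2 _ ab])
      show "S2 z \<noteq> 0" if "z \<in> unit_disk" "blaschke M1 z = 0" for z
        using cop[OF that] S12 that by auto
      fix z assume z: "z \<in> Om"
      show "z \<in> insert p ?J1 \<longleftrightarrow> b z * (cnj (b p) * blaschke M1 z + cnj (cnj (a p)) * S2 z) \<noteq>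
         a z * (cnj (a p) * blaschke M1 z + cnj (cnj (b p)) * S2 z)"
      proof (cases "z = p")
        case zp: True
        have "b p * (cnj (b p) * blaschke M1 p + a p * S2 p) - a p * (cnj (a p) * blaschke M1 p + b p * S2 p) =
           - (complex_of_real (pair_defect a b p) * blaschke M1 p)"
          unfolding of_real_pair_defect by (simp add: algebra_simps)
        moreover have "blaschke M1 p \<noteq> 0" using cop[OF p] True by blast
        ultimately show ?thesis using d zp by auto
      next
        case ne: False
        have zd: "z \<in> unit_disk" using z Om by auto
        then have "bfac p z \<noteq> 0" using ne bn by blast
        moreover have "b z * (cnj (b p) * blaschke M1 z + a p * S2 z) = a z * (cnj (a p) * blaschke M1 z + b p * S2 z) \<longleftrightarrow>
            (a z * cnj (a p) - b z * cnj (b p)) * blaschke M1 z = (b z * a p - a z * b p) * S2 z"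
          by (auto simp: algebra_simps)
        ultimately show ?thesis
          using ne J1[OF z ne] S12[rule_format, OF zd] by (simp add: mult.assoc mult.left_commute[of _ "bfac p z"])
      qed
    qed (use fin J1sub Om(2) in auto)
    then obtain S N where "standard_pair Om a b S N" "size N = size M1" "jump_set Om a b S N = insert p ?J1" by blast
    then show ?thesis using fin pJ1 by (intro exI[of _ S] exI[of _ N]) simp
  qed
qed

section \<open>Pick conditions for Schur functions\<close>

lemma schur_norm_1_imp_constant:
  assumes S: "schur_function S" and p: "p \<in> unit_disk" "cmod (S p) = 1" and z: "z \<in> unit_disk"
  shows "S z = S p"
proof -
  have "S constant_on unit_disk"
    using S p by (intro maximum_modulus_principle[of S unit_disk unit_disk p]) (auto simp: schur_function_def)
  then show ?thesis using p z by (auto simp: constant_on_def)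
qed

text \<open>Pick's necessary condition by the Schur algorithm: one pivot replaces the Schur function by
  the quotient of its Moebius image by a Blaschke factor and removes a point.\<close>

lemma qform_pick_kernel_schur_nonneg:
  assumes "schur_function S" "finite G" "G \<subseteq> unit_disk"
  shows "qform (pick S) G x \<ge> 0"
  using assms(2,1,3)
proof (induction G arbitrary: S x rule: finite_induct)
  case empty
  then show ?case by (simp add: qform_def)
next
  case (insert p G)
  have p: "p \<in> unit_disk" and G: "G \<subseteq> unit_disk" using insert.prems by auto
  have S1: "cmod (S z) \<le> 1" if "z \<in> unit_disk" for z
    using insert.prems(1) that by (simp add: schur_function_def)
  have hS: "S holomorphic_on unit_disk" using insert.prems(1) by (simp add: schur_function_def)
  show ?case
  proof (cases "cmod (S p) = 1")
    case True
    have "qform (pick S) (insert p G) x = qform (\<lambda>_ _. 0) (insert p G) x"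
    proof (rule qform_cong)
      fix z w assume "z \<in> insert p G" "w \<in> insert p G"
      then have "z \<in> unit_disk" "w \<in> unit_disk" using insert.prems(2) by auto
      then have "S z = S p" "S w = S p"
        by (auto intro: schur_norm_1_imp_constant[OF insert.prems(1) p True])
      moreover have "S p * cnj (S p) = 1" using complex_norm_square[of "S p"] True by simp
      ultimately show "pick S z w = 0" by (simp add: pick_kernel_def)
    qed simp
    then show ?thesis by (simp add: qform_def)
  next
    case False
    then have Sp: "cmod (S p) < 1" using S1[OF p] by simp
    let ?d = "pair_defect (\<lambda>_. 1) S p"
    have d: "?d > 0" using Sp by (simp add: pair_defect_def abs_square_less_1)
    define T where "T z = bfac (S p) (S z)" for z
    have "T holomorphic_on unit_disk"
      unfolding T_def bfac_def using S1 cnj_mult_neq_1[OF Sp] by (intro holomorphic_intros hS) auto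
    then have "schur_function T"
      using norm_bfac_le_1[OF Sp S1] by (auto simp: schur_function_def T_def)
    then obtain T' where T': "schur_function T'" "\<forall>z\<in>unit_disk. T z = bfac p z * T' z"
      using schur_divide_bfac[of T p] p by (auto simp: T_def)
    let ?u = "pivot_u (\<lambda>_. 1) S p" and ?v = "pivot_v (\<lambda>_. 1) S p"
    have v: "?v z = ?u z * (bfac p z * T' z)" if "z \<in> unit_disk" for z
    proof -
      have "?u z * T z = ?v z"
        using cnj_mult_neq_1[OF Sp S1[OF that]]
        by (simp add: pivot_u_def pivot_v_def T_def bfac_def mult.commute)
      then show ?thesis using T'(2) that by simp
    qed
    \<comment> \<open>Because \<open>v\<close> is \<open>u\<close> times \<open>bfac p * T'\<close>,
      the pivoted pair is (1, T') multiplied by a common factor, and its kernel is congruent to the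
      Pick kernel of \<open>T'\<close>.\<close>
    have sc: "qform (schur_complement (pick S) p) G y =
       qform (pick T') G (\<lambda>z. y z * (bfac p z * ?u z))" for y
    proof -
      have "qform (schur_complement (pick S) p) G y =
         qform (\<lambda>z w. (bfac p z * ?u z) * pick T' z w * cnj (bfac p w * ?u w)) G y"
      proof (rule qform_cong)
        fix z w assume "z \<in> G" "w \<in> G"
        then have zw: "z \<in> unit_disk" "w \<in> unit_disk" using G by auto
        show "schur_complement (pick S) p z w =
          (bfac p z * ?u z) * pick T' z w * cnj (bfac p w * ?u w)"
          using d unfolding schur_complement_pick_kernel[OF p zw less_imp_neq[OF d, symmetric]]
          by (simp add: pick_kernel_def v[OF zw(1)] v[OF zw(2)] algebra_simps)
      qed simp
      then show ?thesis by (simp only: qform_congruence)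
    qed
    have "\<not> neg_dim_ge (schur_complement (pick S) p) G (Suc 0)"
      unfolding not_neg_dim_ge_1_iff sc using insert.IH[OF T'(1) G] by simp
    moreover have "Re (pick S p p) > 0"
      unfolding pick_kernel_diag using d p by (simp add: abs_square_less_1)
    ultimately have "\<not> neg_dim_ge (pick S) (insert p G) (Suc 0)"
      using neg_dim_ge_schur_complement_pos[OF hermitian_pick_kernel insert.hyps] by blast
    then show ?thesis unfolding not_neg_dim_ge_1_iff by blast
  qed
qed

text \<open>The Szego kernel weighted by \<open>b\<close>. Up to the factor 1 - r^2 it is the change
  of a pair kernel when \<open>b\<close> is shrunk to \<open>r * b\<close>; it is positive because
  it is congruent to the Pick kernel of the zero function.\<close>

definition szego :: "(complex \<Rightarrow> complex) \<Rightarrow> complex \<Rightarrow> complex \<Rightarrow> complex" where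
  "szego b z w = b z * cnj (b w) / (1 - z * cnj w)"

lemma qform_szego_nonneg:
  assumes "finite G" "G \<subseteq> unit_disk"
  shows "qform (szego b) G x \<ge> 0"
proof -
  have "schur_function (\<lambda>_. 0)" by (simp add: schur_function_def)
  from qform_pick_kernel_schur_nonneg[OF this assms, of "\<lambda>z. x z * b z"]
  have "qform (\<lambda>z w. b z * pick (\<lambda>_. 0) z w * cnj (b w)) G x \<ge> 0"
    by (simp only: qform_congruence)
  then show ?thesis by (simp add: pick_kernel_def szego_def[abs_def])
qed

lemma pick_kernel_scale:
  "pick_kernel a (\<lambda>z. complex_of_real r * b z) =
     (\<lambda>z w. pick_kernel a b z w + complex_of_real (1 - r\<^sup>2) * szego b z w)"
  by (intro ext) (simp add: pick_kernel_def szego_def power2_eq_square algebra_simps flip: add_divide_distrib)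

lemma qform_pick_kernel_scale_ge:
  assumes "finite G" "G \<subseteq> unit_disk" "0 \<le> r" "r \<le> 1"
  shows "qform (pick_kernel a b) G x \<le> qform (pick_kernel a (\<lambda>z. complex_of_real r * b z)) G x"
proof -
  have "(1 - r\<^sup>2) * qform (szego b) G x \<ge> 0"
    using assms by (intro mult_nonneg_nonneg qform_szego_nonneg) (auto simp: abs_square_le_1)
  then show ?thesis unfolding pick_kernel_scale qform_add_kernel qform_scale_kernel by simp
qed

lemma norm_one_minus_mult_cnj:
  "(cmod (1 - p * cnj q))\<^sup>2 = (1 - (cmod p)\<^sup>2) * (1 - (cmod q)\<^sup>2) + (cmod (p - q))\<^sup>2"
proof -
  have "complex_of_real ((cmod (1 - p * cnj q))\<^sup>2) =
    complex_of_real ((1 - (cmod p)\<^sup>2) * (1 - (cmod q)\<^sup>2) + (cmod (p - q))\<^sup>2)"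
    unfolding of_real_add of_real_mult of_real_diff of_real_1 complex_norm_square
    by (simp add: algebra_simps)
  then show ?thesis by (simp only: of_real_eq_iff)
qed

text \<open>The Schwarz-Pick contraction of the pseudohyperbolic distance, with denominators
  cleared. The test vector (B, -k) turns positivity into the determinant inequality |k|^2 <= A B,
  where |h(w)| < 1 guarantees B > 0.\<close>

lemma two_point_pick:
  assumes zw: "z \<in> unit_disk" "w \<in> unit_disk" "z \<noteq> w" and h: "cmod (h w) < 1"
    and psd: "\<And>x. qform (pick h) {z, w} x \<ge> 0"
  shows "(cmod (h z - h w))\<^sup>2 * ((1 - (cmod z)\<^sup>2) * (1 - (cmod w)\<^sup>2)) \<le>
    (1 - (cmod (h z))\<^sup>2) * (1 - (cmod (h w))\<^sup>2) * (cmod (z - w))\<^sup>2"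
proof -
  let ?K = "pick h"
  define A where "A = (1 - (cmod (h z))\<^sup>2) / (1 - (cmod z)\<^sup>2)"
  define B where "B = (1 - (cmod (h w))\<^sup>2) / (1 - (cmod w)\<^sup>2)"
  define k where "k = ?K z w"
  have Kz: "?K z z = complex_of_real A" and Kw: "?K w w = complex_of_real B"
    by (simp_all only: pick_kernel_diag pair_defect_def A_def B_def norm_one one_power2 power_one)
  have wz: "?K w z = cnj k" using hermitian_pick_kernel unfolding k_def hermitian_kernel_def by blast
  have zz: "1 - (cmod z)\<^sup>2 > 0" "1 - (cmod w)\<^sup>2 > 0" using zw by (auto simp: abs_square_less_1)
  have B: "B > 0" using h zz by (simp add: B_def abs_square_less_1)
  have "qform ?K {z, w} (\<lambda>v. if v = z then complex_of_real B else - k) = B * (A * B - (cmod k)\<^sup>2)"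
  proof -
    have "(\<Sum>u\<in>{z, w}. \<Sum>v\<in>{z, w}. (if u = z then complex_of_real B else - k) * ?K u v *
        cnj (if v = z then complex_of_real B else - k)) =
       complex_of_real B * complex_of_real A * complex_of_real B - complex_of_real B * (k * cnj k)"
      using zw(3) by (simp add: Kz Kw wz k_def[symmetric] algebra_simps)
    also have "\<dots> = complex_of_real (B * (A * B - (cmod k)\<^sup>2))"
      unfolding complex_norm_square[symmetric] by (simp add: algebra_simps)
    finally show ?thesis unfolding qform_def by (simp only: Re_complex_of_real)
  qed
  then have "A * B - (cmod k)\<^sup>2 \<ge> 0" using psd B by (metis zero_le_mult_iff not_less)
  moreover have "(cmod k)\<^sup>2 = ((1 - (cmod (h z))\<^sup>2) * (1 - (cmod (h w))\<^sup>2) + (cmod (h z - h w))\<^sup>2) /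
      ((1 - (cmod z)\<^sup>2) * (1 - (cmod w)\<^sup>2) + (cmod (z - w))\<^sup>2)"
    by (simp add: k_def pick_kernel_def norm_divide power_divide norm_one_minus_mult_cnj)
  ultimately have "((1 - (cmod (h z))\<^sup>2) * (1 - (cmod (h w))\<^sup>2) + (cmod (h z - h w))\<^sup>2) /
      ((1 - (cmod z)\<^sup>2) * (1 - (cmod w)\<^sup>2) + (cmod (z - w))\<^sup>2) \<le>
      (1 - (cmod (h z))\<^sup>2) * (1 - (cmod (h w))\<^sup>2) / ((1 - (cmod z)\<^sup>2) * (1 - (cmod w)\<^sup>2))"
    by (simp add: A_def B_def)
  moreover have "(P + Q) / (Y + R) \<le> P / Y \<Longrightarrow> Q * Y \<le> P * R" if "Y > 0" "R \<ge> 0" for P Q R Y :: real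
    using that by (simp add: divide_simps algebra_simps split: if_splits)
  ultimately show ?thesis using zz by simp
qed

section \<open>Discrete sets and removable singularities\<close>

lemma discrete_punctured_ball:
  assumes "discrete_in_disk L" "p \<in> unit_disk"
  obtains e where "e > 0" "ball p e \<subseteq> unit_disk" "ball p e - {p} \<subseteq> unit_disk - L"
proof -
  have "eventually (\<lambda>z. z \<notin> L) (at p)"
    using assms by (auto simp: discrete_in_disk_def islimpt_iff_eventually)
  then obtain d where d: "d > 0" "\<And>z. z \<noteq> p \<Longrightarrow> dist z p < d \<Longrightarrow> z \<notin> L"
    by (auto simp: eventually_at)
  obtain e where e: "e > 0" "ball p e \<subseteq> unit_disk"
    using assms(2) open_ball[of "0::complex" 1] open_contains_ball by blast
  show ?thesis
  proof (rule that[of "min d e"])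
    show "ball p (min d e) \<subseteq> unit_disk" using e(2) by auto
    show "ball p (min d e) - {p} \<subseteq> unit_disk - L"
      using e(2) d(2) by (auto simp: dist_commute)
  qed (use d e in auto)
qed

lemma open_disk_minus_discrete:
  assumes "discrete_in_disk L"
  shows "open (unit_disk - L)"
  unfolding open_contains_ball
proof
  fix p assume p: "p \<in> unit_disk - L"
  then obtain e where "e > 0" "ball p e - {p} \<subseteq> unit_disk - L"
    using discrete_punctured_ball[OF assms] by blast
  then show "\<exists>e>0. ball p e \<subseteq> unit_disk - L" using p by blast
qed

text \<open>Riemann's theorem is applied at each point separately: \<open>L\<close> may be infinite,
  but every point of the disk has a punctured neighbourhood avoiding it. Defining \<open>S\<close>
  by limits makes the local extensions agree.\<close>

lemma extend_bounded_holomorphic_discrete: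
  assumes L: "discrete_in_disk L" and f: "f holomorphic_on unit_disk - L"
    and f1: "\<And>z. z \<in> unit_disk - L \<Longrightarrow> cmod (f z) \<le> 1"
  shows "\<exists>S. schur_function S \<and> (\<forall>z\<in>unit_disk - L. S z = f z)"
proof -
  define S where "S z = Lim (at z) f" for z
  have Sf: "S z = f z" if "z \<in> unit_disk - L" for z
  proof -
    have "isCont f z"
      using f that open_disk_minus_discrete[OF L] by (metis continuous_on_eq_continuous_at holomorphic_on_imp_continuous_on)
    then show ?thesis unfolding S_def by (intro tendsto_Lim) (auto simp: isCont_def)
  qed
  have loc: "S field_differentiable at p \<and> cmod (S p) \<le> 1" if p: "p \<in> unit_disk" for p
  proof -
    obtain e where e: "e > 0" "ball p e \<subseteq> unit_disk" "ball p e - {p} \<subseteq> unit_disk - L"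
      using discrete_punctured_ball[OF L p] by blast
    have ev0: "eventually (\<lambda>z. z \<in> ball p e - {p}) (at p)"
      unfolding eventually_at using e(1) by (intro exI[of _ e]) (auto simp: dist_commute)
    then have ev: "eventually (\<lambda>z. cmod (f z) \<le> 1) (at p)"
      by eventually_elim (use e(3) f1 in blast)
    have "\<exists>g. g holomorphic_on ball p e \<and> (\<forall>z\<in>ball p e - {p}. g z = f z)"
      using e ev by (subst holomorphic_on_extend_bounded) (auto intro: holomorphic_on_subset[OF f])
    then obtain g where g: "g holomorphic_on ball p e" "\<forall>z\<in>ball p e - {p}. g z = f z" by blast
    have "isCont g p"
      using g(1) e(1) by (metis centre_in_ball continuous_on_eq_continuous_at holomorphic_on_imp_continuous_on open_ball)
    then have "(g \<longlongrightarrow> g p) (at p)" by (simp add: isCont_def)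
    moreover have "eventually (\<lambda>z. g z = f z) (at p)"
      using ev0 by eventually_elim (use g(2) in blast)
    ultimately have lim: "(f \<longlongrightarrow> g p) (at p)" using tendsto_cong by blast
    then have Sp: "S p = g p" unfolding S_def by (intro tendsto_Lim) auto
    have "S holomorphic_on ball p e"
    proof (rule holomorphic_transform[OF g(1)])
      fix z assume "z \<in> ball p e"
      then show "g z = S z" using Sp Sf e(3) g(2) by (cases "z = p") auto
    qed
    then have "S field_differentiable at p"
      using e(1) by (metis at_within_open centre_in_ball holomorphic_on_def open_ball)
    moreover have "cmod (g p) \<le> 1"
      using ev lim by (intro Lim_norm_ubound[of "at p" f "g p"]) auto
    ultimately show ?thesis using Sp by simp
  qed
  then have "S holomorphic_on unit_disk"
    by (auto simp: holomorphic_on_def intro: field_differentiable_at_within)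
  with loc Sf show ?thesis by (intro exI[of _ S]) (auto simp: schur_function_def)
qed

section \<open>Three-point conditions imply analyticity\<close>

lemma pair_defect_nonneg:
  assumes "p \<in> unit_disk" "\<And>x. qform (pick_kernel a b) {p} x \<ge> 0"
  shows "pair_defect a b p \<ge> 0"
proof -
  have "1 - (cmod p)\<^sup>2 > 0" using assms(1) by (simp add: abs_square_less_1)
  moreover have "pair_defect a b p / (1 - (cmod p)\<^sup>2) \<ge> 0"
    using assms(2)[of "\<lambda>_. 1"] unfolding qform_def by (simp add: pick_kernel_diag)
  ultimately show ?thesis by (simp add: zero_le_divide_iff)
qed

lemma pick_kernel_normalise:
  assumes "\<And>z. z \<in> G \<Longrightarrow> a z \<noteq> 0"
  shows "qform (pick (\<lambda>z. b z / a z)) G x = qform (pick_kernel a b) G (\<lambda>z. x z * inverse (a z))"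
proof -
  have "qform (pick (\<lambda>z. b z / a z)) G x =
     qform (\<lambda>z w. inverse (a z) * pick_kernel a b z w * cnj (inverse (a w))) G x"
    by (intro qform_cong) (auto simp: pick_kernel_def assms field_simps)
  then show ?thesis by (simp only: qform_congruence)
qed

text \<open>Three-point Pick conditions for f pivot to two-point conditions for the difference quotient
  of f at p; these make the quotient Lipschitz, so that its limit at p exists.\<close>

lemma three_point_pick_imp_differentiable:
  assumes L: "discrete_in_disk L" and p: "p \<in> unit_disk - L"
    and g1: "\<And>z. z \<in> unit_disk - L \<Longrightarrow> cmod (g z) < 1"
    and psd: "\<And>G x. finite G \<Longrightarrow> G \<subseteq> unit_disk - L \<Longrightarrow> card G \<le> 3 \<Longrightarrow> qform (pick g) G x \<ge> 0"
  shows "g field_differentiable at p"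
proof -
  let ?X = "unit_disk - L"
  let ?K = "pick g"
  define u where "u = pivot_u (\<lambda>_. 1) g p"
  define v where "v = pivot_v (\<lambda>_. 1) g p"
  define \<gamma> where "\<gamma> = g p"
  have pd: "p \<in> unit_disk" using p by auto
  have gam: "cmod \<gamma> < 1" using g1[OF p] by (simp add: \<gamma>_def)
  have d: "pair_defect (\<lambda>_. 1) g p > 0" using gam by (simp add: pair_defect_def \<gamma>_def abs_square_less_1)
  have Kp: "Re (?K p p) > 0" unfolding pick_kernel_diag using d pd by (simp add: abs_square_less_1)
  \<comment> \<open>The pivot at \<open>p\<close> spends one of the three points, so two are left
    for the pivoted pair.\<close>
  have psd1: "qform (pick_kernel (\<lambda>z. bfac p z * u z) v) G x \<ge> 0"
    if G: "finite G" "G \<subseteq> ?X - {p}" "card G \<le> 2" for G x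
  proof -
    have "\<not> neg_dim_ge ?K (insert p G) (Suc 0)"
      unfolding not_neg_dim_ge_1_iff using G p by (auto intro!: psd simp: card_insert_if)
    moreover have "p \<notin> G" "?K p p \<noteq> 0" using G(2) Kp by auto
    ultimately have "\<not> neg_dim_ge (schur_complement ?K p) G (Suc 0)"
      using neg_dim_ge_from_schur_complement[OF hermitian_pick_kernel G(1), of p "\<lambda>_. 1" g "Suc 0"] Kp
      by auto
    then have "qform (schur_complement ?K p) G x \<ge> 0" unfolding not_neg_dim_ge_1_iff by blast
    also have "qform (schur_complement ?K p) G x = qform (pick_kernel (\<lambda>z. bfac p z * u z) v) G x"
    proof (rule qform_cong)
      fix z w assume "z \<in> G" "w \<in> G"
      then have zw: "z \<in> unit_disk" "w \<in> unit_disk" using G(2) by auto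
      show "schur_complement ?K p z w = pick_kernel (\<lambda>z. bfac p z * u z) v z w"
        using d unfolding schur_complement_pick_kernel[OF pd zw less_imp_neq[OF d, symmetric]]
        by (simp add: u_def v_def)
    qed simp
    finally show ?thesis .
  qed
  define A where "A z = bfac p z * u z" for z
  define h where "h z = v z / A z" for z
  have Av: "A z \<noteq> 0 \<and> cmod (h z) \<le> 1" if z: "z \<in> ?X - {p}" for z
  proof -
    have "pair_defect A v z \<ge> 0"
      using psd1[of "{z}"] z unfolding A_def by (intro pair_defect_nonneg) auto
    then have "(cmod (v z))\<^sup>2 \<le> (cmod (A z))\<^sup>2" by (simp add: pair_defect_def)
    then have le: "cmod (v z) \<le> cmod (A z)" by (rule power2_le_imp_le) simp
    have "(A z, v z) \<noteq> (0, 0)"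
      unfolding A_def u_def v_def using d pd z by (intro pivot_nonzero) auto
    with le have "A z \<noteq> 0" by auto
    with le show ?thesis by (simp add: h_def norm_divide)
  qed
  have lip: "(cmod (h z - h w))\<^sup>2 * ((1 - (cmod z)\<^sup>2) * (1 - (cmod w)\<^sup>2)) \<le> 4 * (cmod (z - w))\<^sup>2"
    if z: "z \<in> ?X - {p}" and w: "w \<in> ?X - {p}" and zw: "z \<noteq> w" for z w
  proof -
    \<comment> \<open>Halving provides the strict bound required by \<open>two_point_pick\<close>,
      since \<open>h\<close> itself may have modulus 1. It is the source of the factor 4.\<close>
    define k where "k = (\<lambda>z. complex_of_real (1/2) * h z)"
    have G: "finite {z, w}" "{z, w} \<subseteq> ?X - {p}" "card {z, w} \<le> 2" "{z, w} \<subseteq> unit_disk"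
      using z w by (auto simp: card_insert_if)
    have hl: "cmod (h z) \<le> 1" "cmod (h w) \<le> 1" using Av z w by auto
    have "0 \<le> qform (pick k) {z, w} x" for x
    proof -
      have "0 \<le> qform (pick_kernel (\<lambda>z. bfac p z * u z) v) {z, w} (\<lambda>z. x z * inverse (A z))"
        by (rule psd1[OF G(1-3)])
      also have "\<dots> = qform (pick h) {z, w} x"
        unfolding h_def A_def[symmetric] using Av z w by (intro pick_kernel_normalise[symmetric]) auto
      also have "\<dots> \<le> qform (pick k) {z, w} x"
        unfolding k_def by (intro qform_pick_kernel_scale_ge G) auto
      finally show ?thesis .
    qed
    moreover have kl: "cmod (k z) \<le> 1/2" "cmod (k w) \<le> 1/2" using hl by (simp_all add: k_def norm_mult)
    ultimately have "(cmod (k z - k w))\<^sup>2 * ((1 - (cmod z)\<^sup>2) * (1 - (cmod w)\<^sup>2)) \<le>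
        (1 - (cmod (k z))\<^sup>2) * (1 - (cmod (k w))\<^sup>2) * (cmod (z - w))\<^sup>2"
      using z w zw by (intro two_point_pick) auto
    also have "(1 - (cmod (k z))\<^sup>2) * (1 - (cmod (k w))\<^sup>2) \<le> 1 * 1"
      using kl by (intro mult_mono) (auto simp: abs_square_le_1)
    then have "(1 - (cmod (k z))\<^sup>2) * (1 - (cmod (k w))\<^sup>2) * (cmod (z - w))\<^sup>2 \<le> 1 * (cmod (z - w))\<^sup>2"
      by (intro mult_right_mono) auto
    finally have "(cmod (k z - k w))\<^sup>2 * ((1 - (cmod z)\<^sup>2) * (1 - (cmod w)\<^sup>2)) \<le> (cmod (z - w))\<^sup>2" by simp
    moreover have "k z - k w = complex_of_real (1/2) * (h z - h w)" by (simp add: k_def algebra_simps)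
    then have "(cmod (k z - k w))\<^sup>2 = (cmod (h z - h w))\<^sup>2 / 4"
      by (simp only: norm_mult power_mult_distrib) (simp add: power2_eq_square)
    ultimately show ?thesis by simp
  qed
  obtain e0 where e0: "e0 > 0" "ball p e0 \<subseteq> unit_disk" "ball p e0 - {p} \<subseteq> ?X"
    using discrete_punctured_ball[OF L pd] by blast
  \<comment> \<open>The midpoint of |p| and 1. All points of \<open>X\<close> have modulus at most
    \<rho>, so 1 - |z|^2 is bounded below by \<open>c\<close> and the estimate becomes a Lipschitz
    condition.\<close>
  define \<rho> where "\<rho> = (1 + cmod p) / 2"
  define e where "e = min e0 ((1 - cmod p) / 2)"
  have e: "e > 0" using e0 pd by (simp add: e_def)
  define X where "X = ball p e - {p}"
  have XOm: "X \<subseteq> ?X - {p}" using e0(3) unfolding X_def e_def by auto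
  have \<rho>: "0 < \<rho>" "\<rho> < 1" using pd by (auto simp: \<rho>_def intro: add_pos_nonneg)
  have Xr: "cmod z \<le> \<rho>" if "z \<in> X" for z
  proof -
    have "cmod (z - p) < (1 - cmod p) / 2" using that by (auto simp: X_def e_def dist_norm norm_minus_commute)
    moreover have "cmod z \<le> cmod (z - p) + cmod p" by (metis diff_add_cancel norm_triangle_ineq)
    ultimately show ?thesis by (simp add: \<rho>_def field_simps)
  qed
  define c where "c = 1 - \<rho>\<^sup>2"
  have c: "c > 0" using \<rho> by (simp add: c_def abs_square_less_1)
  have lip': "cmod (h z - h w) \<le> 2 / c * cmod (z - w)" if z: "z \<in> X" and w: "w \<in> X" for z w
  proof (cases "z = w")
    case False
    have "c \<le> 1 - (cmod z)\<^sup>2" "c \<le> 1 - (cmod w)\<^sup>2"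
      using Xr[OF z] Xr[OF w] \<rho> by (auto simp: c_def intro!: power_mono)
    then have "c * c \<le> (1 - (cmod z)\<^sup>2) * (1 - (cmod w)\<^sup>2)" using c by (intro mult_mono) auto
    then have "(cmod (h z - h w))\<^sup>2 * (c * c) \<le> (cmod (h z - h w))\<^sup>2 * ((1 - (cmod z)\<^sup>2) * (1 - (cmod w)\<^sup>2))"
      by (intro mult_left_mono) auto
    also have "\<dots> \<le> 4 * (cmod (z - w))\<^sup>2" using XOm z w False by (intro lip) auto
    finally have "(c * cmod (h z - h w))\<^sup>2 \<le> (2 * cmod (z - w))\<^sup>2"
      by (simp add: power2_eq_square mult_ac)
    then have "c * cmod (h z - h w) \<le> 2 * cmod (z - w)" by (rule power2_le_imp_le) simp
    then show ?thesis using c by (simp add: field_simps)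
  qed simp
  have "uniformly_continuous_on X h"
    unfolding uniformly_continuous_on_def
  proof (intro allI impI)
    fix \<epsilon> :: real assume eps: "\<epsilon> > 0"
    show "\<exists>d>0. \<forall>x\<in>X. \<forall>x'\<in>X. dist x' x < d \<longrightarrow> dist (h x') (h x) < \<epsilon>"
    proof (intro exI[of _ "\<epsilon> * c / 2"] conjI ballI impI)
      show "\<epsilon> * c / 2 > 0" using eps c by simp
      fix x x' assume x: "x \<in> X" "x' \<in> X" "dist x' x < \<epsilon> * c / 2"
      have "dist (h x') (h x) \<le> 2 / c * dist x' x" using lip'[OF x(2,1)] by (simp add: dist_norm)
      also have "\<dots> < 2 / c * (\<epsilon> * c / 2)" using x(3) c by (intro mult_strict_left_mono) auto
      finally show "dist (h x') (h x) < \<epsilon>" using c by simp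
    qed
  qed
  moreover have atX: "at p within X = at p"
  proof -
    have "at p within X = at p within ball p e" unfolding X_def at_within_def by simp
    also have "\<dots> = at p" using e by (intro at_within_ball) auto
    finally show ?thesis .
  qed
  have "p islimpt X" using trivial_limit_within[of p X] atX by simp
  then have "p \<in> closure X" by (simp add: closure_def)
  ultimately obtain l where "(h \<longlongrightarrow> l) (at p within X)"
    by (rule uniformly_continuous_on_extension_at_closure)
  then have lim: "(h \<longlongrightarrow> l) (at p)" by (simp add: atX)
  define T where "T z = bfac \<gamma> (g z)" for z
  have Tp: "T p = 0" by (simp add: T_def \<gamma>_def)
  have g1': "cmod (g z) \<le> 1" if "z \<in> ?X" for z using g1[OF that] by simp
  have quot: "(T z - T p) / (z - p) = h z / (1 - cnj p * z)" if "z \<in> X" for z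
  proof -
    have z: "z \<in> ?X - {p}" using that XOm by auto
    then have nz: "A z \<noteq> 0" using Av by auto
    have "1 - cnj \<gamma> * g z \<noteq> 0" using cnj_mult_neq_1[OF gam g1'] z by auto
    then have "u z * T z = v z"
      by (simp add: u_def v_def pivot_u_def pivot_v_def T_def bfac_def \<gamma>_def mult.commute)
    then have "T z = bfac p z * h z" using nz by (simp add: h_def A_def field_simps)
    then show ?thesis using z by (simp add: Tp bfac_def)
  qed
  have "((\<lambda>z. h z / (1 - cnj p * z)) \<longlongrightarrow> l / (1 - cnj p * p)) (at p)"
    using cnj_mult_neq_1[of p p] pd by (intro tendsto_intros lim) auto
  moreover have "eventually (\<lambda>z. z \<in> X) (at p)"
    unfolding eventually_at X_def using e by (intro exI[of _ e]) (auto simp: dist_commute)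
  then have "eventually (\<lambda>z. h z / (1 - cnj p * z) = (T z - T p) / (z - p)) (at p)"
    by eventually_elim (simp add: quot)
  ultimately have "((\<lambda>z. (T z - T p) / (z - p)) \<longlongrightarrow> l / (1 - cnj p * p)) (at p)"
    by (rule Lim_transform_eventually)
  then have "T field_differentiable at p"
    unfolding field_differentiable_def has_field_derivative_iff by blast
  \<comment> \<open>\<open>T\<close> is \<open>g\<close> followed by the disk automorphism that
    moves g(p) to 0; the inverse automorphism carries differentiability at \<open>p\<close> back to
    \<open>g\<close>.\<close>
  then have R1: "(\<lambda>z. (T z + \<gamma>) / (1 + cnj \<gamma> * T z)) field_differentiable at p"
    by (intro derivative_intros) (auto simp: Tp)
  have R2: "(T z + \<gamma>) / (1 + cnj \<gamma> * T z) = g z" if "z \<in> ?X" for z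
  proof -
    have nz: "1 - cnj \<gamma> * g z \<noteq> 0" using cnj_mult_neq_1[OF gam g1'] that by auto
    have gg: "1 - cnj \<gamma> * \<gamma> \<noteq> 0" using cnj_mult_neq_1[OF gam, of \<gamma>] gam by auto
    have "T z + \<gamma> = g z * (1 - cnj \<gamma> * \<gamma>) / (1 - cnj \<gamma> * g z)"
      "1 + cnj \<gamma> * T z = (1 - cnj \<gamma> * \<gamma>) / (1 - cnj \<gamma> * g z)"
      using nz by (simp_all add: T_def bfac_def divide_simps) (simp_all add: algebra_simps)
    then show ?thesis using nz gg by simp
  qed
  have R3: "z \<in> ?X" if "dist z p < e" for z
    using that p XOm by (cases "z = p") (auto simp: X_def dist_commute)
  show ?thesis
    by (rule field_differentiable_transform_within[OF e UNIV_I _ R1]) (rule R2[OF R3])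
qed

text \<open>The one-point conditions show that \<open>a\<close> has no zeros and |b/a| <= 1. The
  quotient is halved before the differentiability lemma, which asks for modulus strictly below 1,
  and doubled afterwards; halving keeps positivity by \<open>qform_pick_kernel_scale_ge\<close>. The
  points of \<open>L\<close> are then removable singularities.\<close>

lemma hindmarsh:
  assumes L: "discrete_in_disk L" and nz: "\<And>z. z \<in> unit_disk - L \<Longrightarrow> (a z, b z) \<noteq> (0, 0)"
    and psd: "\<And>G x. finite G \<Longrightarrow> G \<subseteq> unit_disk - L \<Longrightarrow> card G \<le> 3 \<Longrightarrow> qform (pick_kernel a b) G x \<ge> 0"
  shows "\<exists>S. schur_function S \<and> (\<forall>z\<in>unit_disk - L. b z = a z * S z)"
proof -
  let ?X = "unit_disk - L"
  define f where "f z = b z / a z" for z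
  define g where "g = (\<lambda>z. complex_of_real (1/2) * f z)"
  have af: "a z \<noteq> 0 \<and> cmod (f z) \<le> 1" if z: "z \<in> ?X" for z
  proof -
    have "pair_defect a b z \<ge> 0" using psd[of "{z}"] z by (intro pair_defect_nonneg) auto
    then have "(cmod (b z))\<^sup>2 \<le> (cmod (a z))\<^sup>2" by (simp add: pair_defect_def)
    then have le: "cmod (b z) \<le> cmod (a z)" by (rule power2_le_imp_le) simp
    with nz[OF z] have "a z \<noteq> 0" by auto
    with le show ?thesis by (simp add: f_def norm_divide)
  qed
  have "g field_differentiable at p" if p: "p \<in> ?X" for p
  proof (rule three_point_pick_imp_differentiable[OF L p])
    show "cmod (g z) < 1" if "z \<in> ?X" for z
      using af[OF that] by (simp add: g_def norm_mult)
    fix G x assume G: "finite G" "G \<subseteq> ?X" "card G \<le> 3"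
    have "0 \<le> qform (pick_kernel a b) G (\<lambda>z. x z * inverse (a z))" by (rule psd[OF G])
    also have "\<dots> = qform (pick f) G x"
      unfolding f_def using af G(2) by (intro pick_kernel_normalise[symmetric]) auto
    also have "\<dots> \<le> qform (pick g) G x"
      unfolding g_def using G by (intro qform_pick_kernel_scale_ge) auto
    finally show "0 \<le> qform (pick g) G x" .
  qed
  then have "g holomorphic_on ?X"
    unfolding holomorphic_on_def by (blast intro: field_differentiable_at_within)
  then have "(\<lambda>z. 2 * g z) holomorphic_on ?X" by (intro holomorphic_intros)
  moreover have "(\<lambda>z. 2 * g z) = f" by (auto simp: g_def)
  ultimately have "f holomorphic_on ?X" by simp
  then obtain S where "schur_function S" "\<forall>z\<in>?X. S z = f z"
    using extend_bounded_holomorphic_discrete[OF L] af by blast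
  then show ?thesis using af by (intro exI[of _ S]) (auto simp: f_def)
qed

section \<open>Enlarging discrete sets and extending identities across them\<close>

lemma discrete_insert:
  assumes "discrete_in_disk L" "p \<in> unit_disk"
  shows "discrete_in_disk (insert p L)"
  using assms by (auto simp: discrete_in_disk_def islimpt_insert)

lemma discrete_Un_finite:
  assumes "discrete_in_disk L" "finite F" "F \<subseteq> unit_disk"
  shows "discrete_in_disk (L \<union> F)"
  using assms(2,3)
proof (induction F rule: finite_induct)
  case (insert p F)
  then show ?case using discrete_insert[of "L \<union> F" p] by simp
qed (use assms(1) in simp)

text \<open>Every point of the disk is a limit of points outside \<open>L\<close>, so the equality
  extends by continuity.\<close>

lemma eq_on_disk_if_eq_off_discrete:
  assumes L: "discrete_in_disk L" and f: "f holomorphic_on unit_disk" and g: "g holomorphic_on unit_disk"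
    and eq: "\<And>z. z \<in> unit_disk - L \<Longrightarrow> f z = g z" and z: "z \<in> unit_disk"
  shows "f z = (g z :: complex)"
proof -
  obtain e where e: "e > 0" "ball z e - {z} \<subseteq> unit_disk - L"
    by (rule discrete_punctured_ball[OF L z])
  have cont: "(h \<longlongrightarrow> h z) (at z)" if "h holomorphic_on unit_disk" for h
  proof -
    have "isCont h z"
      using holomorphic_on_imp_continuous_on[OF that] z
      by (simp add: continuous_on_eq_continuous_at[OF open_ball])
    then show ?thesis by (simp add: isCont_def)
  qed
  have "eventually (\<lambda>w. w \<in> ball z e - {z}) (at z)"
    unfolding eventually_at using e(1) by (intro exI[of _ e]) (auto simp: dist_commute)
  then have "eventually (\<lambda>w. g w = f w) (at z)"
    by eventually_elim (use e(2) eq in fastforce)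
  with cont[OF g] have "(f \<longlongrightarrow> g z) (at z)" by (rule Lim_transform_eventually)
  then show ?thesis using tendsto_unique[OF _ cont[OF f]] by simp
qed

section \<open>Uniqueness and limits of standard representations\<close>

text \<open>Uniqueness of a reduced fraction. A zero \<open>p\<close> of \<open>blaschke M\<close>
  is not a zero of \<open>S\<close>, hence it is one of \<open>blaschke M'\<close>; the common
  factor is cancelled away from \<open>p\<close>, and the equation is recovered at \<open>p\<close>
  by continuity.\<close>

lemma blaschke_cancel:
  assumes "set_mset M \<subseteq> unit_disk" "set_mset M' \<subseteq> unit_disk"
    "S holomorphic_on unit_disk" "S' holomorphic_on unit_disk"
    "\<And>z. z \<in> unit_disk \<Longrightarrow> S z * blaschke M' z = S' z * blaschke M z"
    "\<And>z. z \<in># M \<Longrightarrow> S z \<noteq> 0" "\<And>z. z \<in># M' \<Longrightarrow> S' z \<noteq> 0"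
  shows "M = M'"
  using assms
proof (induction M arbitrary: M')
  case empty
  show ?case
  proof (rule ccontr)
    assume "{#} \<noteq> M'"
    then obtain z where z: "z \<in># M'" by (metis multiset_nonemptyE)
    then have "z \<in> unit_disk" using empty.prems(2) by auto
    then show False
      using empty.prems(5)[of z] empty.prems(7)[OF z] z blaschke_eq_0_iff[OF empty.prems(2), of z] by auto
  qed
next
  case (add p M)
  have p: "p \<in> unit_disk" using add.prems(1) by auto
  have "S p * blaschke M' p = 0" using add.prems(5)[OF p] by simp
  then have "p \<in># M'"
    using add.prems(6)[of p] blaschke_eq_0_iff[OF add.prems(2), of p] p by auto
  then obtain N where N: "M' = add_mset p N" by (metis insert_DiffM)
  have "M = N"
  proof (rule add.IH)
    show "set_mset M \<subseteq> unit_disk" "set_mset N \<subseteq> unit_disk" using add.prems(1,2) N by auto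
    show "S z * blaschke N z = S' z * blaschke M z" if "z \<in> unit_disk" for z
    proof (rule eq_on_disk_if_eq_off_discrete[OF _ _ _ _ that])
      show "discrete_in_disk {p}" using p by (auto simp: discrete_in_disk_def islimpt_finite)
      show "(\<lambda>z. S z * blaschke N z) holomorphic_on unit_disk" "(\<lambda>z. S' z * blaschke M z) holomorphic_on unit_disk"
        using add.prems(1,2) N by (auto intro!: holomorphic_intros holomorphic_blaschke add.prems(3,4))
      fix w assume w: "w \<in> unit_disk - {p}"
      then have "bfac p w \<noteq> 0" using p by (simp add: bfac_eq_0_iff)
      then show "S w * blaschke N w = S' w * blaschke M w"
        using add.prems(5)[of w] w N by auto
    qed
  qed (use add.prems N in auto)
  then show ?case using N by simp
qed

text \<open>Off \<open>L\<close> and the two finite jump sets both fractions give the same point of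
  the projective line. Either component may vanish there, so the equation is derived once with the
  factor \<open>a\<close> and once with the factor \<open>b\<close>. The second numerator is only
  taken holomorphic because the limit argument inserts a rescaled Schur function.\<close>

lemma standard_pair_cross:
  assumes L: "discrete_in_disk L" and nz: "\<And>z. z \<in> unit_disk - L \<Longrightarrow> (a z, b z) \<noteq> (0, 0)"
    and 1: "standard_pair (unit_disk - L) a b S M"
    and h: "S' holomorphic_on unit_disk" and M': "set_mset M' \<subseteq> unit_disk"
    and fin: "finite (jump_set (unit_disk - L) a b S' M')" and z: "z \<in> unit_disk"
  shows "S z * blaschke M' z = S' z * blaschke M z"
proof (rule eq_on_disk_if_eq_off_discrete[OF _ _ _ _ z])
  let ?J = "jump_set (unit_disk - L) a b S M \<union> jump_set (unit_disk - L) a b S' M'"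
  show "discrete_in_disk (L \<union> ?J)"
    using 1 fin by (intro discrete_Un_finite L) (auto simp: standard_pair_def jump_set_def)
  show "(\<lambda>z. S z * blaschke M' z) holomorphic_on unit_disk" "(\<lambda>z. S' z * blaschke M z) holomorphic_on unit_disk"
    using 1 M' h by (auto intro!: holomorphic_intros holomorphic_blaschke simp: standard_pair_def schur_function_def)
  fix w assume w: "w \<in> unit_disk - (L \<union> ?J)"
  then have e: "b w * blaschke M w = a w * S w" "b w * blaschke M' w = a w * S' w" by (auto simp: jump_set_def)
  have "a w * (S w * blaschke M' w) = b w * blaschke M w * blaschke M' w" by (simp add: e(1))
  also have "\<dots> = (b w * blaschke M' w) * blaschke M w" by (simp add: mult_ac)
  finally have A: "a w * (S w * blaschke M' w) = a w * (S' w * blaschke M w)" by (simp add: e(2) mult_ac)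
  have "b w * (S w * blaschke M' w) = S w * (b w * blaschke M' w)" by (simp only: mult_ac)
  also have "\<dots> = S' w * (a w * S w)" unfolding e(2) by (simp only: mult_ac)
  also have "\<dots> = b w * (S' w * blaschke M w)" unfolding e(1)[symmetric] by (simp only: mult_ac)
  finally have B: "b w * (S w * blaschke M' w) = b w * (S' w * blaschke M w)" .
  have "a w \<noteq> 0 \<or> b w \<noteq> 0" using nz w by auto
  then show "S w * blaschke M' w = S' w * blaschke M w" using A B by (metis mult_left_cancel)
qed

lemma standard_pair_unique:
  assumes L: "discrete_in_disk L" and nz: "\<And>z. z \<in> unit_disk - L \<Longrightarrow> (a z, b z) \<noteq> (0, 0)"
    and 1: "standard_pair (unit_disk - L) a b S M" and 2: "standard_pair (unit_disk - L) a b S' M'"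
  shows "M = M'" "jump_set (unit_disk - L) a b S M = jump_set (unit_disk - L) a b S' M'"
proof -
  let ?X = "unit_disk - L"
  have cross: "S z * blaschke M' z = S' z * blaschke M z" if "z \<in> unit_disk" for z
    using 2 by (intro standard_pair_cross[OF L nz 1 _ _ _ that]) (auto simp: standard_pair_def schur_function_def)
  have hS: "S holomorphic_on unit_disk" "S' holomorphic_on unit_disk"
    using 1 2 by (auto simp: standard_pair_def schur_function_def)
  have M: "set_mset M \<subseteq> unit_disk" "set_mset M' \<subseteq> unit_disk" using 1 2 by (auto simp: standard_pair_def)
  show MM: "M = M'"
  proof (rule blaschke_cancel[OF M hS cross])
    show "S z \<noteq> 0" if "z \<in># M" for z
      using 1 that M(1) blaschke_eq_0_iff[OF M(1), of z] by (force simp: standard_pair_def)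
    show "S' z \<noteq> 0" if "z \<in># M'" for z
      using 2 that M(2) blaschke_eq_0_iff[OF M(2), of z] by (force simp: standard_pair_def)
  qed
  have "S z = S' z" if z: "z \<in> unit_disk" for z
  proof (rule eq_on_disk_if_eq_off_discrete[OF _ hS _ z])
    show "discrete_in_disk (set_mset M)"
      using M(1) by (auto simp: discrete_in_disk_def islimpt_finite countable_finite)
    fix w assume w: "w \<in> unit_disk - set_mset M"
    then show "S w = S' w" using cross[of w] blaschke_eq_0_iff[OF M(1), of w] MM by auto
  qed
  then show "jump_set ?X a b S M = jump_set ?X a b S' M'"
    unfolding jump_set_def MM by auto
qed

text \<open>For one fixed \<open>r\<close>, \<open>T\<close> = \<open>S / r\<close> with the same
  \<open>M\<close> represents \<open>(a, b)\<close> and has the same jumps; what is missing is |T|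
  <= 1. Comparison with the representation for any \<open>s\<close> between \<open>r\<close> and 1
  gives the bound 1 / s near the circle, where the Blaschke products have modulus close to 1, and
  hence in the disk. Then \<open>s\<close> is moved towards 1.\<close>

lemma standard_pair_limit:
  assumes L: "discrete_in_disk L" and nz: "\<And>z. z \<in> unit_disk - L \<Longrightarrow> (a z, b z) \<noteq> (0, 0)"
    and r0: "0 < r0" "r0 < 1"
    and std: "\<And>r. r0 < r \<Longrightarrow> r < 1 \<Longrightarrow> \<exists>S M. standard_pair (unit_disk - L) a (\<lambda>z. complex_of_real r * b z) S M \<and>
       size M + card (jump_set (unit_disk - L) a (\<lambda>z. complex_of_real r * b z) S M) = k"
  shows "\<exists>S M. standard_pair (unit_disk - L) a b S M \<and> size M + card (jump_set (unit_disk - L) a b S M) = k"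
proof -
  let ?X = "unit_disk - L"
  define r where "r = (r0 + 1) / 2"
  have r: "r0 < r" "r < 1" "r > 0" using r0 by (auto simp: r_def)
  obtain S M where S: "standard_pair ?X a (\<lambda>z. complex_of_real r * b z) S M"
    and k: "size M + card (jump_set ?X a (\<lambda>z. complex_of_real r * b z) S M) = k"
    using std[OF r(1,2)] by blast
  define T where "T z = S z / complex_of_real r" for z
  have scale: "jump_set ?X a (\<lambda>z. complex_of_real s * b z) (\<lambda>z. complex_of_real s * U z) N =
      jump_set ?X a b U N" if "s \<noteq> 0" for s U N
    using that by (auto simp: jump_set_def)
  have ST: "S = (\<lambda>z. complex_of_real r * T z)" using r by (auto simp: T_def)
  have J: "jump_set ?X a (\<lambda>z. complex_of_real r * b z) S M = jump_set ?X a b T M"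
    unfolding ST using r by (intro scale) auto
  have M: "set_mset M \<subseteq> unit_disk" and hS: "S holomorphic_on unit_disk"
    using S by (auto simp: standard_pair_def schur_function_def)
  have hT: "T holomorphic_on unit_disk" unfolding T_def using r by (intro holomorphic_intros hS) auto
  have Tle: "cmod (T z) \<le> 1 / s" if s: "r < s" "s < 1" and z: "z \<in> unit_disk" for s z
  proof (rule maximum_principle_to_circle[OF hT _ z])
    obtain S' M' where S': "standard_pair ?X a (\<lambda>z. complex_of_real s * b z) S' M'"
      using std[of s] s r by auto
    have M': "set_mset M' \<subseteq> unit_disk" and hS': "S' holomorphic_on unit_disk" and S1': "\<And>z. z \<in> unit_disk \<Longrightarrow> cmod (S' z) \<le> 1"
      using S' by (auto simp: standard_pair_def schur_function_def)
    \<comment> \<open>The numerator for \<open>s\<close>, rescaled to belong to the pair for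
      \<open>r\<close>, so that \<open>standard_pair_cross\<close> applies to both
      representations.\<close>
    define U where "U = (\<lambda>z. complex_of_real r / complex_of_real s * S' z)"
    have hU: "U holomorphic_on unit_disk" unfolding U_def by (intro holomorphic_intros hS')
    have "jump_set ?X a (\<lambda>z. complex_of_real s * b z) S' M' = jump_set ?X a (\<lambda>z. complex_of_real r * b z) U M'"
      using r s by (auto simp: jump_set_def U_def field_simps)
    then have "finite (jump_set ?X a (\<lambda>z. complex_of_real r * b z) U M')"
      using S' by (simp add: standard_pair_def)
    then have cross: "S z * blaschke M' z = U z * blaschke M z" if "z \<in> unit_disk" for z
      using nz r by (intro standard_pair_cross[OF L _ S hU M' _ that]) auto
    fix c assume c: "c > 1 / s"
    have "((\<lambda>z. 1 / s / cmod (blaschke M' z)) \<longlongrightarrow> 1 / s / 1) to_circle"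
      using tendsto_norm_blaschke[OF M'] by (intro tendsto_intros) auto
    then have ev1: "eventually (\<lambda>z. 1 / s / cmod (blaschke M' z) < c) to_circle"
      using c by (intro order_tendstoD) auto
    have ev2: "eventually (\<lambda>z. cmod (blaschke M' z) > 0) to_circle"
      using tendsto_norm_blaschke[OF M'] by (intro order_tendstoD) auto
    show "eventually (\<lambda>z. cmod (T z) \<le> c) to_circle"
      using ev1 ev2 in_disk_to_circle
    proof eventually_elim
      case (elim z)
      have "cmod (S z) * cmod (blaschke M' z) = cmod (U z) * cmod (blaschke M z)"
        using cross[OF elim(3)] by (metis norm_mult)
      also have "\<dots> \<le> cmod (U z) * 1"
        using elim(3) by (intro mult_left_mono norm_blaschke_le_1 M) auto
      also have "cmod (U z) \<le> r / s * 1"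
        unfolding U_def norm_mult using S1'[OF elim(3)] r s by (intro mult_mono) (auto simp: norm_divide)
      finally have "cmod (S z) * cmod (blaschke M' z) \<le> r / s" by simp
      then have "cmod (T z) * cmod (blaschke M' z) \<le> 1 / s"
        using r s by (simp add: T_def norm_divide field_simps)
      then have "cmod (T z) \<le> 1 / s / cmod (blaschke M' z)" using pos_le_divide_eq[OF elim(2)] by blast
      then show ?case using elim(1) by simp
    qed
  qed
  have "cmod (T z) \<le> 1" if z: "z \<in> unit_disk" for z
  proof (rule ccontr)
    assume "\<not> cmod (T z) \<le> 1"
    then have t: "cmod (T z) > 1" by simp
    \<comment> \<open>Chosen with 1 / |T z| < s < 1, which contradicts |T z| <= 1 / s.\<close>
    define s where "s = (max r (1 / cmod (T z)) + 1) / 2"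
    have tp: "cmod (T z) > 0" using t by linarith
    have "1 / cmod (T z) < 1" unfolding pos_divide_less_eq[OF tp] using t by linarith
    then have s: "r < s" "s < 1" "1 / cmod (T z) < s" using r by (auto simp: s_def max_def)
    have sp: "s > 0" using s(1) r(3) by linarith
    have "1 < s * cmod (T z)" using s(3) unfolding pos_divide_less_eq[OF tp] .
    then have "1 / s < cmod (T z)" unfolding pos_divide_less_eq[OF sp] by (simp only: mult.commute)
    then show False using Tle[OF s(1,2) z] by simp
  qed
  then have T: "schur_function T" using hT by (auto simp: schur_function_def)
  then have "standard_pair ?X a b T M"
    using S J r by (auto simp: standard_pair_def T_def)
  then show ?thesis using k J by auto
qed

section \<open>Standard representation from a stable negative index\<close>

lemma qform_sum_list:
  "qform (\<lambda>z w. \<Sum>e\<leftarrow>es. e z * cnj (e w)) G x = (\<Sum>e\<leftarrow>es. (cmod (\<Sum>z\<in>G. x z * e z))\<^sup>2)"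
proof (induction es)
  case (Cons e es)
  then show ?case by (simp add: qform_add_kernel qform_rank_one)
qed (simp add: qform_def)

text \<open>Each further zero \<open>a\<close> contributes one rank-one term: the previous Blaschke
  product times the normalised Szego kernel at \<open>a\<close>, a Takenaka-Malmquist
  function.\<close>

lemma blaschke_kernel_finite_rank:
  "set_mset M \<subseteq> unit_disk \<Longrightarrow> \<exists>es. length es = size M \<and>
     (\<forall>z\<in>unit_disk. \<forall>w\<in>unit_disk.
        pick (blaschke M) z w = (\<Sum>e\<leftarrow>es. e z * cnj (e w)))"
proof (induction M)
  case empty
  then show ?case by (auto simp: pick_kernel_def)
next
  case (add a M)
  have a: "cmod a < 1" using add.prems by auto
  from add obtain es where es: "length es = size M"
    "\<forall>z\<in>unit_disk. \<forall>w\<in>unit_disk.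
        pick (blaschke M) z w = (\<Sum>e\<leftarrow>es. e z * cnj (e w))" by auto
  define s where "s = complex_of_real (sqrt (1 - (cmod a)\<^sup>2))"
  have s2: "s * cnj s = complex_of_real (1 - (cmod a)\<^sup>2)"
    unfolding s_def using a by (simp add: abs_square_le_1 flip: of_real_mult)
  define e0 where "e0 z = blaschke M z * s / (1 - cnj a * z)" for z
  have "pick (blaschke (add_mset a M)) z w = e0 z * cnj (e0 w) + (\<Sum>e\<leftarrow>es. e z * cnj (e w))"
    if zw: "z \<in> unit_disk" "w \<in> unit_disk" for z w
  proof -
    have nz: "1 - z * cnj w \<noteq> 0" using zw cnj_mult_neq_1[of w z] by (auto simp: mult.commute)
    have "1 - bfac a z * blaschke M z * cnj (bfac a w * blaschke M w) =
       (1 - blaschke M z * cnj (blaschke M w)) + blaschke M z * cnj (blaschke M w) * (1 - bfac a z * cnj (bfac a w))"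
      by (simp add: algebra_simps)
    also have "1 - bfac a z * cnj (bfac a w) =
       s * cnj s * (1 - z * cnj w) / ((1 - cnj a * z) * (1 - a * cnj w))"
      unfolding s2 using zw by (intro one_minus_bfac a) auto
    finally have X: "1 - bfac a z * blaschke M z * cnj (bfac a w * blaschke M w) =
       (1 - blaschke M z * cnj (blaschke M w)) + blaschke M z * cnj (blaschke M w) *
         (s * cnj s * (1 - z * cnj w) / ((1 - cnj a * z) * (1 - a * cnj w)))" .
    have "pick (blaschke (add_mset a M)) z w =
       (1 - bfac a z * blaschke M z * cnj (bfac a w * blaschke M w)) / (1 - z * cnj w)"
      by (simp add: pick_kernel_def)
    also have "\<dots> = pick (blaschke M) z w + e0 z * cnj (e0 w)"
      unfolding X add_divide_distrib using nz by (simp add: pick_kernel_def e0_def mult_ac)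
    finally have "pick (blaschke (add_mset a M)) z w =
       pick (blaschke M) z w + e0 z * cnj (e0 w)" .
    then show ?thesis using es(2) zw by (simp add: add.commute)
  qed
  then show ?case using es(1) by (intro exI[of _ "e0 # es"]) (auto simp del: blaschke_add)
qed

text \<open>Vectors are subjected to one condition per jump and one per pole. With y = x / B the
  form becomes that of the Pick kernel of \<open>S\<close>, which is nonnegative, minus that of the
  Pick kernel of B, whose rank-one terms vanish by the conditions for the poles.\<close>

lemma neg_dim_standard_pair_le:
  assumes std: "standard_pair Om (\<lambda>_. 1) f S M" and Om: "Om \<subseteq> unit_disk" and G: "finite G" "G \<subseteq> Om"
  shows "\<not> neg_dim_ge (pick f) G (Suc (size M + card (jump_set Om (\<lambda>_. 1) f S M)))"
proof -
  let ?J = "jump_set Om (\<lambda>_. 1) f S M" and ?B = "blaschke M"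
  have S: "schur_function S" and M: "set_mset M \<subseteq> unit_disk"
    and cop: "\<And>z. z \<in> unit_disk \<Longrightarrow> ?B z = 0 \<Longrightarrow> S z \<noteq> 0" and fin: "finite ?J"
    using std by (auto simp: standard_pair_def)
  obtain es where es: "length es = size M" "\<forall>z\<in>unit_disk. \<forall>w\<in>unit_disk.
        pick ?B z w = (\<Sum>e\<leftarrow>es. e z * cnj (e w))"
    using blaschke_kernel_finite_rank[OF M] by blast
  obtain Jl where Jl: "set Jl = ?J" "length Jl = card ?J"
    using finite_distinct_list[OF fin] distinct_card by metis
  define fs where "fs = map (\<lambda>e z. e z / ?B z) es @ map (\<lambda>j z. if z = j then 1 else 0) Jl"
  have "\<not> neg_dim_ge (pick f) G (Suc (length fs))"
  proof (rule not_neg_dim_ge_if_nonneg_on_kernel)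
    fix x assume x: "\<And>e. e \<in> set fs \<Longrightarrow> (\<Sum>z\<in>G. x z * e z) = 0"
    have xJ: "x z = 0" if "z \<in> ?J" "z \<in> G" for z
    proof -
      have "(\<Sum>w\<in>G. x w * (if w = z then 1 else 0)) = 0"
        using that(1) by (intro x) (auto simp: fs_def Jl)
      then show ?thesis using that(2) G(1) by (simp add: if_distrib[of "(*) _"] cong: if_cong)
    qed
    \<comment> \<open>Zeros of the Blaschke product in \<open>Om\<close> are jumps, where x = 0, so
      division by zero does no harm.\<close>
    define y where "y z = x z / ?B z" for z
    have xe: "(\<Sum>z\<in>G. y z * e z) = 0" if "e \<in> set es" for e
      using x[of "\<lambda>z. e z / ?B z"] that by (auto simp: fs_def y_def)
    have xy: "x z = y z * ?B z \<and> x z * f z = y z * S z" if z: "z \<in> G" for z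
    proof (cases "z \<in> ?J")
      case True
      then show ?thesis using xJ z by (simp add: y_def)
    next
      case False
      then have Sf: "S z = f z * ?B z" using z G(2) by (auto simp: jump_set_def)
      then have "?B z \<noteq> 0" using cop[of z] z G(2) Om by auto
      then show ?thesis by (simp add: y_def Sf)
    qed
    have "qform (pick f) G x =
        qform (\<lambda>z w. pick S z w - (\<Sum>e\<leftarrow>es. e z * cnj (e w))) G y"
      unfolding qform_def
    proof (intro arg_cong[of _ _ Re] sum.cong refl)
      fix z w assume zw: "z \<in> G" "w \<in> G"
      then have zwd: "z \<in> unit_disk" "w \<in> unit_disk" using G(2) Om by auto
      have "x z * pick f z w * cnj (x w) =
         (x z * cnj (x w) - (x z * f z) * cnj (x w * f w)) / (1 - z * cnj w)"
        by (simp add: pick_kernel_def algebra_simps diff_divide_distrib)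
      also have "\<dots> = ((y z * ?B z) * cnj (y w * ?B w) - (y z * S z) * cnj (y w * S w)) / (1 - z * cnj w)"
        using xy[OF zw(1)] xy[OF zw(2)] by metis
      also have "\<dots> = y z * (pick S z w - pick ?B z w) * cnj (y w)"
        by (simp add: pick_kernel_def algebra_simps flip: diff_divide_distrib)
      finally show "x z * pick f z w * cnj (x w) =
         y z * (pick S z w - (\<Sum>e\<leftarrow>es. e z * cnj (e w))) * cnj (y w)"
        unfolding es(2)[rule_format, OF zwd] .
    qed
    also have "\<dots> = qform (pick S) G y - (\<Sum>e\<leftarrow>es. (cmod (\<Sum>z\<in>G. y z * e z))\<^sup>2)"
      by (simp only: qform_diff_kernel qform_sum_list)
    also have "(\<Sum>e\<leftarrow>es. (cmod (\<Sum>z\<in>G. y z * e z))\<^sup>2) = (\<Sum>e\<leftarrow>es. 0)"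
      using xe by (intro arg_cong[of _ _ sum_list] map_cong) auto
    finally show "qform (pick f) G x \<ge> 0"
      using qform_pick_kernel_schur_nonneg[OF S G(1), of y] G(2) Om by simp
  qed
  moreover have "length fs = size M + card ?J" by (simp add: fs_def es Jl)
  ultimately show ?thesis by simp
qed

lemma neg_dim_ge_le_card:
  assumes "finite G" "neg_dim_ge K G k"
  shows "k \<le> card G"
proof (rule ccontr)
  assume "\<not> k \<le> card G"
  then have "Suc (card G) \<le> k" by simp
  with assms(2) have k: "neg_dim_ge K G (Suc (card G))" by (rule neg_dim_ge_decrease)
  obtain Gl where Gl: "set Gl = G" "length Gl = card G"
    using finite_distinct_list[OF assms(1)] distinct_card by metis
  have "\<not> neg_dim_ge K G (Suc (length (map (\<lambda>j z. if z = j then 1 else (0::complex)) Gl)))"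
  proof (rule not_neg_dim_ge_if_nonneg_on_kernel)
    fix x assume x: "\<And>e. e \<in> set (map (\<lambda>j z. if z = j then 1 else (0::complex)) Gl) \<Longrightarrow> (\<Sum>z\<in>G. x z * e z) = 0"
    have "x z = 0" if "z \<in> G" for z
    proof -
      have "(\<Sum>w\<in>G. x w * (if w = z then 1 else 0)) = 0"
        using that by (intro x) (auto simp: Gl)
      then show ?thesis using that assms(1) by (simp add: if_distrib[of "(*) _"] cong: if_cong)
    qed
    then have "qform K G x = qform K G (\<lambda>_. 0)" by (intro qform_cong) auto
    then show "qform K G x \<ge> 0" by simp
  qed
  then show False using k Gl by simp
qed

text \<open>A pivot at \<open>p\<close> removes \<open>p\<close> from \<open>F\<close> and from the
  domain. At most n + 3 remaining points together with \<open>p\<close> are at most n + 4, so the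
  upper bound is inherited with the same surplus of three, which \<open>hindmarsh\<close> consumes
  when \<open>F\<close> is empty. A negative pivot lowers the index by one, and undoing it restores
  the unit as a pole or a jump.\<close>

lemma stable_negative_index_imp_standard:
  assumes "discrete_in_disk L" "\<And>z. z \<in> unit_disk - L \<Longrightarrow> (a z, b z) \<noteq> (0, 0)"
    "finite F" "F \<subseteq> unit_disk - L" "card F = n" "neg_dim_ge (pick_kernel a b) F k"
    "\<And>G. finite G \<Longrightarrow> G \<subseteq> unit_disk - L \<Longrightarrow> card G \<le> n + 3 \<Longrightarrow> \<not> neg_dim_ge (pick_kernel a b) G (Suc k)"
  shows "\<exists>S M. standard_pair (unit_disk - L) a b S M \<and> size M + card (jump_set (unit_disk - L) a b S M) = k"
  using assms
proof (induction n arbitrary: L a b F k)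
  case 0
  then have k: "k = 0" using neg_dim_ge_le_card[OF 0(3,6)] by simp
  have psd: "qform (pick_kernel a b) G x \<ge> 0" if "finite G" "G \<subseteq> unit_disk - L" "card G \<le> 3" for G x
    using 0(7)[OF that(1,2)] that(3) k not_neg_dim_ge_1_iff by auto
  obtain S where S: "schur_function S" "\<forall>z\<in>unit_disk - L. b z = a z * S z"
    using hindmarsh[OF 0(1) 0(2) psd] by blast
  have "jump_set (unit_disk - L) a b S {#} = {}" using S(2) by (auto simp: jump_set_def)
  then show ?case using S k by (intro exI[of _ S] exI[of _ "{#}"]) (auto simp: standard_pair_def)
next
  case (Suc n)
  let ?Om = "unit_disk - L"
  obtain p F1 where F: "F = insert p F1" "p \<notin> F1" "card F1 = n"
    using Suc.prems(5) by (auto simp: card_Suc_eq)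
  have p: "p \<in> ?Om" "p \<in> unit_disk" and F1: "finite F1" "F1 \<subseteq> ?Om - {p}"
    using Suc.prems(3,4) F by auto
  have Om1: "unit_disk - insert p L = ?Om - {p}" by auto
  have L1: "discrete_in_disk (insert p L)" by (rule discrete_insert[OF Suc.prems(1) p(2)])
  \<comment> \<open>Stated for an arbitrary second component \<open>c\<close>: a nondegenerate pivot
    uses \<open>b\<close> itself, a degenerate one uses the shrunk \<open>b\<close>.\<close>
  have step: "\<exists>S M. standard_pair ?Om a c S M \<and> size M + card (jump_set ?Om a c S M) = k"
    if d: "pair_defect a c p \<noteq> 0" and nz: "\<And>z. z \<in> ?Om \<Longrightarrow> (a z, c z) \<noteq> (0, 0)"
      and F': "neg_dim_ge (pick_kernel a c) F k"
      and G': "\<And>G. finite G \<Longrightarrow> G \<subseteq> ?Om \<Longrightarrow> card G \<le> Suc n + 3 \<Longrightarrow> \<not> neg_dim_ge (pick_kernel a c) G (Suc k)"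
    for c
  proof -
    let ?K = "pick_kernel a c"
    define u where "u = (\<lambda>z. bfac p z * pivot_u a c p z)"
    define v where "v = pivot_v a c p"
    have uv: "(u z, v z) \<noteq> (0, 0)" if "z \<in> ?Om - {p}" for z
      unfolding u_def v_def using that p nz[of z] by (intro pivot_nonzero d) auto
    have pos: "1 - (cmod p)\<^sup>2 > 0" using p(2) by (simp add: abs_square_less_1)
    have Knz: "?K p p \<noteq> 0" unfolding pick_kernel_diag of_real_eq_0_iff using d pos by simp
    have herm: "hermitian_kernel ?K" by (rule hermitian_pick_kernel)
    have Gp: "finite (insert p G)" "insert p G \<subseteq> ?Om" "card (insert p G) \<le> Suc n + 3"
      if "finite G" "G \<subseteq> ?Om - {p}" "card G \<le> n + 3" for G
      using that p by (auto simp: card_insert_if)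
    have sc: "neg_dim_ge (schur_complement ?K p) G j \<longleftrightarrow> neg_dim_ge
        (if pair_defect a c p > 0 then pick_kernel u v else pick_kernel v u) G j"
      if "G \<subseteq> ?Om - {p}" for G j
    proof -
      have "qform (schur_complement ?K p) G x = qform (if pair_defect a c p > 0 then pick_kernel u v else pick_kernel v u) G x" for x
      proof (rule qform_cong)
        fix z w assume "z \<in> G" "w \<in> G"
        then have zw: "z \<in> unit_disk" "w \<in> unit_disk" using that by auto
        show "schur_complement ?K p z w = (if pair_defect a c p > 0 then pick_kernel u v else pick_kernel v u) z w"
          unfolding schur_complement_pick_kernel[OF p(2) zw d] by (simp add: u_def v_def)
      qed simp
      then show ?thesis by (simp add: neg_dim_ge_def neg_family_def)
    qed
    show ?thesis
    proof (cases "pair_defect a c p > 0")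
      case True
      have Kpos: "Re (?K p p) > 0" unfolding pick_kernel_diag using True pos by simp
      have "neg_dim_ge (schur_complement ?K p) F1 k"
        using F' Kpos by (intro neg_dim_ge_schur_complement_pos herm F1 F(2)) (simp_all add: F(1))
      then have A: "neg_dim_ge (pick_kernel u v) F1 k" using sc[OF F1(2)] True by simp
      have B: "\<not> neg_dim_ge (pick_kernel u v) G (Suc k)"
        if G: "finite G" "G \<subseteq> ?Om - {p}" "card G \<le> n + 3" for G
      proof
        assume "neg_dim_ge (pick_kernel u v) G (Suc k)"
        then have "neg_dim_ge (schur_complement ?K p) G (Suc k)" using sc[OF G(2)] True by simp
        moreover have "p \<notin> G" using G(2) by auto
        ultimately have "neg_dim_ge ?K (insert p G) (Suc k)"
          using neg_dim_ge_from_schur_complement[OF herm G(1) _ Knz, of "Suc k"] Kpos by auto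
        then show False using G' Gp[OF G] by blast
      qed
      have "\<exists>S M. standard_pair (unit_disk - insert p L) u v S M \<and>
          size M + card (jump_set (unit_disk - insert p L) u v S M) = k"
      proof (rule Suc.IH[OF L1 _ F1(1) _ F(3) A])
        show "(u z, v z) \<noteq> (0, 0)" if "z \<in> unit_disk - insert p L" for z
          using that unfolding Om1 by (rule uv)
        show "F1 \<subseteq> unit_disk - insert p L" unfolding Om1 by (rule F1(2))
        show "\<not> neg_dim_ge (pick_kernel u v) G (Suc k)"
          if "finite G" "G \<subseteq> unit_disk - insert p L" "card G \<le> n + 3" for G
          using that unfolding Om1 by (rule B)
      qed
      then obtain S M where "standard_pair (?Om - {p}) u v S M" "size M + card (jump_set (?Om - {p}) u v S M) = k"
        unfolding Om1 by blast
      then show ?thesis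
        using standard_pair_unpivot_pos[OF _ p(1) True, of S M] unfolding u_def v_def by auto
    next
      case False
      then have neg: "pair_defect a c p < 0" using d by simp
      have Kneg: "Re (?K p p) < 0" unfolding pick_kernel_diag using neg pos by (simp add: divide_neg_pos)
      \<comment> \<open>A negative pivot is by itself one negative square, so \<open>k\<close>
        cannot be 0 and has a predecessor.\<close>
      have "neg_dim_ge ?K {p} (Suc 0)"
        unfolding neg_dim_ge_Suc_0 using Kneg by (intro exI[of _ "\<lambda>_. 1"]) (simp add: qform_def)
      then have "k \<noteq> 0" using G'[of "{p}"] p by (intro notI) simp
      then obtain k1 where k1: "k = Suc k1" by (cases k) auto
      have "neg_dim_ge (schur_complement ?K p) F1 k1"
        using F' Kneg by (intro neg_dim_ge_schur_complement_neg herm F1 F(2)) (simp_all add: F(1) k1)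
      then have A: "neg_dim_ge (pick_kernel v u) F1 k1" using sc[OF F1(2)] False by simp
      have B: "\<not> neg_dim_ge (pick_kernel v u) G (Suc k1)"
        if G: "finite G" "G \<subseteq> ?Om - {p}" "card G \<le> n + 3" for G
      proof
        assume "neg_dim_ge (pick_kernel v u) G (Suc k1)"
        then have "neg_dim_ge (schur_complement ?K p) G (Suc k1)" using sc[OF G(2)] False by simp
        moreover have "p \<notin> G" using G(2) by auto
        ultimately have "neg_dim_ge ?K (insert p G) (Suc k)"
          using neg_dim_ge_from_schur_complement[OF herm G(1) _ Knz, of "Suc k1"] Kneg k1 by auto
        then show False using G' Gp[OF G] by blast
      qed
      have vu: "(v z, u z) \<noteq> (0, 0)" if "z \<in> ?Om - {p}" for z using uv[OF that] by auto
      have "\<exists>S M. standard_pair (unit_disk - insert p L) v u S M \<and>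
          size M + card (jump_set (unit_disk - insert p L) v u S M) = k1"
      proof (rule Suc.IH[OF L1 _ F1(1) _ F(3) A])
        show "(v z, u z) \<noteq> (0, 0)" if "z \<in> unit_disk - insert p L" for z
          using that unfolding Om1 by (rule vu)
        show "F1 \<subseteq> unit_disk - insert p L" unfolding Om1 by (rule F1(2))
        show "\<not> neg_dim_ge (pick_kernel v u) G (Suc k1)"
          if "finite G" "G \<subseteq> unit_disk - insert p L" "card G \<le> n + 3" for G
          using that unfolding Om1 by (rule B)
      qed
      then obtain S M where "standard_pair (?Om - {p}) v u S M" "size M + card (jump_set (?Om - {p}) v u S M) = k1"
        unfolding Om1 by blast
      then show ?thesis
        using standard_pair_unpivot_neg[OF _ p(1) neg, of S M] k1 unfolding u_def v_def by auto
    qed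
  qed
  obtain \<epsilon> where \<epsilon>: "\<epsilon> > 0" "\<And>t. 0 \<le> t \<Longrightarrow> t < \<epsilon> \<Longrightarrow>
      neg_dim_ge (\<lambda>z w. pick_kernel a b z w + complex_of_real t * szego b z w) F k"
    using neg_dim_ge_perturb[OF Suc.prems(6), of "szego b"] by blast
  show ?case
  proof (cases "pair_defect a b p = 0")
    case False
    then show ?thesis using step[of b] Suc.prems by blast
  next
    case True
    \<comment> \<open>The 1/2 keeps \<open>r\<close> positive, and r > 1 - \<epsilon> / 2 gives 1 -
      r^2 <= 2 (1 - r) < \<epsilon>, a perturbation under which \<open>F\<close> keeps its
      index.\<close>
    define r0 where "r0 = max (1/2) (1 - \<epsilon> / 2)"
    have r0: "0 < r0" "r0 < 1" using \<epsilon>(1) by (auto simp: r0_def)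
    show ?thesis
    proof (rule standard_pair_limit[OF Suc.prems(1,2) r0])
      fix r assume r: "r0 < r" "r < 1"
      then have rpos: "r > 0" using r0 by simp
      let ?c = "\<lambda>z. complex_of_real r * b z"
      show "\<exists>S M. standard_pair ?Om a ?c S M \<and> size M + card (jump_set ?Om a ?c S M) = k"
      proof (rule step)
        have "b p \<noteq> 0" using True Suc.prems(2)[OF p(1)] by (auto simp: pair_defect_def)
        moreover have "(cmod (a p))\<^sup>2 = (cmod (b p))\<^sup>2" using True by (simp add: pair_defect_def)
        then have "pair_defect a ?c p = (1 - r\<^sup>2) * (cmod (b p))\<^sup>2"
          by (simp add: pair_defect_def norm_mult power_mult_distrib algebra_simps)
        moreover have "r\<^sup>2 < 1" using r rpos by (simp add: abs_square_less_1)
        ultimately show "pair_defect a ?c p \<noteq> 0" by simp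
        show "(a z, ?c z) \<noteq> (0, 0)" if "z \<in> ?Om" for z using Suc.prems(2)[OF that] rpos by auto
        have "1 - r\<^sup>2 = (1 - r) * (1 + r)" by (simp add: power2_eq_square algebra_simps)
        also have "\<dots> \<le> (1 - r) * 2" using r by (intro mult_left_mono) auto
        also have "\<dots> < \<epsilon>" using r by (simp add: r0_def)
        finally show "neg_dim_ge (pick_kernel a ?c) F k"
          unfolding pick_kernel_scale using \<open>r\<^sup>2 < 1\<close> by (intro \<epsilon>(2)) auto
        fix G assume G: "finite G" "G \<subseteq> ?Om" "card G \<le> Suc n + 3"
        \<comment> \<open>Shrinking the second component can only increase the form, so the upper
          bound carries over for every such \<open>r\<close>; just the lower bound on
          \<open>F\<close> requires \<open>r\<close> close to 1.\<close>
        show "\<not> neg_dim_ge (pick_kernel a ?c) G (Suc k)"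
        proof
          assume "neg_dim_ge (pick_kernel a ?c) G (Suc k)"
          then have "neg_dim_ge (pick_kernel a b) G (Suc k)"
            by (rule neg_dim_ge_mono_form) (use G r rpos in \<open>auto intro!: qform_pick_kernel_scale_ge\<close>)
          then show False using Suc.prems(7)[OF G] by blast
        qed
      qed
    qed
  qed
qed

section \<open>The equivalences\<close>

lemma blaschke_product_deg_blaschke:
  assumes M: "set_mset M \<subseteq> unit_disk"
  shows "blaschke_product_deg (blaschke M) (size M)"
proof -
  define p where "p = (\<Prod>a\<in>#M. [:- a, 1:])"
  define r where "r = (\<Prod>a\<in>#M. [:1, - cnj a:])"
  have pr: "poly p z = (\<Prod>a\<in>#M. z - a)" "poly r z = (\<Prod>a\<in>#M. 1 - cnj a * z)" for z
    unfolding p_def r_def by (induction M) (auto simp: algebra_simps)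
  have rnz: "poly r z \<noteq> 0" if "cmod z \<le> 1" for z
  proof -
    have "1 - cnj a * z \<noteq> 0" if "a \<in># M" for a
      using that \<open>cmod z \<le> 1\<close> M by (intro one_minus_cnj_mult_neq_0) auto
    then show ?thesis unfolding pr by (auto simp: prod_mset_zero_iff)
  qed
  have r0: "r \<noteq> 0" using rnz[of 0] by auto
  have B: "blaschke M z = poly p z / poly r z" for z
    unfolding pr by (induction M) (auto simp: bfac_def)
  have "proots p = M"
  proof -
    have "(\<Prod>a\<in>#N. [:- a, 1:]) \<noteq> (0 :: complex poly)" for N
      by (induction N) (auto simp del: mult_pCons_left)
    then have "proots (\<Prod>a\<in>#N. [:- a, 1:]) = (N :: complex multiset)" for N
      by (induction N) (auto simp: proots_mult proots_linear_factor simp del: mult_pCons_left)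
    then show ?thesis by (simp add: p_def)
  qed
  moreover have "filter_mset (\<lambda>z. z \<in> unit_disk) M = M"
    using M by (intro filter_mset_eq_conv[THEN iffD2]) auto
  ultimately show ?thesis
    unfolding blaschke_product_deg_def using r0 B rnz norm_blaschke_circle[OF M]
    by (intro exI[of _ p] exI[of _ r]) (simp del: mem_ball)
qed

text \<open>The quotient \<open>h\<close> of \<open>B\<close> by the Blaschke product of its zeros
  in the disk is zero-free on the closed disk and unimodular on the circle. The maximum principle
  for \<open>h\<close> and for its inverse forces |h(0)| = 1, so \<open>h\<close> is constant on the
  disk.\<close>

lemma blaschke_product_deg_imp_blaschke:
  assumes "blaschke_product_deg B q"
  shows "\<exists>M c. set_mset M \<subseteq> unit_disk \<and> size M = q \<and> cmod c = 1 \<and> (\<forall>z\<in>unit_disk. B z = c * blaschke M z)"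
proof -
  obtain p r where pr: "r \<noteq> 0" "\<forall>z. poly r z \<noteq> 0 \<longrightarrow> B z = poly p z / poly r z"
    "\<forall>z. cmod z \<le> 1 \<longrightarrow> poly r z \<noteq> 0" "\<forall>z. cmod z = 1 \<longrightarrow> cmod (B z) = 1"
    "size (filter_mset (\<lambda>z. z \<in> unit_disk) (proots p)) = q"
    using assms unfolding blaschke_product_deg_def by blast
  have Bz: "B z = poly p z / poly r z" if "cmod z \<le> 1" for z using pr(2,3) that by blast
  have p_circle: "poly p z \<noteq> 0" if "cmod z = 1" for z
    using Bz[of z] pr(4) that by auto
  have p0: "p \<noteq> 0" using p_circle[of 1] by (intro notI) simp
  define M where "M = filter_mset (\<lambda>z. z \<in> unit_disk) (proots p)"
  define N where "N = filter_mset (\<lambda>z. z \<notin> unit_disk) (proots p)"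
  have MN: "proots p = M + N" unfolding M_def N_def by (rule multiset_partition)
  have M: "set_mset M \<subseteq> unit_disk" by (auto simp: M_def)
  have p_eq: "poly p z = lead_coeff p * (\<Prod>a\<in>#M. z - a) * (\<Prod>a\<in>#N. z - a)" for z
  proof -
    have ev: "poly (\<Prod>a\<in>#X. [:- a, 1:]) z = (\<Prod>a\<in>#X. z - a)" for X
      by (induction X) (auto simp: algebra_simps)
    have "poly p z = poly (Polynomial.smult (lead_coeff p) (\<Prod>x\<in>#proots p. [:- x, 1:])) z"
      by (simp only: complex_poly_decompose_multiset)
    also have "\<dots> = lead_coeff p * (\<Prod>a\<in>#proots p. z - a)" by (simp add: ev)
    finally show ?thesis by (simp add: MN mult.assoc)
  qed
  define h where "h z = lead_coeff p * (\<Prod>a\<in>#N. z - a) * (\<Prod>a\<in>#M. 1 - cnj a * z) / poly r z" for z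
  have den: "(\<Prod>a\<in>#M. 1 - cnj a * z) \<noteq> 0" if "cmod z \<le> 1" for z
  proof -
    have "1 - cnj a * z \<noteq> 0" if "a \<in># M" for a
      using that \<open>cmod z \<le> 1\<close> M by (intro one_minus_cnj_mult_neq_0) auto
    then show ?thesis by (auto simp: prod_mset_zero_iff)
  qed
  have bl: "blaschke M z = (\<Prod>a\<in>#M. z - a) / (\<Prod>a\<in>#M. 1 - cnj a * z)" for z
    unfolding blaschke_def by (induction M) (auto simp: bfac_def)
  have Bh: "B z = h z * blaschke M z" if "cmod z \<le> 1" for z
    using den[OF that] unfolding Bz[OF that] h_def bl p_eq by (simp add: mult_ac)
  have hol_prod: "(\<lambda>z. \<Prod>a\<in>#X. f a z) holomorphic_on A"
    if "\<And>a. f a holomorphic_on A" for X A and f :: "complex \<Rightarrow> complex \<Rightarrow> complex"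
    by (induction X) (auto intro!: holomorphic_intros that)
  have hh: "h holomorphic_on cball 0 1"
    unfolding h_def using pr(3) by (intro holomorphic_intros hol_prod) auto
  have hnz: "h z \<noteq> 0" if "cmod z \<le> 1" for z
  proof -
    have "z \<notin># N"
    proof
      assume z: "z \<in># N"
      then have "z \<in># proots p" "\<not> cmod z < 1" by (auto simp: N_def)
      then have "poly p z = 0" "cmod z = 1" using p0 that by auto
      then show False using p_circle by blast
    qed
    then have "(\<Prod>a\<in>#N. z - a) \<noteq> 0" by (auto simp: prod_mset_zero_iff)
    then show ?thesis using p0 den[OF that] pr(3) that by (auto simp: h_def)
  qed
  have hcirc: "cmod (h z) = 1" if "cmod z = 1" for z
  proof -
    have "cmod (h z * blaschke M z) = 1" using Bh[of z] pr(4) that by auto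
    then show ?thesis using norm_blaschke_circle[OF M that] by (simp add: norm_mult)
  qed
  have "cmod (h z) \<le> 1" if "z \<in> unit_disk" for z
  proof (rule maximum_modulus_frontier[of h unit_disk 1])
    show "h holomorphic_on interior unit_disk" by (intro holomorphic_on_subset[OF hh]) auto
    show "continuous_on (closure unit_disk) h"
      using holomorphic_on_imp_continuous_on[OF hh] by simp
  qed (use that hcirc in auto)
  then have sh: "schur_function h"
    by (auto simp: schur_function_def intro: holomorphic_on_subset[OF hh])
  have "cmod (inverse (h 0)) \<le> 1"
  proof (rule maximum_modulus_frontier[of "\<lambda>z. inverse (h z)" unit_disk 1])
    have inv: "(\<lambda>z. inverse (h z)) holomorphic_on cball 0 1"
      using hnz by (intro holomorphic_intros hh) auto
    show "(\<lambda>z. inverse (h z)) holomorphic_on interior unit_disk"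
      by (intro holomorphic_on_subset[OF inv]) auto
    show "continuous_on (closure unit_disk) (\<lambda>z. inverse (h z))"
      using holomorphic_on_imp_continuous_on[OF inv] by simp
  qed (auto simp: hcirc norm_inverse)
  then have "cmod (h 0) \<ge> 1" using hnz[of 0] by (simp add: norm_inverse inverse_le_1_iff)
  then have h0: "cmod (h 0) = 1" using sh by (simp add: schur_function_def antisym)
  have hc: "h z = h 0" if "z \<in> unit_disk" for z
    using schur_norm_1_imp_constant[OF sh _ h0 that] by simp
  have "B z = h 0 * blaschke M z" if "z \<in> unit_disk" for z
    using Bh[of z] that unfolding hc[OF that] by simp
  then show ?thesis using M pr(5) h0 by (intro exI[of _ M] exI[of _ "h 0"]) (auto simp: M_def)
qed

text \<open>The unimodular constant of \<open>B\<close> is moved into the numerator; the jump set of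
  the resulting pair is then exactly \<open>Z\<close>. Conversely, poles inside the domain are jumps
  already, so \<open>W\<close> consists of the poles that lie in \<open>L\<close>.\<close>

lemma standard_function_iff_standard_pair:
  fixes L f \<kappa>
  shows "(\<exists>l\<le>\<kappa>. \<exists>g W Z gamma B S.
           standard_function g W Z gamma B S (\<kappa> - l) \<and> card Z = l \<and>
           W \<subseteq> L \<and> (\<forall>z\<in>unit_disk - L. g z = f z) \<and> Z \<inter> L = {}) \<longleftrightarrow>
    (\<exists>S M. standard_pair (unit_disk - L) (\<lambda>_. 1) f S M \<and>
        size M + card (jump_set (unit_disk - L) (\<lambda>_. 1) f S M) = \<kappa>)" (is "?A \<longleftrightarrow> ?B")
proof -
  let ?J = "jump_set (unit_disk - L) (\<lambda>_. 1) f"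
  show ?thesis
  proof
  assume ?A
  then obtain l g W Z gamma B S where l: "l \<le> \<kappa>" and std: "standard_function g W Z gamma B S (\<kappa> - l)"
    and Z: "card Z = l" and W: "W \<subseteq> L" and gf: "\<forall>z\<in>unit_disk - L. g z = f z" and ZL: "Z \<inter> L = {}"
    by blast
  have fin: "finite Z" and Zd: "Z \<subseteq> unit_disk" and B: "blaschke_product_deg B (\<kappa> - l)" and S: "schur_function S"
    and ZB: "zero_set B \<subseteq> W \<union> Z" and cop: "zero_set B \<inter> zero_set S = {}"
    and ga: "\<forall>z\<in>Z - zero_set B. S z / B z \<noteq> gamma z" and gSB: "\<forall>z\<in>unit_disk - (W \<union> Z). g z = S z / B z"
    and gZ: "\<forall>z\<in>Z. g z = gamma z"
    using std by (simp_all add: standard_function_def)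
  obtain M c where M: "set_mset M \<subseteq> unit_disk" "size M = \<kappa> - l" and c: "cmod c = 1"
    and BM: "\<forall>z\<in>unit_disk. B z = c * blaschke M z"
    using blaschke_product_deg_imp_blaschke[OF B] by blast
  have cnz: "c \<noteq> 0" using c by auto
  define S' where "S' = (\<lambda>z. S z / c)"
  have S': "schur_function S'"
    using S c cnz by (auto simp: schur_function_def S'_def norm_divide intro!: holomorphic_intros)
  have cop': "S z \<noteq> 0" if "z \<in> unit_disk" "B z = 0" for z
    using cop that by (auto simp: zero_set_def)
  have jz: "z \<in> ?J S' M \<longleftrightarrow> z \<in> Z" if z: "z \<in> unit_disk - L" for z
  proof -
    have zd: "z \<in> unit_disk" using z by auto
    have fz: "f z = g z" using gf z by simp
    have "f z * blaschke M z \<noteq> S' z \<longleftrightarrow> f z * B z \<noteq> S z"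
      using BM[rule_format, OF zd] cnz by (auto simp: S'_def field_simps)
    moreover have "f z * B z \<noteq> S z \<longleftrightarrow> z \<in> Z"
    proof
      assume "z \<in> Z"
      then have fg: "f z = gamma z" using fz gZ by simp
      show "f z * B z \<noteq> S z"
      proof (cases "B z = 0")
        case True
        then show ?thesis using cop'[OF zd] by auto
      next
        case False
        then have "S z / B z \<noteq> gamma z" using ga \<open>z \<in> Z\<close> by (auto simp: zero_set_def)
        then show ?thesis using False fg by (auto simp: field_simps)
      qed
    next
      assume ne: "f z * B z \<noteq> S z"
      show "z \<in> Z"
      proof (rule ccontr)
        assume "z \<notin> Z"
        moreover have "z \<notin> W" using z W by auto
        ultimately have "f z = S z / B z" "B z \<noteq> 0"
          using gSB fz zd ZB by (auto simp: zero_set_def)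
        then show False using ne by simp
      qed
    qed
    ultimately show ?thesis using z by (simp add: jump_set_def)
  qed
  have "Z \<subseteq> unit_disk - L" using Zd ZL by blast
  moreover have "?J S' M \<subseteq> unit_disk - L" by (auto simp: jump_set_def)
  ultimately have J: "?J S' M = Z" using jz by blast
  have "standard_pair (unit_disk - L) (\<lambda>_. 1) f S' M"
    using S' M(1) fin BM cop' cnz unfolding standard_pair_def J by (auto simp: S'_def)
  then show ?B using J M(2) Z l by (intro exI[of _ S'] exI[of _ M]) auto
next
  assume ?B
  then obtain S M where std: "standard_pair (unit_disk - L) (\<lambda>_. 1) f S M"
    and k: "size M + card (?J S M) = \<kappa>" by blast
  define Z where "Z = ?J S M"
  define W where "W = set_mset M \<inter> L"
  \<comment> \<open>On \<open>L\<close> the extension follows the fraction. At the poles in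
    \<open>L\<close>, which form \<open>W\<close> and lie outside its domain, only the default of
    division is left.\<close>
  define g where "g z = (if z \<in> L then S z / blaschke M z else f z)" for z
  have S: "schur_function S" and M: "set_mset M \<subseteq> unit_disk"
    and cop: "\<And>z. z \<in> unit_disk \<Longrightarrow> blaschke M z = 0 \<Longrightarrow> S z \<noteq> 0" and fin: "finite Z"
    using std by (auto simp: standard_pair_def Z_def)
  have zB: "zero_set (blaschke M) = set_mset M"
    using M blaschke_eq_0_iff[OF M] by (auto simp: zero_set_def)
  have MZ: "z \<in> Z" if "z \<in># M" "z \<notin> L" for z
    using that M cop[of z] blaschke_eq_0_iff[OF M, of z] by (auto simp: Z_def jump_set_def)
  have Zsub: "Z \<subseteq> unit_disk - L" by (auto simp: Z_def jump_set_def)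
  have gS: "g z = S z / blaschke M z" if z: "z \<in> unit_disk - (W \<union> Z)" for z
  proof (cases "z \<in> L")
    case False
    then have "f z * blaschke M z = S z" using z by (auto simp: Z_def jump_set_def)
    moreover have "blaschke M z \<noteq> 0" using blaschke_eq_0_iff[OF M, of z] MZ z False by auto
    ultimately show ?thesis using False by (simp add: g_def field_simps)
  qed (simp add: g_def)
  have sf: "standard_function g W Z f (blaschke M) S (size M)"
    unfolding standard_function_def zB
  proof (intro conjI)
    show "finite Z" by (rule fin)
    show "finite W" by (simp add: W_def)
    show "Z \<subseteq> unit_disk" using Zsub by blast
    show "W \<subseteq> unit_disk" using M by (auto simp: W_def)
    show "Z \<inter> W = {}" using Zsub by (auto simp: W_def)
    show "blaschke_product_deg (blaschke M) (size M)" by (rule blaschke_product_deg_blaschke[OF M])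
    show "schur_function S" by (rule S)
    show "W \<subseteq> set_mset M" by (simp add: W_def)
    show "set_mset M \<subseteq> W \<union> Z" using MZ by (auto simp: W_def)
    show "set_mset M \<inter> zero_set S = {}"
      using cop M blaschke_eq_0_iff[OF M] by (auto simp: zero_set_def subset_iff)
    show "\<forall>z\<in>Z - set_mset M. S z / blaschke M z \<noteq> f z"
    proof
      fix z assume z: "z \<in> Z - set_mset M"
      then have "blaschke M z \<noteq> 0" using blaschke_eq_0_iff[OF M, of z] Zsub by auto
      moreover have "f z * blaschke M z \<noteq> S z" using z by (auto simp: Z_def jump_set_def)
      ultimately show "S z / blaschke M z \<noteq> f z" by (auto simp: field_simps)
    qed
    show "\<forall>z\<in>unit_disk - (W \<union> Z). g z = S z / blaschke M z" using gS by blast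
    show "\<forall>z\<in>Z. g z = f z" using Zsub by (auto simp: g_def)
  qed
  have kZ: "size M = \<kappa> - card Z" "card Z \<le> \<kappa>" using k by (auto simp: Z_def)
  have rest: "W \<subseteq> L" "\<forall>z\<in>unit_disk - L. g z = f z" "Z \<inter> L = {}"
    using Zsub by (auto simp: W_def g_def)
  show ?A
    by (rule exI[of _ "card Z"], rule conjI[OF kZ(2)], rule exI[of _ g], rule exI[of _ W],
        rule exI[of _ Z], rule exI[of _ f], rule exI[of _ "blaschke M"], rule exI[of _ S])
       (intro conjI sf[unfolded kZ(1)] refl rest)
  qed
qed

section \<open>Point sets of prescribed size and the numbers k_n\<close>

lemma infinite_disk_minus_discrete:
  assumes "discrete_in_disk L"
  shows "infinite (unit_disk - L)"
proof
  assume "finite (unit_disk - L)"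
  then have "countable (unit_disk - L)" by (rule countable_finite)
  moreover have "countable L" using assms by (auto simp: discrete_in_disk_def)
  ultimately have "countable ((unit_disk - L) \<union> L)" by (intro countable_Un)
  then have "countable (unit_disk :: complex set)" by (rule countable_subset[rotated]) auto
  then show False using uncountable_ball[of 1 "0::complex"] by simp
qed

lemma extend_finite_set_to_card:
  assumes "infinite X" "finite F" "F \<subseteq> X" "card F \<le> m"
  obtains F' where "finite F'" "F \<subseteq> F'" "F' \<subseteq> X" "card F' = m"
proof -
  have "infinite (X - F)" using assms by simp
  then obtain B where B: "finite B" "card B = m - card F" "B \<subseteq> X - F"
    using infinite_arbitrarily_large by blast
  have "card (F \<union> B) = m" using B assms by (subst card_Un_disjoint) auto
  then show ?thesis using B assms by (intro that[of "F \<union> B"]) auto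
qed

lemma in_S_kappa_iff:
  "in_S_kappa \<kappa> X f \<longleftrightarrow>
    (\<forall>F. finite F \<and> F \<subseteq> X \<longrightarrow> \<not> neg_dim_ge (pick f) F (Suc \<kappa>)) \<and>
    (\<exists>F. finite F \<and> F \<subseteq> X \<and> neg_dim_ge (pick f) F \<kappa>)" (is "_ \<longleftrightarrow> ?R")
proof -
  let ?s = "\<lambda>zs. sq_minus (pick_matrix f zs)" and ?K = "pick f"
  have le: "?s zs \<le> \<kappa> \<longleftrightarrow> \<not> neg_dim_ge ?K (set zs) (Suc \<kappa>)" if "distinct zs" for zs
    using le_sq_minus_pick_matrix_iff[OF that, of "Suc \<kappa>" f] by auto
  have ge: "\<kappa> \<le> ?s zs \<longleftrightarrow> neg_dim_ge ?K (set zs) \<kappa>" if "distinct zs" for zs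
    by (rule le_sq_minus_pick_matrix_iff[OF that])
  have lists: "(\<exists>zs. distinct zs \<and> set zs = F) \<longleftrightarrow> finite F" for F :: "complex set"
    using finite_distinct_list by auto
  show ?thesis
  proof
    assume A: "in_S_kappa \<kappa> X f"
    show ?R
    proof (intro conjI allI impI)
      fix F assume F: "finite F \<and> F \<subseteq> X"
      then obtain zs where "distinct zs" "set zs = F" using lists by blast
      then show "\<not> neg_dim_ge ?K F (Suc \<kappa>)" using A F le unfolding in_S_kappa_def by blast
    next
      obtain zs where "distinct zs" "set zs \<subseteq> X" "?s zs = \<kappa>" using A unfolding in_S_kappa_def by blast
      then show "\<exists>F. finite F \<and> F \<subseteq> X \<and> neg_dim_ge ?K F \<kappa>"
        using ge by (intro exI[of _ "set zs"]) auto
    qed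
  next
    assume R: ?R
    then obtain F where F: "finite F" "F \<subseteq> X" "neg_dim_ge ?K F \<kappa>" by blast
    then obtain zs where zs: "distinct zs" "set zs = F" using lists by blast
    have "?s zs = \<kappa>" using F R zs le[of zs] ge[of zs] by auto
    then show "in_S_kappa \<kappa> X f" unfolding in_S_kappa_def using R F zs le by auto
  qed
qed

text \<open>\<open>Max\<close> is meaningful on finite nonempty sets: the index of an n by n Pick
  matrix is at most \<open>n\<close>, and an infinite \<open>X\<close> has subsets of every finite
  size. The case \<open>n\<close> = 0 is separate because \<open>k_num\<close> is 0 there by
  convention.\<close>

lemma k_num_eq_iff:
  assumes X: "infinite X"
  shows "k_num X f n = \<kappa> \<longleftrightarrow>
    (\<forall>F. finite F \<and> F \<subseteq> X \<and> card F = n \<longrightarrow> \<not> neg_dim_ge (pick f) F (Suc \<kappa>)) \<and>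
    (\<exists>F. finite F \<and> F \<subseteq> X \<and> card F = n \<and> neg_dim_ge (pick f) F \<kappa>)" (is "_ \<longleftrightarrow> ?R")
proof (cases "n = 0")
  case True
  let ?K = "pick f"
  have e: "neg_dim_ge ?K {} k \<longleftrightarrow> k = 0" for k
    using neg_dim_ge_le_card[of "{}" ?K k] by auto
  have "?R \<longleftrightarrow> \<kappa> = 0"
  proof
    assume ?R
    then obtain F where "finite F" "card F = 0" "neg_dim_ge ?K F \<kappa>" using True by blast
    then show "\<kappa> = 0" using e[of \<kappa>] by simp
  next
    assume k0: "\<kappa> = 0"
    show ?R
    proof (intro conjI allI impI)
      fix F assume "finite F \<and> F \<subseteq> X \<and> card F = n"
      then have "F = {}" using True by auto
      then show "\<not> neg_dim_ge ?K F (Suc \<kappa>)" using e[of "Suc \<kappa>"] by simp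
    next
      show "\<exists>F. finite F \<and> F \<subseteq> X \<and> card F = n \<and> neg_dim_ge ?K F \<kappa>"
        using True k0 by (intro exI[of _ "{}"]) simp
    qed
  qed
  moreover have "k_num X f n = \<kappa> \<longleftrightarrow> \<kappa> = 0" using True by (auto simp: k_num_def)
  ultimately show ?thesis by (simp only:)
next
  case False
  let ?s = "\<lambda>zs. sq_minus (pick_matrix f zs)" and ?K = "pick f"
  define V where "V = {?s zs | zs. length zs = n \<and> distinct zs \<and> set zs \<subseteq> X}"
  have kV: "k_num X f n = Max V" using False by (simp add: k_num_def V_def)
  have sle: "?s zs \<le> length zs" if "distinct zs" for zs
    using le_sq_minus_pick_matrix_iff[OF that, of "?s zs" f] neg_dim_ge_le_card[of "set zs" ?K "?s zs"] distinct_card[OF that]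
    by auto
  have "V \<subseteq> {..n}" unfolding V_def using sle by auto
  then have finV: "finite V" by (rule finite_subset) simp
  obtain F0 where "finite F0" "F0 \<subseteq> X" "card F0 = n"
    using extend_finite_set_to_card[OF X, of "{}" n] by auto
  moreover from this obtain zs0 where "distinct zs0" "set zs0 = F0" using finite_distinct_list by blast
  ultimately have neV: "V \<noteq> {}" unfolding V_def using distinct_card by fastforce
  have le: "?s zs \<le> \<kappa> \<longleftrightarrow> \<not> neg_dim_ge ?K (set zs) (Suc \<kappa>)" if "distinct zs" for zs
    using le_sq_minus_pick_matrix_iff[OF that, of "Suc \<kappa>" f] by auto
  have ge: "\<kappa> \<le> ?s zs \<longleftrightarrow> neg_dim_ge ?K (set zs) \<kappa>" if "distinct zs" for zs
    by (rule le_sq_minus_pick_matrix_iff[OF that])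
  have lists: "\<exists>zs. distinct zs \<and> set zs = F \<and> length zs = n" if "finite F" "card F = n" for F :: "complex set"
    using finite_distinct_list[OF that(1)] distinct_card that(2) by metis
  have "k_num X f n = \<kappa> \<longleftrightarrow> \<kappa> \<in> V \<and> (\<forall>v\<in>V. v \<le> \<kappa>)"
    unfolding kV using Max_eq_iff[OF finV neV] by blast
  also have "\<dots> \<longleftrightarrow> ?R"
  proof
    assume A: "\<kappa> \<in> V \<and> (\<forall>v\<in>V. v \<le> \<kappa>)"
    show ?R
    proof (intro conjI allI impI)
      fix F assume F: "finite F \<and> F \<subseteq> X \<and> card F = n"
      then obtain zs where zs: "distinct zs" "set zs = F" "length zs = n" using lists by blast
      then have "?s zs \<in> V" using F unfolding V_def by blast
      then show "\<not> neg_dim_ge ?K F (Suc \<kappa>)" using A zs le[of zs] by auto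
    next
      obtain zs where "length zs = n" "distinct zs" "set zs \<subseteq> X" "?s zs = \<kappa>" using A unfolding V_def by blast
      then show "\<exists>F. finite F \<and> F \<subseteq> X \<and> card F = n \<and> neg_dim_ge ?K F \<kappa>"
        using ge[of zs] distinct_card[of zs] by (intro exI[of _ "set zs"]) auto
    qed
  next
    assume R: ?R
    then obtain F where F: "finite F" "F \<subseteq> X" "card F = n" "neg_dim_ge ?K F \<kappa>" by blast
    obtain zs where zs: "distinct zs" "set zs = F" "length zs = n" using lists[OF F(1,3)] by blast
    have "v \<le> \<kappa>" if v: "v \<in> V" for v
    proof -
      obtain ys where ys: "length ys = n" "distinct ys" "set ys \<subseteq> X" "v = ?s ys"
        using v unfolding V_def by blast
      then have "\<not> neg_dim_ge ?K (set ys) (Suc \<kappa>)" using R distinct_card[OF ys(2)] by auto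
      then show ?thesis using le[OF ys(2)] ys(4) by simp
    qed
    moreover have sV: "?s zs \<in> V" unfolding V_def using zs F by blast
    moreover have "\<kappa> \<le> ?s zs" using ge[OF zs(1)] F zs by simp
    ultimately have "?s zs = \<kappa>" by (simp add: antisym)
    then show "\<kappa> \<in> V \<and> (\<forall>v\<in>V. v \<le> \<kappa>)" using sV \<open>\<And>v. v \<in> V \<Longrightarrow> v \<le> \<kappa>\<close> by auto
  qed
  finally show ?thesis .
qed

text \<open>Adding points never lowers the index, and \<kappa> bounds it, so the maximum is constant
  from the size of one extremal set on.\<close>

lemma in_S_kappa_imp_k_num_stable:
  assumes X: "infinite X" and S: "in_S_kappa \<kappa> X f"
  shows "\<exists>n. k_num X f n = \<kappa> \<and> k_num X f (n + 3) = \<kappa>"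
proof -
  let ?K = "pick f"
  obtain F where F: "finite F" "F \<subseteq> X" "neg_dim_ge ?K F \<kappa>"
    and up: "\<And>F. finite F \<Longrightarrow> F \<subseteq> X \<Longrightarrow> \<not> neg_dim_ge ?K F (Suc \<kappa>)"
    using S unfolding in_S_kappa_iff by blast
  have "k_num X f m = \<kappa>" if m: "card F \<le> m" for m
  proof -
    obtain F' where F': "finite F'" "F \<subseteq> F'" "F' \<subseteq> X" "card F' = m"
      using extend_finite_set_to_card[OF X F(1,2) m] by blast
    have "neg_dim_ge ?K F' \<kappa>" by (rule neg_dim_ge_mono_set[OF F(3) F'(2,1)])
    then show ?thesis unfolding k_num_eq_iff[OF X] using up F' by blast
  qed
  then show ?thesis by (intro exI[of _ "card F"]) auto
qed

text \<open>The hypothesis concerns sets of exactly n + 3 points; smaller sets are enlarged, which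
  keeps their negative subspaces.\<close>

lemma k_num_stable_imp_standard_pair:
  assumes L: "discrete_in_disk L"
    and k: "k_num (unit_disk - L) f n = \<kappa>" "k_num (unit_disk - L) f (n + 3) = \<kappa>"
  shows "\<exists>S M. standard_pair (unit_disk - L) (\<lambda>_. 1) f S M \<and>
    size M + card (jump_set (unit_disk - L) (\<lambda>_. 1) f S M) = \<kappa>"
proof -
  let ?X = "unit_disk - L"
  let ?K = "pick f"
  have X: "infinite ?X" by (rule infinite_disk_minus_discrete[OF L])
  obtain F where F: "finite F" "F \<subseteq> ?X" "card F = n" "neg_dim_ge ?K F \<kappa>"
    using k(1) unfolding k_num_eq_iff[OF X] by blast
  have up: "\<not> neg_dim_ge ?K G (Suc \<kappa>)" if G: "finite G" "G \<subseteq> ?X" "card G \<le> n + 3" for G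
  proof
    assume neg: "neg_dim_ge ?K G (Suc \<kappa>)"
    obtain G' where G': "finite G'" "G \<subseteq> G'" "G' \<subseteq> ?X" "card G' = n + 3"
      using extend_finite_set_to_card[OF X G] by blast
    have "neg_dim_ge ?K G' (Suc \<kappa>)" by (rule neg_dim_ge_mono_set[OF neg G'(2,1)])
    then show False using k(2) G' unfolding k_num_eq_iff[OF X] by blast
  qed
  show ?thesis
    by (rule stable_negative_index_imp_standard[OF L _ F up]) auto
qed

text \<open>The lower bound on the negative index of a standard function is not proved by exhibiting a
  negative subspace: the index is finite by the upper bound, hence determines a standard
  representation with the right count, and that representation is unique.\<close>

lemma standard_pair_imp_in_S_kappa:
  assumes L: "discrete_in_disk L" and std: "standard_pair (unit_disk - L) (\<lambda>_. 1) f S M"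
  shows "in_S_kappa (size M + card (jump_set (unit_disk - L) (\<lambda>_. 1) f S M)) (unit_disk - L) f"
proof -
  let ?X = "unit_disk - L" and ?K = "pick f"
  define m where "m = size M + card (jump_set ?X (\<lambda>_. 1) f S M)"
  have X: "infinite ?X" by (rule infinite_disk_minus_discrete[OF L])
  define P where "P k \<longleftrightarrow> (\<exists>F. finite F \<and> F \<subseteq> ?X \<and> neg_dim_ge ?K F k)" for k
  have P0: "P 0" unfolding P_def by (intro exI[of _ "{}"]) auto
  have Pm: "k \<le> m" if "P k" for k
  proof (rule ccontr)
    assume "\<not> k \<le> m"
    obtain F where F: "finite F" "F \<subseteq> ?X" "neg_dim_ge ?K F k" using \<open>P k\<close> unfolding P_def by blast
    have "neg_dim_ge ?K F (Suc m)" by (rule neg_dim_ge_decrease[OF F(3)]) (use \<open>\<not> k \<le> m\<close> in simp)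
    then show False using neg_dim_standard_pair_le[OF std _ F(1,2)] unfolding m_def by auto
  qed
  define k where "k = (GREATEST k. P k)"
  have Pk: "P k" and Pmax: "\<And>j. P j \<Longrightarrow> j \<le> k"
    unfolding k_def using P0 Pm by (blast intro: GreatestI_nat Greatest_le_nat)+
  have "\<not> P (Suc k)" using Pmax[of "Suc k"] by auto
  then have S: "in_S_kappa k ?X f"
    unfolding in_S_kappa_iff using Pk unfolding P_def by blast
  then obtain S' M' where std': "standard_pair ?X (\<lambda>_. 1) f S' M'"
    and k': "size M' + card (jump_set ?X (\<lambda>_. 1) f S' M') = k"
    using in_S_kappa_imp_k_num_stable[OF X S] k_num_stable_imp_standard_pair[OF L] by blast
  have "M = M'" "jump_set ?X (\<lambda>_. 1) f S M = jump_set ?X (\<lambda>_. 1) f S' M'"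
    using standard_pair_unique[OF L _ std std'] by auto
  then have "m = k" using k' by (simp add: m_def)
  then show ?thesis using S m_def by simp
qed

theorem theorem1p4:
  fixes L :: "complex set" and f :: "complex \<Rightarrow> complex" and \<kappa> :: nat
  assumes "discrete_in_disk L"
  shows "(in_S_kappa \<kappa> (unit_disk - L) f
           \<longleftrightarrow> (\<exists>l\<le>\<kappa>. \<exists>g W Z gamma B S.
                 standard_function g W Z gamma B S (\<kappa> - l) \<and> card Z = l \<and>
                 W \<subseteq> L \<and> (\<forall>z\<in>unit_disk - L. g z = f z) \<and> Z \<inter> L = {}))
       \<and> (in_S_kappa \<kappa> (unit_disk - L) f
           \<longleftrightarrow> (\<exists>n. k_num (unit_disk - L) f n = \<kappa> \<and> k_num (unit_disk - L) f (n + 3) = \<kappa>))"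
proof -
  \<comment> \<open>The implications form a cycle: membership in the class, stability of the numbers
    k_n, standard representation, membership.\<close>
  let ?STD = "\<exists>S M. standard_pair (unit_disk - L) (\<lambda>_. 1) f S M \<and>
        size M + card (jump_set (unit_disk - L) (\<lambda>_. 1) f S M) = \<kappa>"
  have "in_S_kappa \<kappa> (unit_disk - L) f \<Longrightarrow>
     \<exists>n. k_num (unit_disk - L) f n = \<kappa> \<and> k_num (unit_disk - L) f (n + 3) = \<kappa>"
    by (rule in_S_kappa_imp_k_num_stable[OF infinite_disk_minus_discrete[OF assms]])
  moreover have "\<exists>n. k_num (unit_disk - L) f n = \<kappa> \<and> k_num (unit_disk - L) f (n + 3) = \<kappa> \<Longrightarrow> ?STD"
    using k_num_stable_imp_standard_pair[OF assms] by blast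
  moreover have "?STD \<Longrightarrow> in_S_kappa \<kappa> (unit_disk - L) f"
    using standard_pair_imp_in_S_kappa[OF assms] by blast
  ultimately show ?thesis unfolding standard_function_iff_standard_pair by blast
qed

end
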